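(* Let $n\ge 1$. An algebra $\mathbf A$ is an $n$-generated projective Wajsberg hoop if and only if it is isomorphic to $\mathcal{W}(\mathscr P)$ for some pointed $\mathbb{Z}$-retract $\mathscr P$ of $[0,1]^{n}$.
   Context: A Wajsberg hoop is an algebra $(A,\cdot,\to,1)$ with $(A,\cdot,1)$ a commutative monoid satisfying $x\to x=1$, $x\cdot(x\to y)=y\cdot(y\to x)$, $(x\cdot y)\to z=x\to(y\to z)$, and $(x\to y)\to y=(y\to x)\to x$; it is lattice-ordered by $x\le y$ iff $x\to y=1$, with $x\wedge y=x\cdot(x\to y)$, $x\vee y=(x\to y)\to y$. The variety of Wajsberg hoops is $\mathsf{WH}$. An algebra is $n$-generated if it is generated by $n$ (not necessarily distinct) elements. "Projective" means projective in $\mathsf{WH}$: $\mathbf P\in\mathsf{WH}$ is projective if for all $\mathbf A,\mathbf B\in\mathsf{WH}$, every homomorphism $f:\mathbf P\to\mathbf A$ and every surjective homomorphism $g:\mathbf B\to\mathbf A$, there is a homomorphism $h:\mathbf P\to\mathbf B$ with $f=g\circ h$ (equivalently, $\mathbf P$ is a retract of a free Wajsberg hoop). A Wajsberg function on $[0,1]^n$ is a continuous function $f:[0,1]^n\to[0,1]$ that is piecewise (affine) linear with integer coefficients and satisfies $f(\mathbf 1)=1$, where $\mathbf 1=(1,\dots,1)$. For $\mathscr P\subseteq[0,1]^n$ containing $\mathbf 1$, $\mathcal{W}(\mathscr P)$ is the Wajsberg hoop of restrictions to $\mathscr P$ of all Wajsberg functions on $[0,1]^n$, with pointwise operations induced by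 $x\cdot y=\max\{0,x+y-1\}$, $x\to y=\min\{1,1-x+y\}$ and constant $1$ on $[0,1]$. A $\mathbb{Z}$-map $[0,1]^n\to[0,1]^n$ is a continuous map each of whose components is piecewise (affine) linear with integer coefficients; it is pointed if it maps $\mathbf 1$ to $\mathbf 1$. A pointed $\mathbb{Z}$-retraction is a pointed $\mathbb{Z}$-map $\zeta:[0,1]^n\to[0,1]^n$ with $\zeta\circ\zeta=\zeta$; its image $\zeta([0,1]^n)$ is called a pointed $\mathbb{Z}$-retract of $[0,1]^n$. *)

theory Defs
  imports
    "HOL-Analysis.Analysis"
    "HOL-Algebra.Group"
    "HOL-Library.Infinite_Typeclass"
begin

record 'a hoop = "'a monoid" +
  himp :: "['a, 'a] \<Rightarrow> 'a" (infixr \<open>\<rightharpoonup>\<index>\<close> 65)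

text \<open>
  An algebra of signature \<open>(\<cdot>, \<rightarrow>, 1)\<close>, with no equations imposed: the carrier is
  closed under the operations.
\<close>
locale hoop_algebra =
  fixes A :: "('a, 'r) hoop_scheme" (structure)
  assumes hone_closed: "\<one> \<in> carrier A"
    and hmult_closed: "\<lbrakk>x \<in> carrier A; y \<in> carrier A\<rbrakk> \<Longrightarrow> x \<otimes> y \<in> carrier A"
    and himp_closed: "\<lbrakk>x \<in> carrier A; y \<in> carrier A\<rbrakk> \<Longrightarrow> x \<rightharpoonup> y \<in> carrier A"

locale wajsberg_hoop = hoop_algebra A + comm_monoid A
  for A :: "('a, 'r) hoop_scheme" (structure) +
  assumes imp_refl: "x \<in> carrier A \<Longrightarrow> x \<rightharpoonup> x = \<one>"
    and divisibility: "\<lbrakk>x \<in> carrier A; y \<in> carrier A\<rbrakk>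
      \<Longrightarrow> x \<otimes> (x \<rightharpoonup> y) = y \<otimes> (y \<rightharpoonup> x)"
    and imp_curry: "\<lbrakk>x \<in> carrier A; y \<in> carrier A; z \<in> carrier A\<rbrakk>
      \<Longrightarrow> (x \<otimes> y) \<rightharpoonup> z = x \<rightharpoonup> (y \<rightharpoonup> z)"
    and wajsberg: "\<lbrakk>x \<in> carrier A; y \<in> carrier A\<rbrakk>
      \<Longrightarrow> (x \<rightharpoonup> y) \<rightharpoonup> y = (y \<rightharpoonup> x) \<rightharpoonup> x"

definition hoop_hom ::
    "('a, 'r) hoop_scheme \<Rightarrow> ('b, 's) hoop_scheme \<Rightarrow> ('a \<Rightarrow> 'b) set" where
  "hoop_hom A B = {h \<in> hom A B. h \<one>\<^bsub>A\<^esub> = \<one>\<^bsub>B\<^esub> \<and>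
     (\<forall>x\<in>carrier A. \<forall>y\<in>carrier A. h (x \<rightharpoonup>\<^bsub>A\<^esub> y) = h x \<rightharpoonup>\<^bsub>B\<^esub> h y)}"

definition hoop_isomorphic ::
    "('a, 'r) hoop_scheme \<Rightarrow> ('b, 's) hoop_scheme \<Rightarrow> bool" where
  "hoop_isomorphic A B \<longleftrightarrow> (\<exists>h\<in>hoop_hom A B. bij_betw h (carrier A) (carrier B))"

inductive_set hoop_generate :: "('a, 'r) hoop_scheme \<Rightarrow> 'a set \<Rightarrow> 'a set"
  for A (structure) and S where
  one: "\<one> \<in> hoop_generate A S"
| incl: "x \<in> S \<Longrightarrow> x \<in> hoop_generate A S"
| mult: "\<lbrakk>x \<in> hoop_generate A S; y \<in> hoop_generate A S\<rbrakk>
    \<Longrightarrow> x \<otimes> y \<in> hoop_generate A S"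
| imp: "\<lbrakk>x \<in> hoop_generate A S; y \<in> hoop_generate A S\<rbrakk>
    \<Longrightarrow> x \<rightharpoonup> y \<in> hoop_generate A S"

definition n_generated :: "nat \<Rightarrow> ('a, 'r) hoop_scheme \<Rightarrow> bool" where
  "n_generated n A \<longleftrightarrow> (\<exists>xs. length xs = n \<and> set xs \<subseteq> carrier A \<and>
     hoop_generate A (set xs) = carrier A)"

text \<open>
  HOL cannot quantify over types inside a formula, so the types from which the carriers
  of the target \<open>A\<close> and of the covering algebra \<open>B\<close> are drawn are parameters. A theorem
  stated for arbitrary infinite types \<open>'b\<close> and \<open>'c\<close> covers all Wajsberg hoops: carriers
  are arbitrary subsets of the types, so an algebra over a finite type has copies over
  every infinite one. Finite types must be excluded, since the lifting property
  against hoops of bounded finite cardinality only would be too weak.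
\<close>
definition projective_hoop ::
    "'b itself \<Rightarrow> 'c itself \<Rightarrow> ('a, 'r) hoop_scheme \<Rightarrow> bool" where
  "projective_hoop _ _ P \<longleftrightarrow> wajsberg_hoop P \<and>
     (\<forall>(A :: 'b hoop) (B :: 'c hoop) f g.
        wajsberg_hoop A \<longrightarrow> wajsberg_hoop B \<longrightarrow>
        f \<in> hoop_hom P A \<longrightarrow> g \<in> hoop_hom B A \<longrightarrow> g ` carrier B = carrier A \<longrightarrow>
        (\<exists>h\<in>hoop_hom P B. \<forall>x\<in>carrier P. f x = g (h x)))"

definition unit_cube :: "(real ^ 'n) set" where
  "unit_cube = {x. \<forall>i. 0 \<le> x $ i \<and> x $ i \<le> 1}"

definition int_affine :: "(real ^ 'n \<Rightarrow> real) \<Rightarrow> bool" where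
  "int_affine p \<longleftrightarrow> (\<exists>(a :: 'n \<Rightarrow> int) (b :: int).
     p = (\<lambda>x. (\<Sum>i\<in>UNIV. of_int (a i) * x $ i) + of_int b))"

text \<open>
  Continuous and piecewise affine linear with integer coefficients, in the sense usual for
  McNaughton functions: finitely many integer affine functions such that at every point
  of the cube \<open>f\<close> agrees with one of them. For a continuous \<open>f\<close> the pieces can then be taken
  to be polytopes. Functions are total on \<open>real ^ 'n\<close>; only their values on the
  cube matter.
\<close>
definition int_pwl :: "(real ^ 'n \<Rightarrow> real) \<Rightarrow> bool" where
  "int_pwl f \<longleftrightarrow> continuous_on unit_cube f \<and>
     (\<exists>Q. finite Q \<and> (\<forall>p\<in>Q. int_affine p) \<and> (\<forall>x\<in>unit_cube. \<exists>p\<in>Q. f x = p x))"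

definition wajsberg_function :: "(real ^ 'n \<Rightarrow> real) \<Rightarrow> bool" where
  "wajsberg_function f \<longleftrightarrow> int_pwl f \<and> f ` unit_cube \<subseteq> {0..1} \<and> f 1 = 1"

text \<open>
  The operations of the standard algebra on \<open>[0,1]\<close>, applied pointwise. Restrictions to \<open>P\<close>
  are represented by functions that are \<open>undefined\<close> outside \<open>P\<close>, so that equality in the
  carrier is equality on \<open>P\<close>.
\<close>
definition wajsberg_algebra :: "(real ^ 'n) set \<Rightarrow> (real ^ 'n \<Rightarrow> real) hoop" where
  "wajsberg_algebra P = \<lparr>
     carrier = {restrict f P | f. wajsberg_function f},
     mult = (\<lambda>f g. \<lambda>x\<in>P. max 0 (f x + g x - 1)),
     one = (\<lambda>x\<in>P. 1),
     himp = (\<lambda>f g. \<lambda>x\<in>P. min 1 (1 - f x + g x))\<rparr>"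

definition z_map :: "(real ^ 'n \<Rightarrow> real ^ 'n) \<Rightarrow> bool" where
  "z_map \<zeta> \<longleftrightarrow> \<zeta> ` unit_cube \<subseteq> unit_cube \<and> (\<forall>i. int_pwl (\<lambda>x. \<zeta> x $ i))"

definition pointed_z_retraction :: "(real ^ 'n \<Rightarrow> real ^ 'n) \<Rightarrow> bool" where
  "pointed_z_retraction \<zeta> \<longleftrightarrow> z_map \<zeta> \<and> \<zeta> 1 = 1 \<and> (\<forall>x\<in>unit_cube. \<zeta> (\<zeta> x) = \<zeta> x)"

definition pointed_z_retract :: "(real ^ 'n) set \<Rightarrow> bool" where
  "pointed_z_retract P \<longleftrightarrow> (\<exists>\<zeta>. pointed_z_retraction \<zeta> \<and> P = \<zeta> ` unit_cube)"

end

(*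
The hoop of Wajsberg functions on the cube is the free Wajsberg hoop on the coordinate
projections.  Freeness combines McNaughton's theorem (every Wajsberg function is a term function)
with Chang's completeness theorem (a term equal to 1 throughout [0,1] is equal to 1 in every
Wajsberg hoop).  For the latter, a prime filter omitting the value of a term yields a totally
ordered quotient; truncating it at an element m below all values of subterms gives an MV-chain,
hence a totally ordered abelian group with strong unit.  The order which this group induces on the
finitely many integer vectors that describe the subterms is realised by a point of the cube, at
which the term is smaller than 1.

Projective n-generated hoops are then the retracts of the free hoop.  An endomorphism of the free
hoop is composition with a pointed Z-map, idempotent endomorphisms correspond to pointed
Z-retractions, and the image of the endomorphism is the hoop of restrictions to the retract.
The free hoop is countable, so lifting against hoops over arbitrary infinite types suffices.
*)
theory Submission
  imports Defs "HOL-Algebra.FiniteProduct"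
begin

section \<open>Arithmetic of Wajsberg hoops\<close>

text \<open>The signature has no constant 0, and this shapes both halves of freeness. A chain need
  not have a least element, so the truncation point \<open>m\<close> depends on the term and the
  valuation: it only has to lie below the finitely many values that occur, where the hoop operations
  agree with the truncated ones. For functions on the cube, negation 1 - f leaves the hoop;
  McNaughton's theorem is therefore proved for functions that are hoop terms up to negation, and the
  value at the vertex 1 decides between the two alternatives at the end. No embedding theorem for
  ordered groups enters. The order of Chang's group matters only on finitely many integer
  combinations of the generators and the strong unit, and finitely many sign conditions are realised
  by Fourier-Motzkin elimination. Each branch of a truncation is recorded as one such sign
  condition, which is what transfers the value of a term from the group to the cube. McNaughton's
  theorem is reached without a polyhedral subdivision: a max-min formula reduces it to continuity
  along a single segment.\<close>

context wajsberg_hoop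
begin

declare hone_closed [simp] hmult_closed [simp] himp_closed [simp] imp_refl [simp]

abbreviation hle (infix \<open>\<preceq>\<close> 50) where "x \<preceq> y \<equiv> x \<rightharpoonup> y = \<one>"

text \<open>The law 1 -> x = x is not among the axioms. With \<open>a\<close>, \<open>d\<close>,
  \<open>c\<close> as below, divisibility gives a = x d and x = a c, while d c = d; so x = x d c = x
  d = a.\<close>

lemma one_imp [simp]:
  assumes x: "x \<in> carrier A" shows "\<one> \<rightharpoonup> x = x"
proof -
  define a d c where "a = \<one> \<rightharpoonup> x" and "d = x \<rightharpoonup> \<one>" and "c = d \<rightharpoonup> \<one>"
  have cl: "a \<in> carrier A" "d \<in> carrier A" "c \<in> carrier A"
    using x by (simp_all add: a_def d_def c_def)
  have a: "a = x \<otimes> d" using divisibility[of x \<one>] x by (simp add: a_def d_def)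
  have "x \<rightharpoonup> a = \<one>" using imp_curry[of x \<one> x] x by (simp add: a_def)
  then have xa: "x = a \<otimes> (a \<rightharpoonup> x)" using divisibility[of a x] x cl by simp
  have "a \<rightharpoonup> x = c"
    using imp_curry[of d x x] a x cl by (simp add: m_comm c_def)
  moreover have "d \<otimes> c = d"
    using divisibility[of d \<one>] imp_curry[of \<one> x \<one>] x cl by (simp add: c_def d_def)
  ultimately show ?thesis using xa a x cl by (metis a_def m_assoc)
qed

text \<open>The Wajsberg identity for x and 1 gives (x -> 1) -> 1 = 1. Currying x (x -> 1) -> 1 in
  both orders of the factors then equates x -> 1 with 1.\<close>

lemma imp_one [simp]:
  assumes x: "x \<in> carrier A" shows "x \<rightharpoonup> \<one> = \<one>"
proof -
  have "(x \<rightharpoonup> \<one>) \<rightharpoonup> \<one> = \<one>" using wajsberg[of x \<one>] x by simp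
  then have "(x \<otimes> (x \<rightharpoonup> \<one>)) \<rightharpoonup> \<one> = x \<rightharpoonup> \<one>" using x by (simp add: imp_curry)
  moreover have "((x \<rightharpoonup> \<one>) \<otimes> x) \<rightharpoonup> \<one> = \<one>" using x by (simp add: imp_curry)
  ultimately show ?thesis using x by (simp add: m_comm)
qed

lemma hle_antisym:
  "\<lbrakk>x \<preceq> y; y \<preceq> x; x \<in> carrier A; y \<in> carrier A\<rbrakk> \<Longrightarrow> x = y"
  using divisibility[of x y] by simp

lemma imp_swap:
  "\<lbrakk>x \<in> carrier A; y \<in> carrier A; z \<in> carrier A\<rbrakk> \<Longrightarrow> x \<rightharpoonup> (y \<rightharpoonup> z) = y \<rightharpoonup> (x \<rightharpoonup> z)"
  by (metis imp_curry m_comm)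

lemma residuation:
  "\<lbrakk>x \<in> carrier A; y \<in> carrier A; z \<in> carrier A\<rbrakk> \<Longrightarrow> x \<otimes> y \<preceq> z \<longleftrightarrow> x \<preceq> y \<rightharpoonup> z"
  by (simp add: imp_curry)

lemma mult_le_left [simp]:
  "\<lbrakk>x \<in> carrier A; y \<in> carrier A\<rbrakk> \<Longrightarrow> x \<otimes> y \<preceq> x"
  by (simp add: imp_curry imp_swap[of x y x])

lemma mult_le_right [simp]:
  "\<lbrakk>x \<in> carrier A; y \<in> carrier A\<rbrakk> \<Longrightarrow> x \<otimes> y \<preceq> y"
  by (simp add: imp_curry)

lemma imp_ge [simp]:
  "\<lbrakk>x \<in> carrier A; y \<in> carrier A\<rbrakk> \<Longrightarrow> y \<preceq> x \<rightharpoonup> y"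
  by (simp add: imp_swap[of y x y])

lemma le_imp_factor:
  "\<lbrakk>x \<preceq> y; x \<in> carrier A; y \<in> carrier A\<rbrakk> \<Longrightarrow> y \<otimes> (y \<rightharpoonup> x) = x"
  using divisibility[of x y] by simp

text \<open>Divisibility writes x as y (y -> x), so x -> z curries to (y -> x) -> (y -> z).\<close>

lemma hle_trans:
  assumes "x \<preceq> y" "y \<preceq> z" "x \<in> carrier A" "y \<in> carrier A" "z \<in> carrier A"
  shows "x \<preceq> z"
proof -
  have "x \<rightharpoonup> z = (y \<otimes> (y \<rightharpoonup> x)) \<rightharpoonup> z" using assms le_imp_factor by simp
  also have "\<dots> = (y \<rightharpoonup> x) \<rightharpoonup> (y \<rightharpoonup> z)" using assms by (simp add: imp_curry imp_swap[of y])
  finally show ?thesis using assms by simp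
qed

lemma mult_mono_left:
  assumes "x \<preceq> y" "x \<in> carrier A" "y \<in> carrier A" "z \<in> carrier A"
  shows "x \<otimes> z \<preceq> y \<otimes> z"
proof -
  have "y \<preceq> z \<rightharpoonup> y \<otimes> z" using assms imp_curry[of y z "y \<otimes> z"] by simp
  then have "x \<preceq> z \<rightharpoonup> y \<otimes> z" using assms hle_trans by (meson hmult_closed himp_closed)
  then show ?thesis using assms by (simp add: imp_curry)
qed

lemma mult_mono_right:
  "\<lbrakk>x \<preceq> y; x \<in> carrier A; y \<in> carrier A; z \<in> carrier A\<rbrakk> \<Longrightarrow> z \<otimes> x \<preceq> z \<otimes> y"
  using mult_mono_left by (simp add: m_comm)

lemma modus_ponens [simp]:
  "\<lbrakk>x \<in> carrier A; y \<in> carrier A\<rbrakk> \<Longrightarrow> x \<otimes> (x \<rightharpoonup> y) \<preceq> y"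
  by (metis divisibility himp_closed mult_le_left)

lemma imp_mono:
  assumes "x \<preceq> y" "x \<in> carrier A" "y \<in> carrier A" "z \<in> carrier A"
  shows "z \<rightharpoonup> x \<preceq> z \<rightharpoonup> y"
proof -
  have "(z \<rightharpoonup> x) \<otimes> z \<preceq> x" using assms modus_ponens[of z x] by (simp add: m_comm)
  then have "(z \<rightharpoonup> x) \<otimes> z \<preceq> y" using assms hle_trans by (meson hmult_closed himp_closed)
  then show ?thesis using assms by (simp add: imp_curry)
qed

lemma imp_antimono:
  assumes "x \<preceq> y" "x \<in> carrier A" "y \<in> carrier A" "z \<in> carrier A"
  shows "y \<rightharpoonup> z \<preceq> x \<rightharpoonup> z"
proof -
  have "(y \<rightharpoonup> z) \<otimes> x \<preceq> (y \<rightharpoonup> z) \<otimes> y" using assms by (intro mult_mono_right) auto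
  moreover have "(y \<rightharpoonup> z) \<otimes> y \<preceq> z" using assms modus_ponens[of y z] by (simp add: m_comm)
  ultimately have "(y \<rightharpoonup> z) \<otimes> x \<preceq> z"
    using assms hle_trans by (meson hmult_closed himp_closed)
  then show ?thesis using assms by (simp add: imp_curry)
qed

lemma join_eq: "\<lbrakk>y \<preceq> x; x \<in> carrier A; y \<in> carrier A\<rbrakk> \<Longrightarrow> (x \<rightharpoonup> y) \<rightharpoonup> y = x"
  by (simp add: wajsberg[of x y])

lemma join_least:
  assumes "x \<preceq> z" "y \<preceq> z" "x \<in> carrier A" "y \<in> carrier A" "z \<in> carrier A"
  shows "(x \<rightharpoonup> y) \<rightharpoonup> y \<preceq> z"
proof -
  have "z \<rightharpoonup> y \<preceq> x \<rightharpoonup> y" using assms imp_antimono by simp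
  then have "(x \<rightharpoonup> y) \<rightharpoonup> y \<preceq> (z \<rightharpoonup> y) \<rightharpoonup> y" using assms imp_antimono by simp
  then show ?thesis using assms join_eq by simp
qed

text \<open>With p = x -> y, q = y -> x and j the join of x and y, one has y = p j and x = q j.
  Hence (p -> q) y = p (p -> q) j = q (q -> p) j = x (q -> p) lies below x. The resulting equation p
  -> q = q amounts to the join of p and q being 1.\<close>

lemma prelinearity:
  assumes x: "x \<in> carrier A" and y: "y \<in> carrier A"
  shows "(x \<rightharpoonup> y) \<rightharpoonup> (y \<rightharpoonup> x) = y \<rightharpoonup> x"
proof -
  let ?p = "x \<rightharpoonup> y" and ?q = "y \<rightharpoonup> x" and ?j = "(x \<rightharpoonup> y) \<rightharpoonup> y"
  have py: "y = ?p \<otimes> ?j" using x y le_imp_factor[of y ?p] by simp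
  have qx: "x = ?q \<otimes> ?j" using x y le_imp_factor[of x ?q] wajsberg[of x y] by simp
  have "(?p \<rightharpoonup> ?q) \<otimes> y = ?p \<otimes> (?p \<rightharpoonup> ?q) \<otimes> ?j"
    using x y by (subst py, simp add: m_ac)
  also have "\<dots> = (?q \<otimes> (?q \<rightharpoonup> ?p)) \<otimes> ?j" using x y divisibility[of ?p ?q] by simp
  also have "\<dots> = (?q \<otimes> ?j) \<otimes> (?q \<rightharpoonup> ?p)" using x y by (simp add: m_ac)
  also have "\<dots> = x \<otimes> (?q \<rightharpoonup> ?p)" using qx by simp
  finally have "(?p \<rightharpoonup> ?q) \<otimes> y \<preceq> x" using x y by simp
  then have "?p \<rightharpoonup> ?q \<preceq> ?q" using x y by (simp add: imp_curry)
  moreover have "?q \<preceq> ?p \<rightharpoonup> ?q" using x y imp_ge[of ?p ?q] by (simp only: himp_closed)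
  ultimately show ?thesis using x y hle_antisym by (meson himp_closed)
qed

text \<open>Both x and y lie below z -> c, hence so does their join, which is 1.\<close>

lemma mult_join_le:
  assumes "x \<otimes> z \<preceq> c" "y \<otimes> z \<preceq> c" "(x \<rightharpoonup> y) \<rightharpoonup> y = \<one>"
    and "x \<in> carrier A" "y \<in> carrier A" "z \<in> carrier A" "c \<in> carrier A"
  shows "z \<preceq> c"
proof -
  have "(x \<rightharpoonup> y) \<rightharpoonup> y \<preceq> z \<rightharpoonup> c"
    using assms by (intro join_least) (simp_all add: imp_curry)
  then show ?thesis using assms by simp
qed

end

section \<open>Prime filters and quotients\<close>

datatype 'v hterm = HVar 'v | HOne | HMul "'v hterm" "'v hterm" | HImp "'v hterm" "'v hterm"

instance hterm :: (countable) countable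
  by countable_datatype

primrec heval :: "('a, 'r) hoop_scheme \<Rightarrow> ('v \<Rightarrow> 'a) \<Rightarrow> 'v hterm \<Rightarrow> 'a" where
  "heval A b (HVar i) = b i"
| "heval A b HOne = \<one>\<^bsub>A\<^esub>"
| "heval A b (HMul s t) = heval A b s \<otimes>\<^bsub>A\<^esub> heval A b t"
| "heval A b (HImp s t) = heval A b s \<rightharpoonup>\<^bsub>A\<^esub> heval A b t"

lemma hoop_homD:
  assumes "h \<in> hoop_hom A B"
  shows "x \<in> carrier A \<Longrightarrow> h x \<in> carrier B"
    and "\<lbrakk>x \<in> carrier A; y \<in> carrier A\<rbrakk> \<Longrightarrow> h (x \<otimes>\<^bsub>A\<^esub> y) = h x \<otimes>\<^bsub>B\<^esub> h y"
    and "\<lbrakk>x \<in> carrier A; y \<in> carrier A\<rbrakk> \<Longrightarrow> h (x \<rightharpoonup>\<^bsub>A\<^esub> y) = h x \<rightharpoonup>\<^bsub>B\<^esub> h y"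
    and "h \<one>\<^bsub>A\<^esub> = \<one>\<^bsub>B\<^esub>"
  using assms by (auto simp: hoop_hom_def hom_def)

lemma hoop_homI:
  assumes "\<And>x. x \<in> carrier A \<Longrightarrow> h x \<in> carrier B"
    and "\<And>x y. \<lbrakk>x \<in> carrier A; y \<in> carrier A\<rbrakk> \<Longrightarrow> h (x \<otimes>\<^bsub>A\<^esub> y) = h x \<otimes>\<^bsub>B\<^esub> h y"
    and "\<And>x y. \<lbrakk>x \<in> carrier A; y \<in> carrier A\<rbrakk> \<Longrightarrow> h (x \<rightharpoonup>\<^bsub>A\<^esub> y) = h x \<rightharpoonup>\<^bsub>B\<^esub> h y"
    and "h \<one>\<^bsub>A\<^esub> = \<one>\<^bsub>B\<^esub>"
  shows "h \<in> hoop_hom A B"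
  using assms by (auto simp: hoop_hom_def hom_def)

lemma (in hoop_algebra) heval_closed:
  "(\<And>i. b i \<in> carrier A) \<Longrightarrow> heval A b t \<in> carrier A"
  by (induction t) (auto intro: hone_closed hmult_closed himp_closed)

lemma (in hoop_algebra) hom_heval:
  assumes h: "h \<in> hoop_hom A B" and b: "\<And>i. b i \<in> carrier A"
  shows "h (heval A b t) = heval B (\<lambda>i. h (b i)) t"
  by (induction t) (simp_all add: hoop_homD[OF h] heval_closed b)

lemma hoop_hom_compose:
  assumes "g \<in> hoop_hom A B" "h \<in> hoop_hom B C"
  shows "(\<lambda>x. h (g x)) \<in> hoop_hom A C"
  by (rule hoop_homI) (simp_all add: hoop_homD[OF assms(1)] hoop_homD[OF assms(2)])

text \<open>Identities pass to surjective images. This supplies the hoop laws for quotients, for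
  copies over another type and for algebras isomorphic to some W(P).\<close>

lemma (in wajsberg_hoop) hom_image_wajsberg:
  assumes h: "h \<in> hoop_hom A B" and surj: "h ` carrier A = carrier B"
  shows "wajsberg_hoop B"
proof -
  note hs = hoop_homD(2-4)[OF h, symmetric]
  have lift: "\<exists>u\<in>carrier A. x = h u" if "x \<in> carrier B" for x using that surj by auto
  have clB: "h u \<in> carrier B" if "u \<in> carrier A" for u using that surj by auto
  have one: "\<one>\<^bsub>B\<^esub> \<in> carrier B" using hs(3) clB by auto
  have two: "x \<otimes>\<^bsub>B\<^esub> y \<in> carrier B" "x \<rightharpoonup>\<^bsub>B\<^esub> y \<in> carrier B" "x \<otimes>\<^bsub>B\<^esub> y = y \<otimes>\<^bsub>B\<^esub> x"
    "x \<otimes>\<^bsub>B\<^esub> (x \<rightharpoonup>\<^bsub>B\<^esub> y) = y \<otimes>\<^bsub>B\<^esub> (y \<rightharpoonup>\<^bsub>B\<^esub> x)"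
    "(x \<rightharpoonup>\<^bsub>B\<^esub> y) \<rightharpoonup>\<^bsub>B\<^esub> y = (y \<rightharpoonup>\<^bsub>B\<^esub> x) \<rightharpoonup>\<^bsub>B\<^esub> x"
    if xy: "x \<in> carrier B" "y \<in> carrier B" for x y
  proof -
    obtain u v where uv: "u \<in> carrier A" "v \<in> carrier A" "x = h u" "y = h v" using xy lift by meson
    show "x \<otimes>\<^bsub>B\<^esub> y \<in> carrier B" "x \<rightharpoonup>\<^bsub>B\<^esub> y \<in> carrier B"
      using uv clB by (simp_all add: hs)
    show "x \<otimes>\<^bsub>B\<^esub> y = y \<otimes>\<^bsub>B\<^esub> x" using uv m_comm[of u v] by (simp add: hs)
    show "x \<otimes>\<^bsub>B\<^esub> (x \<rightharpoonup>\<^bsub>B\<^esub> y) = y \<otimes>\<^bsub>B\<^esub> (y \<rightharpoonup>\<^bsub>B\<^esub> x)"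
      using uv divisibility[of u v] by (simp add: hs)
    show "(x \<rightharpoonup>\<^bsub>B\<^esub> y) \<rightharpoonup>\<^bsub>B\<^esub> y = (y \<rightharpoonup>\<^bsub>B\<^esub> x) \<rightharpoonup>\<^bsub>B\<^esub> x"
      using uv wajsberg[of u v] by (simp add: hs)
  qed
  have three: "x \<otimes>\<^bsub>B\<^esub> y \<otimes>\<^bsub>B\<^esub> z = x \<otimes>\<^bsub>B\<^esub> (y \<otimes>\<^bsub>B\<^esub> z)"
    "x \<otimes>\<^bsub>B\<^esub> y \<rightharpoonup>\<^bsub>B\<^esub> z = x \<rightharpoonup>\<^bsub>B\<^esub> (y \<rightharpoonup>\<^bsub>B\<^esub> z)"
    if xyz: "x \<in> carrier B" "y \<in> carrier B" "z \<in> carrier B" for x y z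
  proof -
    obtain u v w where uv: "u \<in> carrier A" "v \<in> carrier A" "w \<in> carrier A"
      "x = h u" "y = h v" "z = h w" using xyz lift by meson
    show "x \<otimes>\<^bsub>B\<^esub> y \<otimes>\<^bsub>B\<^esub> z = x \<otimes>\<^bsub>B\<^esub> (y \<otimes>\<^bsub>B\<^esub> z)"
      using uv by (simp add: hs m_assoc)
    show "x \<otimes>\<^bsub>B\<^esub> y \<rightharpoonup>\<^bsub>B\<^esub> z = x \<rightharpoonup>\<^bsub>B\<^esub> (y \<rightharpoonup>\<^bsub>B\<^esub> z)"
      using uv by (simp add: hs imp_curry)
  qed
  have un: "\<one>\<^bsub>B\<^esub> \<otimes>\<^bsub>B\<^esub> x = x" "x \<rightharpoonup>\<^bsub>B\<^esub> x = \<one>\<^bsub>B\<^esub>" if x: "x \<in> carrier B" for x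
  proof -
    obtain u where u: "u \<in> carrier A" "x = h u" using x lift by meson
    show "\<one>\<^bsub>B\<^esub> \<otimes>\<^bsub>B\<^esub> x = x" "x \<rightharpoonup>\<^bsub>B\<^esub> x = \<one>\<^bsub>B\<^esub>" using u by (simp_all add: hs)
  qed
  have alg: "hoop_algebra B" by unfold_locales (fact one two)+
  have mon: "comm_monoid B" by (rule comm_monoidI) (fact one two three un)+
  show ?thesis
    by (intro wajsberg_hoop.intro wajsberg_hoop_axioms.intro) (fact alg mon two three un)+
qed

section \<open>Filters, their quotients, and prime filters\<close>

context wajsberg_hoop
begin

definition hfilter :: "'a set \<Rightarrow> bool" where
  "hfilter F \<longleftrightarrow> F \<subseteq> carrier A \<and> \<one> \<in> F \<and> (\<forall>x\<in>F. \<forall>y\<in>F. x \<otimes> y \<in> F) \<and>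
     (\<forall>x\<in>F. \<forall>y\<in>carrier A. x \<rightharpoonup> y = \<one> \<longrightarrow> y \<in> F)"

lemma hfilterI:
  assumes "F \<subseteq> carrier A" "\<one> \<in> F" "\<And>x y. \<lbrakk>x \<in> F; y \<in> F\<rbrakk> \<Longrightarrow> x \<otimes> y \<in> F"
    "\<And>x y. \<lbrakk>x \<in> F; y \<in> carrier A; x \<preceq> y\<rbrakk> \<Longrightarrow> y \<in> F"
  shows "hfilter F"
  using assms by (auto simp: hfilter_def)

lemma hfilterD:
  assumes "hfilter F"
  shows "x \<in> F \<Longrightarrow> x \<in> carrier A" "\<one> \<in> F"
    "\<lbrakk>x \<in> F; y \<in> F\<rbrakk> \<Longrightarrow> x \<otimes> y \<in> F"
    "\<lbrakk>x \<in> F; x \<preceq> y; y \<in> carrier A\<rbrakk> \<Longrightarrow> y \<in> F"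
  using assms by (auto simp: hfilter_def)

lemma mult_mono:
  assumes "x \<preceq> x'" "y \<preceq> y'"
    and "x \<in> carrier A" "x' \<in> carrier A" "y \<in> carrier A" "y' \<in> carrier A"
  shows "x \<otimes> y \<preceq> x' \<otimes> y'"
  using mult_mono_left[of x x' y] mult_mono_right[of y y' x'] assms
    hle_trans[of "x \<otimes> y" "x' \<otimes> y" "x' \<otimes> y'"] by simp

lemma imp_trans_le:
  assumes "x \<in> carrier A" "y \<in> carrier A" "z \<in> carrier A"
  shows "(x \<rightharpoonup> y) \<otimes> (y \<rightharpoonup> z) \<preceq> x \<rightharpoonup> z"
proof -
  have "x \<otimes> (x \<rightharpoonup> y) \<otimes> (y \<rightharpoonup> z) \<preceq> y \<otimes> (y \<rightharpoonup> z)" using assms by (intro mult_mono_left) auto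
  moreover have "y \<otimes> (y \<rightharpoonup> z) \<preceq> z" using assms by simp
  ultimately have "x \<otimes> (x \<rightharpoonup> y) \<otimes> (y \<rightharpoonup> z) \<preceq> z"
    using assms hle_trans by (meson hmult_closed himp_closed)
  then have "((x \<rightharpoonup> y) \<otimes> (y \<rightharpoonup> z)) \<otimes> x \<preceq> z" using assms by (simp add: m_ac)
  then show ?thesis using assms residuation by (meson hmult_closed himp_closed)
qed

lemma imp_mult_le:
  assumes "x \<in> carrier A" "y \<in> carrier A" "x' \<in> carrier A" "y' \<in> carrier A"
  shows "(x \<rightharpoonup> x') \<otimes> (y \<rightharpoonup> y') \<preceq> x \<otimes> y \<rightharpoonup> x' \<otimes> y'"
proof -
  have "x \<otimes> (x \<rightharpoonup> x') \<otimes> (y \<otimes> (y \<rightharpoonup> y')) \<preceq> x' \<otimes> y'" using assms by (intro mult_mono) auto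
  then have "((x \<rightharpoonup> x') \<otimes> (y \<rightharpoonup> y')) \<otimes> (x \<otimes> y) \<preceq> x' \<otimes> y'" using assms by (simp add: m_ac)
  then show ?thesis using assms residuation by (meson hmult_closed himp_closed)
qed

lemma imp_imp_le:
  assumes "x \<in> carrier A" "y \<in> carrier A" "x' \<in> carrier A" "y' \<in> carrier A"
  shows "(x' \<rightharpoonup> x) \<otimes> (y \<rightharpoonup> y') \<preceq> (x \<rightharpoonup> y) \<rightharpoonup> (x' \<rightharpoonup> y')"
proof -
  have "x' \<otimes> (x' \<rightharpoonup> x) \<otimes> (x \<rightharpoonup> y) \<preceq> x \<otimes> (x \<rightharpoonup> y)" using assms by (intro mult_mono_left) auto
  then have "x' \<otimes> (x' \<rightharpoonup> x) \<otimes> (x \<rightharpoonup> y) \<preceq> y"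
    using assms hle_trans[OF _ modus_ponens[of x y]] by simp
  then have "x' \<otimes> (x' \<rightharpoonup> x) \<otimes> (x \<rightharpoonup> y) \<otimes> (y \<rightharpoonup> y') \<preceq> y \<otimes> (y \<rightharpoonup> y')"
    using assms by (intro mult_mono_left) auto
  then have "x' \<otimes> (x' \<rightharpoonup> x) \<otimes> (x \<rightharpoonup> y) \<otimes> (y \<rightharpoonup> y') \<preceq> y'"
    using assms hle_trans[OF _ modus_ponens[of y y']] by simp
  then have "(((x' \<rightharpoonup> x) \<otimes> (y \<rightharpoonup> y')) \<otimes> (x \<rightharpoonup> y)) \<otimes> x' \<preceq> y'" using assms by (simp add: m_ac)
  then show ?thesis using assms residuation by (meson hmult_closed himp_closed)
qed

definition hrep :: "'a set \<Rightarrow> 'a \<Rightarrow> 'a" where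
  "hrep F x = (SOME y. y \<in> carrier A \<and> x \<rightharpoonup> y \<in> F \<and> y \<rightharpoonup> x \<in> F)"

text \<open>The quotient is carried by representatives, so that it lives over the same type.\<close>
definition hquot :: "'a set \<Rightarrow> 'a hoop" where
  "hquot F = \<lparr>carrier = hrep F ` carrier A, mult = (\<lambda>x y. hrep F (x \<otimes> y)),
     one = hrep F \<one>, himp = (\<lambda>x y. hrep F (x \<rightharpoonup> y))\<rparr>"

lemma hrep:
  assumes "hfilter F" "x \<in> carrier A"
  shows "hrep F x \<in> carrier A" "x \<rightharpoonup> hrep F x \<in> F" "hrep F x \<rightharpoonup> x \<in> F"
proof -
  have "x \<in> carrier A \<and> x \<rightharpoonup> x \<in> F \<and> x \<rightharpoonup> x \<in> F" using assms hfilterD by simp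
  then have "hrep F x \<in> carrier A \<and> x \<rightharpoonup> hrep F x \<in> F \<and> hrep F x \<rightharpoonup> x \<in> F"
    unfolding hrep_def by (rule someI)
  then show "hrep F x \<in> carrier A" "x \<rightharpoonup> hrep F x \<in> F" "hrep F x \<rightharpoonup> x \<in> F" by auto
qed

lemma hfilter_trans:
  assumes F: "hfilter F" and "x \<rightharpoonup> y \<in> F" "y \<rightharpoonup> z \<in> F"
    and "x \<in> carrier A" "y \<in> carrier A" "z \<in> carrier A"
  shows "x \<rightharpoonup> z \<in> F"
  using hfilterD(4)[OF F hfilterD(3)[OF F assms(2,3)] imp_trans_le] assms by simp

text \<open>For congruent x and y the two choice predicates are equivalent, so the chosen
  representatives are equal and not merely congruent.\<close>

lemma hrep_eq_iff:
  assumes F: "hfilter F" and x: "x \<in> carrier A" and y: "y \<in> carrier A"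
  shows "hrep F x = hrep F y \<longleftrightarrow> x \<rightharpoonup> y \<in> F \<and> y \<rightharpoonup> x \<in> F"
proof
  assume "hrep F x = hrep F y"
  then show "x \<rightharpoonup> y \<in> F \<and> y \<rightharpoonup> x \<in> F"
    using hfilter_trans[OF F] hrep[OF F x] hrep[OF F y] x y by metis
next
  assume xy: "x \<rightharpoonup> y \<in> F \<and> y \<rightharpoonup> x \<in> F"
  have "z \<in> carrier A \<and> x \<rightharpoonup> z \<in> F \<and> z \<rightharpoonup> x \<in> F \<longleftrightarrow> z \<in> carrier A \<and> y \<rightharpoonup> z \<in> F \<and> z \<rightharpoonup> y \<in> F" for z
    using hfilter_trans[OF F] xy x y by blast
  then show "hrep F x = hrep F y" by (simp add: hrep_def)
qed

lemma hrep_hom: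
  assumes F: "hfilter F" shows "hrep F \<in> hoop_hom A (hquot F)"
proof (rule hoop_homI)
  fix x y assume x: "x \<in> carrier A" and y: "y \<in> carrier A"
  note r = hrep[OF F x] hrep[OF F y]
  have up: "c \<in> F" if "a \<otimes> b \<preceq> c" "a \<in> F" "b \<in> F" "c \<in> carrier A" for a b c
    using hfilterD(3,4)[OF F] that by blast
  have "x \<otimes> y \<rightharpoonup> hrep F x \<otimes> hrep F y \<in> F" "hrep F x \<otimes> hrep F y \<rightharpoonup> x \<otimes> y \<in> F"
    using up[OF imp_mult_le] x y r by simp_all
  then show "hrep F (x \<otimes> y) = hrep F x \<otimes>\<^bsub>hquot F\<^esub> hrep F y"
    using x y r by (simp add: hquot_def hrep_eq_iff[OF F])
  have "(x \<rightharpoonup> y) \<rightharpoonup> (hrep F x \<rightharpoonup> hrep F y) \<in> F" "(hrep F x \<rightharpoonup> hrep F y) \<rightharpoonup> (x \<rightharpoonup> y) \<in> F"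
    using up[OF imp_imp_le] x y r by simp_all
  then show "hrep F (x \<rightharpoonup> y) = hrep F x \<rightharpoonup>\<^bsub>hquot F\<^esub> hrep F y"
    using x y r by (simp add: hquot_def hrep_eq_iff[OF F])
qed (auto simp: hquot_def)

lemma hquot_wajsberg: "hfilter F \<Longrightarrow> wajsberg_hoop (hquot F)"
  by (rule hom_image_wajsberg[OF hrep_hom]) (auto simp: hquot_def)

text \<open>If the join of p and q is 1, so is the join of p^n and q: one factor p is peeled off at
  a time by applying the induction hypothesis to p z. The covering property \<open>D\<close> is kept
  abstract so that the lemma applies a second time, with q in the role of p and p^n in the role of
  q.\<close>

lemma pow_join_le:
  assumes D: "\<And>z c. \<lbrakk>p \<otimes> z \<preceq> c; q \<otimes> z \<preceq> c; z \<in> carrier A; c \<in> carrier A\<rbrakk> \<Longrightarrow> z \<preceq> c"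
    and p: "p \<in> carrier A" and q: "q \<in> carrier A"
  shows "\<lbrakk>p [^] (n::nat) \<otimes> z \<preceq> c; q \<otimes> z \<preceq> c; z \<in> carrier A; c \<in> carrier A\<rbrakk> \<Longrightarrow> z \<preceq> c"
proof (induction n arbitrary: z)
  case (Suc n)
  have "p [^] n \<otimes> (p \<otimes> z) \<preceq> c" using Suc.prems p by (simp add: m_assoc)
  moreover have "q \<otimes> (p \<otimes> z) \<preceq> q \<otimes> z" using Suc.prems p q by (intro mult_mono_right) auto
  then have "q \<otimes> (p \<otimes> z) \<preceq> c" using Suc.prems(2-) p q hle_trans by (meson hmult_closed)
  ultimately have "p \<otimes> z \<preceq> c" using Suc.IH[of "p \<otimes> z"] Suc.prems p by simp
  then show ?case using D Suc.prems by blast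
qed simp

lemma pow_prelinearity_le:
  assumes x: "x \<in> carrier A" and y: "y \<in> carrier A" and z: "z \<in> carrier A" and c: "c \<in> carrier A"
    and 1: "(x \<rightharpoonup> y) [^] (n::nat) \<otimes> z \<preceq> c" and 2: "(y \<rightharpoonup> x) [^] (k::nat) \<otimes> z \<preceq> c"
  shows "z \<preceq> c"
proof -
  let ?p = "x \<rightharpoonup> y" and ?q = "y \<rightharpoonup> x"
  have D: "w \<preceq> d" if "?p \<otimes> w \<preceq> d" "?q \<otimes> w \<preceq> d" "w \<in> carrier A" "d \<in> carrier A" for w d
    using mult_join_le[of ?p w d ?q] prelinearity[OF x y] that x y by simp
  have D': "w \<preceq> d" if "?q \<otimes> w \<preceq> d" "?p [^] n \<otimes> w \<preceq> d" "w \<in> carrier A" "d \<in> carrier A" for w d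
    by (rule pow_join_le[OF D, where n = n]) (use that x y in simp_all)
  show ?thesis
    by (rule pow_join_le[OF D', where n = k]) (use 1 2 x y z c in simp_all)
qed

text \<open>A filter maximal among those omitting c is prime: if neither x -> y nor y -> x belonged
  to it, adjoining either one would bring in c, and prelinearity for powers would put c into the
  filter itself.\<close>

lemma prime_filter_exists:
  assumes c: "c \<in> carrier A" "c \<noteq> \<one>"
  obtains F where "hfilter F" "c \<notin> F"
    "\<And>x y. \<lbrakk>x \<in> carrier A; y \<in> carrier A\<rbrakk> \<Longrightarrow> x \<rightharpoonup> y \<in> F \<or> y \<rightharpoonup> x \<in> F"
proof -
  let ?S = "{F. hfilter F \<and> c \<notin> F}"
  have "\<exists>M\<in>?S. \<forall>X\<in>?S. M \<subseteq> X \<longrightarrow> X = M"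
  proof (rule subset_Zorn_nonempty)
    have "hfilter {\<one>}" by (rule hfilterI) auto
    then show "?S \<noteq> {}" using c by blast
  next
    fix C assume C: "C \<noteq> {}" "subset.chain ?S C"
    have fil: "hfilter F" "c \<notin> F" if "F \<in> C" for F using C that by (auto simp: subset.chain_def)
    have "hfilter (\<Union>C)"
    proof (rule hfilterI)
      show "\<Union>C \<subseteq> carrier A" using fil hfilterD(1) by blast
      show "\<one> \<in> \<Union>C" using C(1) fil hfilterD(2) by blast
    next
      fix x y assume "x \<in> \<Union>C" "y \<in> \<Union>C"
      then obtain F G where FG: "F \<in> C" "G \<in> C" "x \<in> F" "y \<in> G" by blast
      then have "F \<subseteq> G \<or> G \<subseteq> F" using C(2) by (auto simp: subset.chain_def)
      then obtain H where H: "H \<in> C" "x \<in> H" "y \<in> H" using FG by blast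
      then have "x \<otimes> y \<in> H" using hfilterD(3) fil(1) by simp
      then show "x \<otimes> y \<in> \<Union>C" using H by blast
    next
      fix x y assume xy: "x \<in> \<Union>C" "y \<in> carrier A" "x \<preceq> y"
      then obtain F where F: "F \<in> C" "x \<in> F" by blast
      then have "y \<in> F" using hfilterD(4)[OF fil(1)] xy by simp
      then show "y \<in> \<Union>C" using F by blast
    qed
    then show "\<Union>C \<in> ?S" using fil by blast
  qed
  then obtain M where M: "hfilter M" "c \<notin> M" and max: "\<And>X. \<lbrakk>hfilter X; c \<notin> X; M \<subseteq> X\<rbrakk> \<Longrightarrow> X = M"
    by blast
  \<comment> \<open>The set \<open>X\<close> below is the filter generated by M and p. Were no p^n f
    below c, it would strictly enlarge M and still omit c.\<close>
  have ext: "\<exists>f\<in>M. \<exists>n::nat. p [^] n \<otimes> f \<preceq> c" if p: "p \<in> carrier A" "p \<notin> M" for p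
  proof (rule ccontr)
    assume no: "\<not> (\<exists>f\<in>M. \<exists>n::nat. p [^] n \<otimes> f \<preceq> c)"
    define X where "X = {z \<in> carrier A. \<exists>f\<in>M. \<exists>n::nat. p [^] n \<otimes> f \<preceq> z}"
    have X: "z \<in> X" if "z \<in> carrier A" "f \<in> M" "p [^] (n::nat) \<otimes> f \<preceq> z" for z f n
      using that by (auto simp: X_def)
    have inM: "f \<in> carrier A" if "f \<in> M" for f using hfilterD(1)[OF M(1)] that by simp
    have MX: "M \<subseteq> X"
    proof
      fix f assume "f \<in> M"
      then show "f \<in> X" using X[of f f 0] inM[of f] by simp
    qed
    have "p \<in> X" using X[of p \<one> 1] p hfilterD(2)[OF M(1)] by simp
    have "hfilter X"
    proof (rule hfilterI)
      show "\<one> \<in> X" using MX hfilterD(2)[OF M(1)] by blast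
    next
      fix x y assume "x \<in> X" "y \<in> X"
      then obtain f n g k where fg: "f \<in> M" "g \<in> M" "p [^] (n::nat) \<otimes> f \<preceq> x" "p [^] (k::nat) \<otimes> g \<preceq> y"
        "x \<in> carrier A" "y \<in> carrier A" by (auto simp: X_def)
      have "(p [^] n \<otimes> f) \<otimes> (p [^] k \<otimes> g) \<preceq> x \<otimes> y" using fg p inM[of f] inM[of g] by (intro mult_mono) auto
      moreover have "(p [^] n \<otimes> f) \<otimes> (p [^] k \<otimes> g) = p [^] (n + k) \<otimes> (f \<otimes> g)"
        using fg p inM[of f] inM[of g] by (simp add: m_ac nat_pow_mult[symmetric])
      ultimately show "x \<otimes> y \<in> X" using X[of "x \<otimes> y" "f \<otimes> g" "n + k"] fg hfilterD(3)[OF M(1)] by simp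
    next
      fix x y assume xy: "x \<in> X" "y \<in> carrier A" "x \<preceq> y"
      then obtain f n where "f \<in> M" "p [^] (n::nat) \<otimes> f \<preceq> x" "x \<in> carrier A" by (auto simp: X_def)
      then show "y \<in> X" using X[of y f n] hle_trans[of "p [^] n \<otimes> f" x y] xy p inM[of f] by simp
    qed (auto simp: X_def)
    moreover have "c \<notin> X" using no by (auto simp: X_def)
    ultimately have "X = M" using max MX by blast
    then show False using p \<open>p \<in> X\<close> by simp
  qed
  have "x \<rightharpoonup> y \<in> M \<or> y \<rightharpoonup> x \<in> M" if x: "x \<in> carrier A" and y: "y \<in> carrier A" for x y
  proof (rule ccontr)
    assume no: "\<not> (x \<rightharpoonup> y \<in> M \<or> y \<rightharpoonup> x \<in> M)"
    obtain f and n :: nat where f: "f \<in> M" "(x \<rightharpoonup> y) [^] n \<otimes> f \<preceq> c" using ext[of "x \<rightharpoonup> y"] x y no by auto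
    obtain g and k :: nat where g: "g \<in> M" "(y \<rightharpoonup> x) [^] k \<otimes> g \<preceq> c" using ext[of "y \<rightharpoonup> x"] x y no by auto
    have cl: "f \<in> carrier A" "g \<in> carrier A" using f g hfilterD(1)[OF M(1)] by simp_all
    have "(x \<rightharpoonup> y) [^] n \<otimes> (f \<otimes> g) \<preceq> (x \<rightharpoonup> y) [^] n \<otimes> f" using x y cl by (intro mult_mono_right) auto
    then have "(x \<rightharpoonup> y) [^] n \<otimes> (f \<otimes> g) \<preceq> c"
      using hle_trans[OF _ f(2)] x y cl c by simp
    moreover have "(y \<rightharpoonup> x) [^] k \<otimes> (f \<otimes> g) \<preceq> (y \<rightharpoonup> x) [^] k \<otimes> g" using x y cl by (intro mult_mono_right) auto
    then have "(y \<rightharpoonup> x) [^] k \<otimes> (f \<otimes> g) \<preceq> c"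
      using hle_trans[OF _ g(2)] x y cl c by simp
    ultimately have "f \<otimes> g \<preceq> c" using pow_prelinearity_le[of x y "f \<otimes> g" c n k] x y cl c by simp
    moreover have "f \<otimes> g \<in> M" using f g hfilterD(3)[OF M(1)] by blast
    ultimately show False using hfilterD(4)[OF M(1)] M(2) c by blast
  qed
  then show ?thesis using that M by blast
qed

end

section \<open>Chang's group of a chain\<close>

locale truncated_wajsberg_chain = wajsberg_hoop +
  fixes m
  assumes m_closed [simp]: "m \<in> carrier A"
    and m_neq_one: "m \<noteq> \<one>"
    and chain: "\<lbrakk>x \<in> carrier A; y \<in> carrier A\<rbrakk> \<Longrightarrow> x \<rightharpoonup> y = \<one> \<or> y \<rightharpoonup> x = \<one>"
begin

text \<open>The interval above \<open>m\<close> is an MV-chain for the product truncated at \<open>m\<close>.\<close>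
definition above :: "'a set" where "above = {x \<in> carrier A. x \<rightharpoonup> m \<noteq> \<one>}"

abbreviation oplus (infixl \<open>\<boxplus>\<close> 65) where "x \<boxplus> y \<equiv> (x \<rightharpoonup> m) \<rightharpoonup> y"

lemma above_closed [simp]: "x \<in> above \<Longrightarrow> x \<in> carrier A"
  by (simp add: above_def)

lemma aboveD: "x \<in> above \<Longrightarrow> x \<rightharpoonup> m \<noteq> \<one>"
  by (simp add: above_def del: above_closed)

lemma above_ge: "x \<in> above \<Longrightarrow> m \<preceq> x"
  using chain[of x m] by (auto simp: above_def simp del: above_closed)

lemma one_above [simp]: "\<one> \<in> above"
  using m_neq_one by (simp add: above_def del: above_closed)

lemma above_upward:
  assumes "x \<in> above" "x \<preceq> y" "y \<in> carrier A" shows "y \<in> above"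
  using assms hle_trans[of x y m] by (auto simp: above_def simp del: above_closed)

lemma neg_neg: "x \<in> above \<Longrightarrow> (x \<rightharpoonup> m) \<rightharpoonup> m = x"
  by (simp add: above_ge join_eq)

lemma oplus_above:
  assumes "x \<in> above" "y \<in> above" shows "x \<boxplus> y \<in> above"
  using assms by (intro above_upward[OF assms(2)]) auto

lemma oplus_commute:
  assumes "x \<in> above" "y \<in> above" shows "x \<boxplus> y = y \<boxplus> x"
proof -
  have "x \<boxplus> y = (x \<rightharpoonup> m) \<rightharpoonup> ((y \<rightharpoonup> m) \<rightharpoonup> m)" using assms by (simp add: neg_neg)
  also have "\<dots> = (y \<rightharpoonup> m) \<rightharpoonup> ((x \<rightharpoonup> m) \<rightharpoonup> m)" using assms by (intro imp_swap) auto
  finally show ?thesis using assms by (simp add: neg_neg)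
qed

text \<open>With \<open>p = aw\<close> and \<open>d = (w \<rightarrow> aw) \<rightarrow> a\<close> one has \<open>pd = p\<close>, whence
  \<open>d \<or> (p \<rightarrow> m) = 1\<close>.\<close>
lemma cancel:
  assumes a: "a \<in> carrier A" and w: "w \<in> carrier A" and above: "a \<otimes> w \<rightharpoonup> m \<noteq> \<one>"
  shows "w \<rightharpoonup> a \<otimes> w = a"
proof -
  define p c where "p = a \<otimes> w" and "c = w \<rightharpoonup> p"
  define d where "d = c \<rightharpoonup> a"
  have cl: "p \<in> carrier A" "c \<in> carrier A" "d \<in> carrier A"
    using a w by (auto simp: p_def c_def d_def)
  have ac: "a \<preceq> c" using a w imp_curry[of a w p] by (simp add: c_def p_def)
  have cw: "w \<otimes> c = p"
    using a w cl le_imp_factor[of p w] by (simp add: c_def p_def)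
  have "a = c \<otimes> d" using a cl ac le_imp_factor by (simp add: d_def)
  then have "p = d \<otimes> (w \<otimes> c)" unfolding p_def using cl w by (simp add: m_ac)
  then have "p = d \<otimes> p" using cw by simp
  then have "d \<rightharpoonup> (p \<rightharpoonup> m) = p \<rightharpoonup> m" using cl imp_curry[of d p m] by simp
  then have "(d \<rightharpoonup> (p \<rightharpoonup> m)) \<rightharpoonup> (p \<rightharpoonup> m) = \<one>" using cl by simp
  then have "d = \<one> \<or> p \<rightharpoonup> m = \<one>"
  proof -
    assume j: "(d \<rightharpoonup> (p \<rightharpoonup> m)) \<rightharpoonup> (p \<rightharpoonup> m) = \<one>"
    consider "d \<preceq> p \<rightharpoonup> m" | "p \<rightharpoonup> m \<preceq> d" using chain cl by (meson m_closed himp_closed)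
    then show ?thesis
    proof cases
      case 1 then show ?thesis using j cl by simp
    next
      case 2 then show ?thesis using j cl join_eq[of "p \<rightharpoonup> m" d] by simp
    qed
  qed
  then have "d = \<one>" using above p_def by simp
  then show ?thesis using ac cl a hle_antisym[of a c] by (simp add: c_def d_def p_def)
qed

lemma not_above_iff:
  assumes "x \<in> carrier A" "y \<in> carrier A" shows "x \<otimes> y \<notin> above \<longleftrightarrow> x \<preceq> y \<rightharpoonup> m"
  using assms by (simp add: above_def residuation del: above_closed)

lemma cancelD:
  assumes "a \<in> carrier A" "w \<in> carrier A" "a \<otimes> w \<in> above" shows "w \<rightharpoonup> a \<otimes> w = a"
  using assms by (intro cancel) (auto simp: above_def simp del: above_closed)

text \<open>This and the next two lemmas are the cases of exchanging a and b in a + (b + c),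
  according to whether xz and yz stay above m. Here u -> m factors as z (z -> (u -> m)), and
  cancellation gives z -> vz = v; hence u \<boxplus> vz = uz \<boxplus> v, and commutativity of
  \<boxplus> finishes.\<close>

lemma oplus_mult_carry:
  assumes x: "x \<in> above" and y: "y \<in> above" and z: "z \<in> above"
    and xz: "x \<otimes> z \<in> above" and yz: "y \<otimes> z \<in> above"
  shows "x \<boxplus> (y \<otimes> z) = y \<boxplus> (x \<otimes> z)"
proof -
  have expand: "u \<boxplus> (v \<otimes> z) = (u \<otimes> z) \<boxplus> v"
    if u: "u \<in> above" and v: "v \<in> above" and uz: "u \<otimes> z \<in> above" and vz: "v \<otimes> z \<in> above" for u v
  proof -
    have "\<not> z \<preceq> u \<rightharpoonup> m"
      using uz u z by (metis aboveD above_closed m_closed imp_curry m_comm)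
    then have "u \<rightharpoonup> m \<preceq> z" using chain[of z "u \<rightharpoonup> m"] u z by auto
    then have f: "u \<rightharpoonup> m = z \<otimes> (z \<rightharpoonup> (u \<rightharpoonup> m))" using le_imp_factor u z by simp
    have "u \<boxplus> (v \<otimes> z) = (z \<otimes> (z \<rightharpoonup> (u \<rightharpoonup> m))) \<rightharpoonup> (v \<otimes> z)" using f by simp
    also have "\<dots> = (z \<rightharpoonup> (u \<rightharpoonup> m)) \<rightharpoonup> (z \<rightharpoonup> v \<otimes> z)"
      using u v z by (simp add: m_comm[of z] imp_curry)
    also have "\<dots> = (z \<rightharpoonup> (u \<rightharpoonup> m)) \<rightharpoonup> v" using cancelD v z vz by simp
    also have "z \<rightharpoonup> (u \<rightharpoonup> m) = u \<otimes> z \<rightharpoonup> m" using u z by (simp add: m_comm[of u] imp_curry)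
    finally show ?thesis .
  qed
  have "x \<boxplus> (y \<otimes> z) = (x \<otimes> z) \<boxplus> y" using expand assms by blast
  also have "\<dots> = y \<boxplus> (x \<otimes> z)" using oplus_commute assms by blast
  finally show ?thesis .
qed

text \<open>Since z lies below x -> m, multiplying x \<boxplus> z by x -> m gives back z. So y (x
  \<boxplus> z) times x -> m is yz, and the factor x -> m can be cancelled.\<close>

lemma oplus_mult_mixed:
  assumes x: "x \<in> above" and y: "y \<in> above" and z: "z \<in> above"
    and xz: "x \<otimes> z \<notin> above" and yz: "y \<otimes> z \<in> above"
  shows "y \<otimes> (x \<boxplus> z) = x \<boxplus> (y \<otimes> z)"
    and "y \<otimes> (x \<boxplus> z) \<in> above"
proof -
  let ?X = "x \<rightharpoonup> m"
  have "z \<preceq> ?X" using xz x z not_above_iff[of z x] by (simp add: m_comm)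
  then have z': "?X \<otimes> (?X \<rightharpoonup> z) = z" using le_imp_factor x z by simp
  have "(y \<otimes> (x \<boxplus> z)) \<otimes> ?X = y \<otimes> (?X \<otimes> (?X \<rightharpoonup> z))" using x y z by (simp add: m_ac)
  then have e: "(y \<otimes> (x \<boxplus> z)) \<otimes> ?X = y \<otimes> z" using z' by simp
  then have "?X \<rightharpoonup> (y \<otimes> (x \<boxplus> z)) \<otimes> ?X = y \<otimes> (x \<boxplus> z)"
    using x y z yz by (intro cancelD) auto
  then show "y \<otimes> (x \<boxplus> z) = x \<boxplus> (y \<otimes> z)" using e by simp
  have "y \<otimes> z \<preceq> y \<otimes> (x \<boxplus> z)" using x y z by (intro mult_mono_right) auto
  then show "y \<otimes> (x \<boxplus> z) \<in> above" using above_upward[OF yz] x y z by simp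
qed

text \<open>As z lies below x -> m, the latter equals ((x -> m) -> z) -> z, and likewise for y.
  After this substitution the negations of the two products agree by exchange of premises.
  Membership is settled beforehand because \<open>neg_neg\<close> speaks of elements of
  \<open>above\<close>.\<close>

lemma mult_oplus_carry:
  assumes x: "x \<in> above" and y: "y \<in> above" and z: "z \<in> above"
    and xz: "x \<otimes> z \<notin> above" and yz: "y \<otimes> z \<notin> above"
  shows "x \<otimes> (y \<boxplus> z) \<in> above \<longleftrightarrow> y \<otimes> (x \<boxplus> z) \<in> above"
    and "x \<otimes> (y \<boxplus> z) \<in> above \<Longrightarrow> x \<otimes> (y \<boxplus> z) = y \<otimes> (x \<boxplus> z)"
proof -
  have zle: "z \<preceq> u \<rightharpoonup> m" if "u \<in> above" "u \<otimes> z \<notin> above" for u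
    using that z not_above_iff[of z u] by (simp add: m_comm)
  have half: "v \<otimes> (u \<boxplus> z) \<notin> above"
    if u: "u \<in> above" and v: "v \<in> above" and uz: "u \<otimes> z \<notin> above" and vz: "v \<otimes> z \<notin> above"
      and "u \<otimes> (v \<boxplus> z) \<notin> above" for u v
  proof -
    have "v \<boxplus> z \<preceq> u \<rightharpoonup> m" using that z not_above_iff[of "v \<boxplus> z" u] by (simp add: m_comm)
    then have "u \<boxplus> z \<preceq> (v \<boxplus> z) \<rightharpoonup> z" using u v z by (intro imp_antimono) auto
    then have "u \<boxplus> z \<preceq> v \<rightharpoonup> m" using zle[OF v vz] join_eq v z by simp
    then show ?thesis using u v z not_above_iff[of "u \<boxplus> z" v] by (simp add: m_comm)
  qed
  show iff: "x \<otimes> (y \<boxplus> z) \<in> above \<longleftrightarrow> y \<otimes> (x \<boxplus> z) \<in> above"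
    using half assms by blast
  assume a: "x \<otimes> (y \<boxplus> z) \<in> above"
  have neg: "u \<otimes> (v \<boxplus> z) \<rightharpoonup> m = (v \<boxplus> z) \<rightharpoonup> (u \<rightharpoonup> m)" if "u \<in> above" "v \<in> above" for u v
    using that z by (simp add: m_comm[of u] imp_curry)
  let ?X = "x \<rightharpoonup> m" and ?Y = "y \<rightharpoonup> m"
  have "y \<otimes> (x \<boxplus> z) \<rightharpoonup> m = (?X \<rightharpoonup> z) \<rightharpoonup> ((?Y \<rightharpoonup> z) \<rightharpoonup> z)"
    using neg[OF y x] join_eq[OF zle[OF y yz]] y z by simp
  also have "\<dots> = (?Y \<rightharpoonup> z) \<rightharpoonup> ((?X \<rightharpoonup> z) \<rightharpoonup> z)" using x y z by (intro imp_swap) auto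
  also have "\<dots> = x \<otimes> (y \<boxplus> z) \<rightharpoonup> m"
    using neg[OF x y] join_eq[OF zle[OF x xz]] x z by simp
  finally show "x \<otimes> (y \<boxplus> z) = y \<otimes> (x \<boxplus> z)"
    using neg_neg a iff by metis
qed

text \<open>\<open>(k, x)\<close> stands for \<open>k + x - 1\<close>, where \<open>m\<close> and \<open>1\<close> play the parts of \<open>0\<close> and \<open>1\<close>.\<close>
definition chang_group :: "(int \<times> 'a) monoid" where
  "chang_group = \<lparr>carrier = UNIV \<times> above,
     mult = (\<lambda>(k, x) (l, y). if x \<otimes> y \<in> above then (k + l, x \<otimes> y) else (k + l - 1, x \<boxplus> y)),
     one = (0, \<one>)\<rparr>"

section \<open>Group laws and order for the pairs\<close>

abbreviation cadd (infixl \<open>\<oplus>\<^sub>c\<close> 70) where "cadd \<equiv> mult chang_group"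

lemma cadd_simp:
  "(k, x) \<oplus>\<^sub>c (l, y) = (if x \<otimes> y \<in> above then (k + l, x \<otimes> y) else (k + l - 1, x \<boxplus> y))"
  by (simp add: chang_group_def)

lemma carrier_chang: "carrier chang_group = UNIV \<times> above"
  by (simp add: chang_group_def)

lemma cadd_commute:
  assumes "a \<in> carrier chang_group" "b \<in> carrier chang_group"
  shows "a \<oplus>\<^sub>c b = b \<oplus>\<^sub>c a"
  using assms m_comm[of "snd a" "snd b"] oplus_commute[of "snd a" "snd b"]
  by (cases a; cases b) (simp add: carrier_chang cadd_simp)

text \<open>This form is symmetric in a and b, unlike associativity: only the carries in x + z and y
  + z have to be distinguished, and the two mixed cases mirror each other.\<close>

lemma cadd_left_commute:
  assumes "a \<in> carrier chang_group" "b \<in> carrier chang_group" "c \<in> carrier chang_group"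
  shows "a \<oplus>\<^sub>c (b \<oplus>\<^sub>c c) = b \<oplus>\<^sub>c (a \<oplus>\<^sub>c c)"
proof -
  obtain k x l y j z where abc: "a = (k, x)" "b = (l, y)" "c = (j, z)"
    using prod.exhaust by metis
  then have xyz: "x \<in> above" "y \<in> above" "z \<in> above" using assms by (auto simp: carrier_chang)
  have assoc: "x \<otimes> (y \<otimes> z) = y \<otimes> (x \<otimes> z)" using xyz by (simp add: m_lcomm)
  have swap: "x \<boxplus> (y \<boxplus> z) = y \<boxplus> (x \<boxplus> z)" using xyz by (intro imp_swap) auto
  \<comment> \<open>A triple product above m forces both partial products above m; this decides the
    outer carry in the mixed cases.\<close>
  have below: "x \<otimes> (y \<otimes> z) \<notin> above" "y \<otimes> (x \<otimes> z) \<notin> above" if "x \<otimes> z \<notin> above \<or> y \<otimes> z \<notin> above"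
  proof -
    have "x \<otimes> (y \<otimes> z) \<preceq> y \<otimes> z" using xyz by simp
    moreover have "x \<otimes> (y \<otimes> z) \<preceq> x \<otimes> z" unfolding assoc using xyz by simp
    ultimately show "x \<otimes> (y \<otimes> z) \<notin> above"
      using that xyz above_upward by (meson above_closed hmult_closed)
    then show "y \<otimes> (x \<otimes> z) \<notin> above" unfolding assoc .
  qed
  have bc: "b \<oplus>\<^sub>c c = (if y \<otimes> z \<in> above then (l + j, y \<otimes> z) else (l + j - 1, y \<boxplus> z))"
    and ac: "a \<oplus>\<^sub>c c = (if x \<otimes> z \<in> above then (k + j, x \<otimes> z) else (k + j - 1, x \<boxplus> z))"
    by (simp_all only: abc cadd_simp)
  consider (nn) "x \<otimes> z \<in> above" "y \<otimes> z \<in> above" | (nc) "x \<otimes> z \<in> above" "y \<otimes> z \<notin> above"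
    | (cn) "x \<otimes> z \<notin> above" "y \<otimes> z \<in> above" | (cc) "x \<otimes> z \<notin> above" "y \<otimes> z \<notin> above" by blast
  then show ?thesis
  proof cases
    case nn
    then have "x \<boxplus> (y \<otimes> z) = y \<boxplus> (x \<otimes> z)" using oplus_mult_carry xyz by blast
    then show ?thesis
      unfolding bc ac if_P[OF nn(1)] if_P[OF nn(2)] unfolding abc cadd_simp assoc by simp
  next
    case nc
    then have "x \<otimes> (y \<boxplus> z) = y \<boxplus> (x \<otimes> z)" "x \<otimes> (y \<boxplus> z) \<in> above" "y \<otimes> (x \<otimes> z) \<notin> above"
      using oplus_mult_mixed xyz below by blast+
    then show ?thesis
      unfolding bc ac if_P[OF nc(1)] if_not_P[OF nc(2)] unfolding abc cadd_simp by simp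
  next
    case cn
    then have "y \<otimes> (x \<boxplus> z) = x \<boxplus> (y \<otimes> z)" "y \<otimes> (x \<boxplus> z) \<in> above" "x \<otimes> (y \<otimes> z) \<notin> above"
      using oplus_mult_mixed xyz below by blast+
    then show ?thesis
      unfolding bc ac if_not_P[OF cn(1)] if_P[OF cn(2)] unfolding abc cadd_simp by simp
  next
    case cc
    note eqs = mult_oplus_carry[OF xyz cc]
    show ?thesis
    proof (cases "x \<otimes> (y \<boxplus> z) \<in> above")
      case True
      then show ?thesis using eqs
        unfolding bc ac if_not_P[OF cc(1)] if_not_P[OF cc(2)] unfolding abc cadd_simp by simp
    next
      case False
      then show ?thesis using eqs(1) swap
        unfolding bc ac if_not_P[OF cc(1)] if_not_P[OF cc(2)] unfolding abc cadd_simp by simp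
    qed
  qed
qed

lemma cadd_closed:
  assumes "a \<in> carrier chang_group" "b \<in> carrier chang_group"
  shows "a \<oplus>\<^sub>c b \<in> carrier chang_group"
  using assms by (cases a; cases b) (auto simp: carrier_chang cadd_simp oplus_above)

text \<open>Associativity holds since translations commute.\<close>
lemma cadd_assoc:
  assumes "a \<in> carrier chang_group" "b \<in> carrier chang_group" "c \<in> carrier chang_group"
  shows "a \<oplus>\<^sub>c b \<oplus>\<^sub>c c = a \<oplus>\<^sub>c (b \<oplus>\<^sub>c c)"
proof -
  have "a \<oplus>\<^sub>c b \<oplus>\<^sub>c c = c \<oplus>\<^sub>c (a \<oplus>\<^sub>c b)" using assms by (simp add: cadd_commute cadd_closed)
  also have "\<dots> = a \<oplus>\<^sub>c (c \<oplus>\<^sub>c b)" using assms by (intro cadd_left_commute)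
  also have "c \<oplus>\<^sub>c b = b \<oplus>\<^sub>c c" using assms by (simp add: cadd_commute)
  finally show ?thesis .
qed

lemma one_chang: "\<one>\<^bsub>chang_group\<^esub> = (0, \<one>)"
  by (simp add: chang_group_def)

lemma chang_comm_group: "comm_group chang_group"
proof (rule comm_groupI)
  fix a assume a: "a \<in> carrier chang_group"
  obtain k x where kx: "a = (k, x)" "x \<in> above" using a by (auto simp: carrier_chang)
  show "\<one>\<^bsub>chang_group\<^esub> \<oplus>\<^sub>c a = a" using kx by (simp add: one_chang cadd_simp)
  show "\<exists>b\<in>carrier chang_group. b \<oplus>\<^sub>c a = \<one>\<^bsub>chang_group\<^esub>"
  proof (cases "x = \<one>")
    case True
    then show ?thesis using kx
      by (intro bexI[of _ "(- k, \<one>)"]) (auto simp: one_chang cadd_simp carrier_chang)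
  next
    case False
    then have "x \<rightharpoonup> m \<in> above" using kx neg_neg[of x] by (auto simp: above_def simp del: above_closed)
    moreover have "(x \<rightharpoonup> m) \<otimes> x \<notin> above"
      using kx modus_ponens[of x m] by (simp add: above_def m_comm del: above_closed)
    \<comment> \<open>The negative of k + x - 1 is (1 - k) + (1 - x) - 1, where x -> m plays the
      part of 1 - x.\<close>
    ultimately show ?thesis using kx neg_neg[of x]
      by (intro bexI[of _ "(1 - k, x \<rightharpoonup> m)"]) (auto simp: one_chang cadd_simp carrier_chang)
  qed
next
  show "\<one>\<^bsub>chang_group\<^esub> \<in> carrier chang_group" by (simp add: one_chang carrier_chang)
qed (fact cadd_closed cadd_assoc cadd_commute)+

text \<open>For x strictly above m and at most 1, the element k + x - 1 lies strictly above k - 1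
  and at most at k. These ranges are disjoint for different k, so the order is lexicographic. Hence
  also the exclusion of m from \<open>above\<close>: (k, m) would duplicate (k - 1, 1).\<close>

definition cle where "cle a b \<longleftrightarrow> fst a < fst b \<or> fst a = fst b \<and> snd a \<rightharpoonup> snd b = \<one>"

lemma cle_total:
  "\<lbrakk>a \<in> carrier chang_group; b \<in> carrier chang_group\<rbrakk> \<Longrightarrow> cle a b \<or> cle b a"
  using chain[of "snd a" "snd b"] by (auto simp: cle_def carrier_chang)

lemma cle_antisym:
  assumes "cle a b" "cle b a" "a \<in> carrier chang_group" "b \<in> carrier chang_group"
  shows "a = b"
proof -
  have "fst a = fst b" "snd a \<preceq> snd b" "snd b \<preceq> snd a"
    using assms(1,2) unfolding cle_def by linarith+
  moreover have "snd a \<in> carrier A" "snd b \<in> carrier A"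
    using assms(3,4) by (auto simp: carrier_chang)
  ultimately show ?thesis using hle_antisym by (simp add: prod_eq_iff)
qed

lemma cle_trans:
  assumes "cle a b" "cle b c"
    "a \<in> carrier chang_group" "b \<in> carrier chang_group" "c \<in> carrier chang_group"
  shows "cle a c"
proof -
  have "snd a \<in> carrier A" "snd b \<in> carrier A" "snd c \<in> carrier A"
    using assms(3-) by (auto simp: carrier_chang)
  then have "snd a \<preceq> snd c" if "snd a \<preceq> snd b" "snd b \<preceq> snd c"
    using that hle_trans by blast
  then show ?thesis using assms(1,2) unfolding cle_def by linarith
qed

lemma cadd_mono:
  assumes "cle a b"
    "a \<in> carrier chang_group" "b \<in> carrier chang_group" "c \<in> carrier chang_group"
  shows "cle (c \<oplus>\<^sub>c a) (c \<oplus>\<^sub>c b)"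
proof -
  obtain k x l y j z where abc: "a = (k, x)" "b = (l, y)" "c = (j, z)"
    using prod.exhaust by metis
  then have xyz: "x \<in> above" "y \<in> above" "z \<in> above" using assms by (auto simp: carrier_chang)
  \<comment> \<open>For k < l the first components of the two sums agree only if l = k + 1 and just
    the second sum carries; this inequality then decides.\<close>
  have zle: "z \<otimes> x \<preceq> z \<boxplus> y"
  proof (rule hle_trans)
    show "z \<otimes> x \<preceq> z" using xyz by simp
    show "z \<preceq> z \<boxplus> y"
      using imp_mono[OF above_ge[of y], of "z \<rightharpoonup> m"] neg_neg[of z] xyz by simp
  qed (use xyz in auto)
  consider "k < l" | "k = l" "x \<preceq> y" using assms(1) by (auto simp: cle_def abc)
  then show ?thesis
  proof cases
    case 1
    then show ?thesis using zle unfolding abc cadd_simp cle_def by (simp; linarith)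
  next
    case 2
    have mono: "z \<otimes> x \<preceq> z \<otimes> y" using xyz 2 by (intro mult_mono_right) auto
    have omono: "z \<boxplus> x \<preceq> z \<boxplus> y" using xyz 2 by (intro imp_mono) auto
    show ?thesis
    proof (cases "z \<otimes> x \<in> above")
      case True
      then have "z \<otimes> y \<in> above" using above_upward[OF True mono] xyz by simp
      then show ?thesis using True 2 mono by (simp add: abc cadd_simp cle_def)
    next
      case False
      then have "c \<oplus>\<^sub>c a = (j + l - 1, z \<boxplus> x)" using 2 by (simp only: abc cadd_simp if_False)
      then show ?thesis using omono by (simp only: abc cadd_simp cle_def fst_conv snd_conv split: if_split) simp
    qed
  qed
qed

end

section \<open>Total preorders on integer vectors\<close>

text \<open>Serves to place a new coordinate in a cut that no threshold hits; either side of the cut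
  may be empty.\<close>

lemma finite_separation:
  fixes A B :: "real set"
  assumes "finite A" "finite B" "\<And>a b. a \<in> A \<Longrightarrow> b \<in> B \<Longrightarrow> a < b"
  obtains t where "\<And>a. a \<in> A \<Longrightarrow> a < t" "\<And>b. b \<in> B \<Longrightarrow> t < b"
proof -
  consider "A = {}" | "B = {}" | "A \<noteq> {}" "B \<noteq> {}" by blast
  then show ?thesis
  proof cases
    case 1
    then show ?thesis
    proof (cases "B = {}")
      case False
      then show ?thesis using that[of "Min B - 1"] 1 assms
        by (force dest: Min_le[OF assms(2)])
    qed (use that 1 in auto)
  next
    case 2
    then show ?thesis
    proof (cases "A = {}")
      case False
      then show ?thesis using that[of "Max A + 1"] 2 assms
        by (force dest: Max_ge[OF assms(1)])
    qed (use that 2 in auto)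
  next
    case 3
    then have "Max A < Min B" using assms Max_in Min_in by blast
    then obtain t where "Max A < t" "t < Min B" using dense by blast
    then show ?thesis using that[of t] assms 3
      by (metis Max_ge Min_le order_le_less_trans order_less_le_trans)
  qed
qed

text \<open>The nonnegative vectors of a translation-invariant total preorder. Different vectors may
  be equivalent, so membership of both v and -v does not force v = 0.\<close>

locale total_cone =
  fixes Pos :: "('i \<Rightarrow> int) set"
  assumes add: "\<lbrakk>v \<in> Pos; w \<in> Pos\<rbrakk> \<Longrightarrow> (\<lambda>i. v i + w i) \<in> Pos"
    and total: "v \<in> Pos \<or> (\<lambda>i. - v i) \<in> Pos"
begin

lemma zero: "(\<lambda>i. 0) \<in> Pos"
  using total[of "\<lambda>i. 0"] by simp

lemma scale_nat: "v \<in> Pos \<Longrightarrow> (\<lambda>i. int n * v i) \<in> Pos"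
proof (induction n)
  case (Suc n)
  then show ?case using add[of "\<lambda>i. int n * v i" v] by (simp add: algebra_simps)
qed (simp add: zero)

lemma scale: "\<lbrakk>v \<in> Pos; 0 \<le> c\<rbrakk> \<Longrightarrow> (\<lambda>i. c * v i) \<in> Pos"
  using scale_nat[of v "nat c"] by simp

text \<open>If -v were nonnegative, adding c - 1 copies of it to c v would leave v.\<close>

lemma unscale:
  assumes "(\<lambda>i. c * v i) \<in> Pos" "0 < c" shows "v \<in> Pos"
proof (rule ccontr)
  assume "v \<notin> Pos"
  then have "(\<lambda>i. (c - 1) * - v i) \<in> Pos" using scale[of "\<lambda>i. - v i" "c - 1"] total assms by auto
  from add[OF assms(1) this] have "v \<in> Pos" by (simp add: algebra_simps)
  then show False using \<open>v \<notin> Pos\<close> by simp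
qed

text \<open>Fourier--Motzkin elimination: the value at the new index is chosen in the cut which the
  cone determines.\<close>
lemma real_realization:
  assumes "finite I" "finite V" "\<And>v i. \<lbrakk>v \<in> V; i \<notin> I\<rbrakk> \<Longrightarrow> v i = 0"
  shows "\<exists>y :: 'i \<Rightarrow> real. \<forall>v\<in>V. v \<in> Pos \<longleftrightarrow> 0 \<le> (\<Sum>i\<in>I. of_int (v i) * y i)"
  using assms
proof (induction I arbitrary: V rule: finite_induct)
  case empty
  then have "v = (\<lambda>i. 0)" if "v \<in> V" for v using that by auto
  then show ?case using zero by auto
next
  case (insert j I)
  \<comment> \<open>Closing under negation lets the vectors with positive coefficient at j represent
    every v whose coefficient there is nonzero.\<close>
  define W where "W = V \<union> (\<lambda>v i. - v i) ` V"
  define P where "P = {v \<in> W. v j > 0}"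
  \<comment> \<open>The coefficient at j cancels. The induction hypothesis is applied to these
    combinations and to the vectors of V without j.\<close>
  define comb where "comb v w = (\<lambda>i. v j * w i - w j * v i)" for v w :: "'i \<Rightarrow> int"
  define V' where "V' = {v \<in> V. v j = 0} \<union> (\<lambda>(v, w). comb v w) ` (P \<times> P)"
  have finP: "finite P" using insert.prems(1) by (simp add: P_def W_def)
  have supW: "v i = 0" if "v \<in> W" "i \<notin> insert j I" for v i
    using that insert.prems(2) by (auto simp: W_def)
  have "finite V'" using insert.prems(1) finP by (simp add: V'_def)
  moreover have "v i = 0" if "v \<in> V'" "i \<notin> I" for v i
  proof (cases "i = j")
    case True
    then show ?thesis using that by (auto simp: V'_def comb_def)
  next
    case False
    then have *: "i \<notin> insert j I" using that by simp
    from \<open>v \<in> V'\<close> consider "v \<in> V" | u w where "u \<in> P" "w \<in> P" "v = comb u w"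
      by (auto simp: V'_def)
    then show ?thesis
    proof cases
      case 1 then show ?thesis using insert.prems(2) * by blast
    next
      case 2 then show ?thesis using supW[of u i] supW[of w i] * by (simp add: comb_def P_def)
    qed
  qed
  ultimately obtain y :: "'i \<Rightarrow> real" where
    y: "\<And>v. v \<in> V' \<Longrightarrow> v \<in> Pos \<longleftrightarrow> 0 \<le> (\<Sum>i\<in>I. of_int (v i) * y i)"
    using insert.IH[of V'] by blast
  define L where "L v = (\<Sum>i\<in>I. of_int (v i) * y i)" for v :: "'i \<Rightarrow> int"
  \<comment> \<open>The threshold of v: for v j > 0 the linear form of v is nonnegative exactly when
    the coordinate at j is at least \<open>r v\<close>.\<close>
  define r where "r v = - L v / of_int (v j)" for v :: "'i \<Rightarrow> int"
  have comb_iff: "comb v w \<in> Pos \<longleftrightarrow> r w \<le> r v" if "v \<in> P" "w \<in> P" for v w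
  proof -
    have "L (comb v w) = of_int (v j) * L w - of_int (w j) * L v"
      by (simp add: L_def comb_def algebra_simps sum_subtractf sum_distrib_left)
    moreover have "comb v w \<in> V'" using that by (auto simp: V'_def)
    moreover have "(0::real) < of_int (v j)" "(0::real) < of_int (w j)"
      using that by (auto simp: P_def)
    moreover have "comb v w \<in> Pos \<longleftrightarrow> 0 \<le> L (comb v w)"
      unfolding L_def using y that by (auto simp: V'_def)
    ultimately show ?thesis by (simp add: r_def field_simps; linarith)
  qed
  \<comment> \<open>The cut is consistent: thresholds of nonnegative vectors lie at or below those
    of nonpositive vectors, and strictly below as soon as one of the two vectors is strictly
    so.\<close>
  have cross1: "r v < r w" if "v \<in> P" "(\<lambda>i. - v i) \<notin> Pos" "w \<in> P" "(\<lambda>i. - w i) \<in> Pos" for v w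
  proof (rule ccontr)
    assume "\<not> r v < r w"
    then have "comb v w \<in> Pos" using comb_iff that by simp
    moreover have "(\<lambda>i. v j * - w i) \<in> Pos" using scale[OF that(4)] that(1) by (simp add: P_def)
    ultimately have "(\<lambda>i. comb v w i + v j * - w i) \<in> Pos" by (rule add)
    then have "(\<lambda>i. w j * - v i) \<in> Pos" by (simp add: comb_def)
    then show False using unscale[of "w j" "\<lambda>i. - v i"] that by (simp add: P_def)
  qed
  have cross2: "r v < r w" if "v \<in> P" "v \<in> Pos" "w \<in> P" "w \<notin> Pos" for v w
  proof (rule ccontr)
    assume "\<not> r v < r w"
    then have "comb v w \<in> Pos" using comb_iff that by simp
    moreover have "(\<lambda>i. w j * v i) \<in> Pos" using scale[OF that(2)] that(3) by (simp add: P_def)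
    ultimately have "(\<lambda>i. comb v w i + w j * v i) \<in> Pos" by (rule add)
    then have "(\<lambda>i. v j * w i) \<in> Pos" by (simp add: comb_def)
    then show False using unscale[of "v j" w] that by (simp add: P_def)
  qed
  have cross3: "r v \<le> r w" if "v \<in> P" "v \<in> Pos" "w \<in> P" "(\<lambda>i. - w i) \<in> Pos" for v w
  proof -
    have "(\<lambda>i. w j * v i) \<in> Pos" "(\<lambda>i. v j * - w i) \<in> Pos"
      using scale[OF that(2)] scale[OF that(4)] that(1,3) by (auto simp: P_def)
    then have "(\<lambda>i. w j * v i + v j * - w i) \<in> Pos" by (rule add)
    then have "comb w v \<in> Pos" by (simp add: comb_def)
    then show ?thesis using comb_iff that by simp
  qed
  have "\<exists>t. \<forall>v\<in>P. (v \<in> Pos \<longleftrightarrow> r v \<le> t) \<and> ((\<lambda>i. - v i) \<in> Pos \<longleftrightarrow> t \<le> r v)"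
  \<comment> \<open>A vector equivalent to zero pins the coordinate to its own threshold; without
    one there is an open gap to choose from.\<close>
  proof (cases "\<exists>e\<in>P. e \<in> Pos \<and> (\<lambda>i. - e i) \<in> Pos")
    case True
    then obtain e where e: "e \<in> P" "e \<in> Pos" "(\<lambda>i. - e i) \<in> Pos" by blast
    show ?thesis
    proof (intro exI[of _ "r e"] ballI)
      fix v assume v: "v \<in> P"
      show "(v \<in> Pos \<longleftrightarrow> r v \<le> r e) \<and> ((\<lambda>i. - v i) \<in> Pos \<longleftrightarrow> r e \<le> r v)"
        using cross1[OF v _ e(1,3)] cross2[OF e(1,2) v] cross3[OF v _ e(1,3)] cross3[OF e(1,2) v]
        by (meson linorder_not_le)
    qed
  next
    case False
    define Lo where "Lo = {v \<in> P. v \<in> Pos}"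
    define Hi where "Hi = {v \<in> P. v \<notin> Pos}"
    have "finite (r ` Lo)" "finite (r ` Hi)" using finP by (auto simp: Lo_def Hi_def)
    then obtain t where t: "\<And>a. a \<in> r ` Lo \<Longrightarrow> a < t" "\<And>b. b \<in> r ` Hi \<Longrightarrow> t < b"
    proof (rule finite_separation)
      show "a < b" if "a \<in> r ` Lo" "b \<in> r ` Hi" for a b
        using that cross2 by (auto simp: Lo_def Hi_def)
    qed blast
    show ?thesis
    proof (intro exI[of _ t] ballI)
      fix v assume v: "v \<in> P"
      show "(v \<in> Pos \<longleftrightarrow> r v \<le> t) \<and> ((\<lambda>i. - v i) \<in> Pos \<longleftrightarrow> t \<le> r v)"
      proof (cases "v \<in> Pos")
        case True
        then show ?thesis using t(1)[of "r v"] False v by (fastforce simp: Lo_def)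
      next
        case False
        then show ?thesis using t(2)[of "r v"] total[of v] v by (fastforce simp: Hi_def)
      qed
    qed
  qed
  then obtain t where t: "\<And>v. v \<in> P \<Longrightarrow> v \<in> Pos \<longleftrightarrow> r v \<le> t"
    "\<And>v. v \<in> P \<Longrightarrow> (\<lambda>i. - v i) \<in> Pos \<longleftrightarrow> t \<le> r v" by blast
  show ?case
  proof (intro exI[of _ "y(j := t)"] ballI)
    fix v assume v: "v \<in> V"
    have "(\<Sum>i\<in>I. of_int (v i) * (y(j := t)) i) = L v"
      unfolding L_def using insert.hyps(2) by (intro sum.cong) auto
    then have S: "(\<Sum>i\<in>insert j I. of_int (v i) * (y(j := t)) i) = of_int (v j) * t + L v"
      using insert.hyps by simp
    consider "v j = 0" | "v j > 0" | "v j < 0" by linarith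
    then have "v \<in> Pos \<longleftrightarrow> 0 \<le> of_int (v j) * t + L v"
    proof cases
      case 1
      then show ?thesis using y[of v] v by (simp add: V'_def L_def)
    next
      case 2
      then have "v \<in> P" using v by (simp add: P_def W_def)
      then have "v \<in> Pos \<longleftrightarrow> - L v / of_int (v j) \<le> t" using t(1) by (simp add: r_def)
      also have "\<dots> \<longleftrightarrow> 0 \<le> of_int (v j) * t + L v" using 2 by (simp add: field_simps; linarith)
      finally show ?thesis .
    next
      case 3
      define u where "u = (\<lambda>i. - v i)"
      have "u \<in> P" using v 3 by (auto simp: P_def W_def u_def)
      then have "v \<in> Pos \<longleftrightarrow> t \<le> r u" using t(2)[of u] by (simp add: u_def)
      also have "r u = L v / - of_int (v j)" by (simp add: r_def u_def L_def sum_negf)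
      also have "t \<le> \<dots> \<longleftrightarrow> 0 \<le> of_int (v j) * t + L v"
        using 3 by (subst pos_le_divide_eq) (auto simp: algebra_simps)
      finally show ?thesis .
    qed
    then show "v \<in> Pos \<longleftrightarrow> 0 \<le> (\<Sum>i\<in>insert j I. of_int (v i) * (y(j := t)) i)" using S by simp
  qed
qed

end

section \<open>Completeness\<close>

definition unit_hoop :: "real hoop" where
  "unit_hoop = \<lparr>carrier = {0..1}, mult = (\<lambda>x y. max 0 (x + y - 1)), one = 1,
     himp = (\<lambda>x y. min 1 (1 - x + y))\<rparr>"

lemma unit_hoop_simps [simp]:
  "carrier unit_hoop = {0..1}" "x \<otimes>\<^bsub>unit_hoop\<^esub> y = max 0 (x + y - 1)"
  "\<one>\<^bsub>unit_hoop\<^esub> = 1" "x \<rightharpoonup>\<^bsub>unit_hoop\<^esub> y = min 1 (1 - x + y)"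
  by (simp_all add: unit_hoop_def)

text \<open>The truncation point has to lie below the values of all subterms and not just below the
  generators, since products descend further.\<close>

primrec subvals :: "('a, 'r) hoop_scheme \<Rightarrow> ('v \<Rightarrow> 'a) \<Rightarrow> 'v hterm \<Rightarrow> 'a set" where
  "subvals A b (HVar i) = {b i}"
| "subvals A b HOne = {\<one>\<^bsub>A\<^esub>}"
| "subvals A b (HMul s t) = insert (heval A b s \<otimes>\<^bsub>A\<^esub> heval A b t) (subvals A b s \<union> subvals A b t)"
| "subvals A b (HImp s t) = insert (heval A b s \<rightharpoonup>\<^bsub>A\<^esub> heval A b t) (subvals A b s \<union> subvals A b t)"

lemma finite_subvals: "finite (subvals A b t)"
  by (induction t) auto

lemma heval_in_subvals: "heval A b t \<in> subvals A b t"
  by (induction t) auto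

lemma (in hoop_algebra) subvals_closed:
  assumes "\<And>i. b i \<in> carrier A" shows "subvals A b t \<subseteq> carrier A"
  by (induction t) (auto intro: hone_closed hmult_closed himp_closed heval_closed[of b] assms)

context truncated_wajsberg_chain
begin

interpretation chang: comm_group chang_group
  by (rule chang_comm_group)

text \<open>\<open>emb x\<close> stands for \<open>x - 1\<close>.\<close>
definition emb :: "'a \<Rightarrow> int \<times> 'a" where
  "emb x = (if x \<in> above then (0, x) else (- 1, \<one>))"

definition unitc :: "int \<times> 'a" where "unitc = (1, \<one>)"

definition negunit :: "int \<times> 'a" where "negunit = (- 1, \<one>)"

lemma emb_closed: "emb x \<in> carrier chang_group"
  by (simp add: emb_def carrier_chang)

lemma unitc_closed: "unitc \<in> carrier chang_group"
  by (simp add: unitc_def carrier_chang)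

lemma negunit_closed: "negunit \<in> carrier chang_group"
  by (simp add: negunit_def carrier_chang)

lemma inv_unitc: "inv\<^bsub>chang_group\<^esub> unitc = negunit"
  by (rule chang.inv_equality)
    (simp_all add: unitc_closed negunit_closed, simp add: unitc_def negunit_def cadd_simp one_chang)

lemma not_above: "\<lbrakk>x \<notin> above; m \<preceq> x; x \<in> carrier A\<rbrakk> \<Longrightarrow> x = m"
  using hle_antisym[of x m] by (simp add: above_def del: above_closed)

lemma m_not_above: "m \<notin> above"
  by (simp add: above_def del: above_closed)

lemma emb_one: "emb \<one> = \<one>\<^bsub>chang_group\<^esub>"
  by (simp add: emb_def one_chang)

lemma emb_le_zero: "x \<in> carrier A \<Longrightarrow> cle (emb x) \<one>\<^bsub>chang_group\<^esub>"
  by (simp add: emb_def cle_def one_chang)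

lemma emb_ge: "x \<in> carrier A \<Longrightarrow> cle negunit (emb x)"
  by (simp add: emb_def cle_def negunit_def)

text \<open>On the scale shifted by 1 the product is the maximum of the group sum and the negated
  unit. The disjunction keeps the inequality that selects the branch; it later becomes a sign
  condition on an integer vector.\<close>

lemma emb_mult:
  assumes x: "x \<in> carrier A" and y: "y \<in> carrier A"
    and mx: "m \<preceq> x" and my: "m \<preceq> y" and mxy: "m \<preceq> x \<otimes> y"
  shows "emb (x \<otimes> y) = emb x \<oplus>\<^sub>c emb y \<and> cle negunit (emb x \<oplus>\<^sub>c emb y) \<or>
    emb (x \<otimes> y) = negunit \<and> cle (emb x \<oplus>\<^sub>c emb y) negunit"
proof -
  have prod: "x \<otimes> y \<notin> above" if "x \<notin> above \<or> y \<notin> above"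
  proof
    assume "x \<otimes> y \<in> above"
    then have "x \<in> above" "y \<in> above"
      using above_upward[of "x \<otimes> y" x] above_upward[of "x \<otimes> y" y] x y by simp_all
    then show False using that by blast
  qed
  consider "x \<in> above" "y \<in> above" | "x \<in> above" "y \<notin> above" | "x \<notin> above" "y \<in> above"
    | "x \<notin> above" "y \<notin> above" by blast
  then show ?thesis
  proof cases
    case 1
    then have cl: "x \<boxplus> y \<in> carrier A" using x y by simp
    show ?thesis
    proof (cases "x \<otimes> y \<in> above")
      case True
      then show ?thesis using 1 by (simp add: emb_def cadd_simp cle_def negunit_def)
    next
      case False
      then show ?thesis using 1 imp_one[OF cl] by (simp add: emb_def cadd_simp cle_def negunit_def)
    qed
  next
    case 2
    then show ?thesis using prod x by (simp add: emb_def cadd_simp cle_def negunit_def)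
  next
    case 3
    then show ?thesis using prod y by (simp add: emb_def cadd_simp cle_def negunit_def)
  next
    case 4
    then show ?thesis using prod by (simp add: emb_def cadd_simp cle_def negunit_def)
  qed
qed

text \<open>On the shifted scale the implication is the minimum of 0 and the difference. The
  difference is expressed as a sum, which comes straight from x (x -> y) = y and avoids computing
  inverses of pairs.\<close>

lemma emb_imp:
  assumes x: "x \<in> carrier A" and y: "y \<in> carrier A" and mx: "m \<preceq> x" and my: "m \<preceq> y"
  shows "emb (x \<rightharpoonup> y) = \<one>\<^bsub>chang_group\<^esub> \<and> cle (emb x) (emb y) \<or>
    emb x \<oplus>\<^sub>c emb (x \<rightharpoonup> y) = emb y \<and> cle (emb y) (emb x)"
proof (cases "x \<preceq> y")
  case True
  have "cle (emb x) (emb y)"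
  proof (cases "x \<in> above")
    case xa: True
    then have "y \<in> above" using above_upward[OF xa True y] by blast
    then show ?thesis using xa True by (simp add: emb_def cle_def)
  next
    case False
    then show ?thesis using emb_ge[OF y] by (simp add: emb_def negunit_def)
  qed
  then show ?thesis using True emb_one by simp
next
  case False
  then have yx: "y \<preceq> x" using chain x y by blast
  have f: "x \<otimes> (x \<rightharpoonup> y) = y" using le_imp_factor yx x y by blast
  have xa: "x \<in> above"
  proof (rule ccontr)
    assume "x \<notin> above"
    then have "x = m" using not_above mx x by blast
    then show False using False my by simp
  qed
  have "cle (emb y) (emb x)"
    using xa yx x emb_ge[OF x] by (auto simp: emb_def cle_def negunit_def)
  moreover have "emb x \<oplus>\<^sub>c emb (x \<rightharpoonup> y) = emb y"
  proof (cases "y \<in> above")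
    case True
    then have "x \<rightharpoonup> y \<in> above" using above_upward[OF True imp_ge[OF x y]] x y by simp
    then show ?thesis using True xa f by (simp add: emb_def cadd_simp)
  next
    case False
    then have ym: "y = m" using not_above my y by blast
    \<comment> \<open>The value m is represented by (-1, 1). If x -> m is not in
      \<open>above\<close>, it equals m, and then x = 1.\<close>
    show ?thesis
    proof (cases "x \<rightharpoonup> m \<in> above")
      case True
      then show ?thesis using False xa f ym x by (simp add: emb_def cadd_simp)
    next
      case False
      then have "x \<rightharpoonup> m = m" using not_above[of "x \<rightharpoonup> m"] x by simp
      then have "x = \<one>" using neg_neg[OF xa] by simp
      then show ?thesis using ym m_not_above by (simp add: emb_def cadd_simp)
    qed
  qed
  ultimately show ?thesis by blast
qed

end

section \<open>Integer vectors as linear forms in the generators and the unit\<close>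

definition dot :: "('i::finite \<Rightarrow> int) \<Rightarrow> ('i \<Rightarrow> real) \<Rightarrow> real" where
  "dot v y = (\<Sum>i\<in>UNIV. of_int (v i) * y i)"

lemma dot_add: "dot (\<lambda>i. v i + w i) y = dot v y + dot w y"
  by (simp add: dot_def distrib_right sum.distrib)

lemma dot_minus: "dot (\<lambda>i. - v i) y = - dot v y"
  by (simp add: dot_def sum_negf)

lemma dot_diff: "dot (\<lambda>i. v i - w i) y = dot v y - dot w y"
  by (simp add: dot_def left_diff_distrib sum_subtractf)

lemma dot_zero: "dot (\<lambda>i. 0) y = 0"
  by (simp add: dot_def)

lemma dot_unit: "dot (\<lambda>i. if i = j then 1 else 0) y = y j"
  by (simp add: dot_def if_distrib[of of_int] if_distrib[of "\<lambda>x. x * _"] cong: if_cong)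

lemma dot_scale: "dot v (\<lambda>i. c * y i) = c * dot v y"
  by (simp add: dot_def sum_distrib_left mult.left_commute)

locale chang_valuation = truncated_wajsberg_chain A m
  for A :: "('a, 'r) hoop_scheme" (structure) and m +
  fixes b :: "'v::finite \<Rightarrow> 'a"
  assumes b_closed: "b i \<in> carrier A" and b_ge: "m \<rightharpoonup> b i = \<one>"
begin

interpretation chang: comm_group chang_group
  by (rule chang_comm_group)

text \<open>The extra index \<open>None\<close> carries the strong unit, because the bound at which
  products are truncated must itself be an integer combination of generators.\<close>

definition gen :: "'v option \<Rightarrow> int \<times> 'a" where
  "gen i = (case i of None \<Rightarrow> unitc | Some j \<Rightarrow> emb (b j))"

definition val :: "('v option \<Rightarrow> int) \<Rightarrow> int \<times> 'a" where
  "val v = finprod chang_group (\<lambda>i. gen i [^]\<^bsub>chang_group\<^esub> v i) UNIV"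

definition Pos :: "('v option \<Rightarrow> int) set" where
  "Pos = {v. cle \<one>\<^bsub>chang_group\<^esub> (val v)}"

lemma gen_closed [simp]: "gen i \<in> carrier chang_group"
  by (simp add: gen_def emb_closed unitc_closed split: option.split)

lemma val_closed [simp]: "val v \<in> carrier chang_group"
  unfolding val_def by (rule chang.finprod_closed) simp

lemma val_add: "val (\<lambda>i. v i + w i) = val v \<oplus>\<^sub>c val w"
  unfolding val_def
  by (subst chang.finprod_multf[symmetric]) (simp_all add: chang.int_pow_mult)

lemma val_zero: "val (\<lambda>i. 0) = \<one>\<^bsub>chang_group\<^esub>"
  by (simp add: val_def chang.finprod_one_eqI)

lemma val_minus: "val (\<lambda>i. - v i) = inv\<^bsub>chang_group\<^esub> val v"
  by (rule chang.inv_equality[symmetric]) (simp_all add: val_add[symmetric] val_zero)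

lemma val_unit: "val (\<lambda>i. if i = j then 1 else 0) = gen j"
proof -
  have "val (\<lambda>i. if i = j then 1 else 0)
      = finprod chang_group (\<lambda>i. if j = i then gen i else \<one>\<^bsub>chang_group\<^esub>) UNIV"
    unfolding val_def by (rule chang.finprod_cong') (auto simp: chang.int_pow_1)
  also have "\<dots> = gen j" by (rule chang.finprod_singleton) auto
  finally show ?thesis .
qed

lemma diff_Pos_iff: "(\<lambda>i. w i - v i) \<in> Pos \<longleftrightarrow> cle (val v) (val w)"
proof -
  have "val v \<oplus>\<^sub>c val (\<lambda>i. w i - v i) = val w"
    by (simp add: val_add[symmetric])
  then have "cle (val v) (val w)" if "cle \<one>\<^bsub>chang_group\<^esub> (val (\<lambda>i. w i - v i))"
    using cadd_mono[OF that, of "val v"] by simp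
  moreover have "cle \<one>\<^bsub>chang_group\<^esub> (val (\<lambda>i. w i - v i))" if "cle (val v) (val w)"
  proof -
    have "val (\<lambda>i. - v i) \<oplus>\<^sub>c val w = val (\<lambda>i. w i - v i)"
      "val (\<lambda>i. - v i) \<oplus>\<^sub>c val v = \<one>\<^bsub>chang_group\<^esub>"
      by (simp_all add: val_add[symmetric] val_zero)
    then show ?thesis using cadd_mono[OF that, of "val (\<lambda>i. - v i)"] by simp
  qed
  ultimately show ?thesis by (auto simp: Pos_def)
qed

lemma Pos_cone: "total_cone Pos"
proof (rule total_cone.intro)
  fix v w assume "v \<in> Pos" "w \<in> Pos"
  then have v: "cle \<one>\<^bsub>chang_group\<^esub> (val v)" and w: "cle \<one>\<^bsub>chang_group\<^esub> (val w)"
    by (simp_all only: Pos_def mem_Collect_eq)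
  have "cle (val v \<oplus>\<^sub>c \<one>\<^bsub>chang_group\<^esub>) (val v \<oplus>\<^sub>c val w)"
    by (rule cadd_mono[OF w]) simp_all
  then have "cle (val v) (val (\<lambda>i. v i + w i))"
    by (simp only: val_add chang.r_one val_closed)
  then have "cle \<one>\<^bsub>chang_group\<^esub> (val (\<lambda>i. v i + w i))"
    by (rule cle_trans[OF v]) simp_all
  then show "(\<lambda>i. v i + w i) \<in> Pos" by (simp only: Pos_def mem_Collect_eq)
next
  fix v
  have "cle (val (\<lambda>i. 0)) (val v) \<or> cle (val v) (val (\<lambda>i. 0))"
    by (rule cle_total) simp_all
  then have "(\<lambda>i. v i - 0) \<in> Pos \<or> (\<lambda>i. 0 - v i) \<in> Pos" by (simp only: diff_Pos_iff)
  then show "v \<in> Pos \<or> (\<lambda>i. - v i) \<in> Pos" by simp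
qed

text \<open>One direction of the sign condition is enough here: it makes the evaluation over the
  reals follow the branches taken in the group.\<close>

abbreviation sound :: "('v option \<Rightarrow> int) set \<Rightarrow> ('v option \<Rightarrow> real) \<Rightarrow> bool" where
  "sound V y \<equiv> y None = 1 \<and> (\<forall>w\<in>V. w \<in> Pos \<longrightarrow> 0 \<le> dot w y)"

text \<open>On the branches that a term takes in the group it is given by one integer vector
  \<open>v\<close>, and \<open>V\<close> collects the inequalities selecting those branches. A real
  point respecting \<open>V\<close> takes the same branches, so the same vector computes the value
  there. Real coordinates are shifted by 1 as in the group, whence the variables become
  \<open>1 + y (Some i)\<close>.\<close>

lemma term_linear:
  assumes "\<And>x. x \<in> subvals A b t \<Longrightarrow> m \<rightharpoonup> x = \<one>"
  shows "\<exists>v V. finite V \<and> val v = emb (heval A b t) \<and>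
    (\<forall>y. sound V y \<longrightarrow> heval unit_hoop (\<lambda>i. 1 + y (Some i)) t = 1 + dot v y)"
  using assms
proof (induction t)
  case (HVar i)
  show ?case
    by (rule exI[of _ "\<lambda>k. if k = Some i then 1 else 0"], rule exI[of _ "{}"])
      (simp add: val_unit dot_unit gen_def)
next
  case HOne
  show ?case
    by (rule exI[of _ "\<lambda>k. 0"], rule exI[of _ "{}"]) (simp add: val_zero dot_zero emb_one)
next
  case (HMul s t)
  let ?x = "heval A b s" and ?y = "heval A b t"
  have ps: "m \<preceq> x" if "x \<in> subvals A b s" for x using HMul.prems that by simp
  have pt: "m \<preceq> x" if "x \<in> subvals A b t" for x using HMul.prems that by simp
  obtain v V where v: "finite V" "val v = emb ?x"
    "\<And>y. sound V y \<Longrightarrow> heval unit_hoop (\<lambda>i. 1 + y (Some i)) s = 1 + dot v y"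
    using HMul.IH(1)[OF ps] by blast
  obtain w W where w: "finite W" "val w = emb ?y"
    "\<And>y. sound W y \<Longrightarrow> heval unit_hoop (\<lambda>i. 1 + y (Some i)) t = 1 + dot w y"
    using HMul.IH(2)[OF pt] by blast
  \<comment> \<open>The vector of the negated unit, the lower bound of a truncated product.\<close>
  define n :: "'v option \<Rightarrow> int" where "n = (\<lambda>i. - (if i = None then 1 else 0))"
  define vw where "vw = (\<lambda>i. v i + w i)"
  have n: "val n = negunit" "dot n y = - y None" for y
    using val_minus[of "\<lambda>i. if i = None then 1 else 0"] dot_minus[of "\<lambda>i. if i = None then 1 else 0" y]
    by (simp_all add: n_def val_unit gen_def inv_unitc dot_unit)
  have vw: "val vw = emb ?x \<oplus>\<^sub>c emb ?y" "dot vw y = dot v y + dot w y" for y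
    by (simp_all add: vw_def val_add v(2) w(2) dot_add)
  have "emb (?x \<otimes> ?y) = val vw \<and> cle (val n) (val vw) \<or> emb (?x \<otimes> ?y) = val n \<and> cle (val vw) (val n)"
    using emb_mult[OF heval_closed[OF b_closed] heval_closed[OF b_closed] ps[OF heval_in_subvals]
        pt[OF heval_in_subvals]] HMul.prems[of "?x \<otimes> ?y"] unfolding n(1) vw(1) by simp
  then show ?case
  proof
    assume a: "emb (?x \<otimes> ?y) = val vw \<and> cle (val n) (val vw)"
    then have P: "(\<lambda>i. vw i - n i) \<in> Pos" by (simp only: diff_Pos_iff)
    show ?thesis
    proof (intro exI[of _ vw] exI[of _ "insert (\<lambda>i. vw i - n i) (V \<union> W)"] conjI allI impI)
      fix y assume s: "sound (insert (\<lambda>i. vw i - n i) (V \<union> W)) y"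
      then have "heval unit_hoop (\<lambda>i. 1 + y (Some i)) s = 1 + dot v y"
        "heval unit_hoop (\<lambda>i. 1 + y (Some i)) t = 1 + dot w y" using v(3) w(3) by blast+
      moreover have "0 \<le> dot (\<lambda>i. vw i - n i) y" using s P by blast
      then have "0 \<le> dot vw y - dot n y" by (simp only: dot_diff)
      ultimately show "heval unit_hoop (\<lambda>i. 1 + y (Some i)) (HMul s t) = 1 + dot vw y"
        using s by (simp add: vw n)
    qed (use v(1,2) w(1,2) a in simp_all)
  next
    assume a: "emb (?x \<otimes> ?y) = val n \<and> cle (val vw) (val n)"
    then have P: "(\<lambda>i. n i - vw i) \<in> Pos" by (simp only: diff_Pos_iff)
    show ?thesis
    proof (intro exI[of _ n] exI[of _ "insert (\<lambda>i. n i - vw i) (V \<union> W)"] conjI allI impI)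
      fix y assume s: "sound (insert (\<lambda>i. n i - vw i) (V \<union> W)) y"
      then have "heval unit_hoop (\<lambda>i. 1 + y (Some i)) s = 1 + dot v y"
        "heval unit_hoop (\<lambda>i. 1 + y (Some i)) t = 1 + dot w y" using v(3) w(3) by blast+
      moreover have "0 \<le> dot (\<lambda>i. n i - vw i) y" using s P by blast
      then have "0 \<le> dot n y - dot vw y" by (simp only: dot_diff)
      ultimately show "heval unit_hoop (\<lambda>i. 1 + y (Some i)) (HMul s t) = 1 + dot n y"
        using s by (simp add: vw n)
    qed (use v(1,2) w(1,2) a in simp_all)
  qed
next
  case (HImp s t)
  let ?x = "heval A b s" and ?y = "heval A b t"
  have ps: "m \<preceq> x" if "x \<in> subvals A b s" for x using HImp.prems that by simp
  have pt: "m \<preceq> x" if "x \<in> subvals A b t" for x using HImp.prems that by simp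
  obtain v V where v: "finite V" "val v = emb ?x"
    "\<And>y. sound V y \<Longrightarrow> heval unit_hoop (\<lambda>i. 1 + y (Some i)) s = 1 + dot v y"
    using HImp.IH(1)[OF ps] by blast
  obtain w W where w: "finite W" "val w = emb ?y"
    "\<And>y. sound W y \<Longrightarrow> heval unit_hoop (\<lambda>i. 1 + y (Some i)) t = 1 + dot w y"
    using HImp.IH(2)[OF pt] by blast
  define d where "d = (\<lambda>i. w i - v i)"
  define d' where "d' = (\<lambda>i. v i - w i)"
  have dd: "dot d y = dot w y - dot v y" "dot d' y = dot v y - dot w y" for y
    by (simp_all add: d_def d'_def dot_diff)
  have Pd: "d \<in> Pos \<longleftrightarrow> cle (val v) (val w)" "d' \<in> Pos \<longleftrightarrow> cle (val w) (val v)"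
    by (simp_all add: d_def d'_def diff_Pos_iff)
  have "emb (?x \<rightharpoonup> ?y) = \<one>\<^bsub>chang_group\<^esub> \<and> cle (emb ?x) (emb ?y) \<or>
      emb ?x \<oplus>\<^sub>c emb (?x \<rightharpoonup> ?y) = emb ?y \<and> cle (emb ?y) (emb ?x)"
    by (rule emb_imp[OF heval_closed[OF b_closed] heval_closed[OF b_closed] ps[OF heval_in_subvals]
        pt[OF heval_in_subvals]])
  then show ?case
  proof
    assume a: "emb (?x \<rightharpoonup> ?y) = \<one>\<^bsub>chang_group\<^esub> \<and> cle (emb ?x) (emb ?y)"
    then have P: "d \<in> Pos" by (simp only: Pd v(2) w(2))
    show ?thesis
    proof (intro exI[of _ "\<lambda>i. 0"] exI[of _ "insert d (V \<union> W)"] conjI allI impI)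
      fix y assume s: "sound (insert d (V \<union> W)) y"
      then have "heval unit_hoop (\<lambda>i. 1 + y (Some i)) s = 1 + dot v y"
        "heval unit_hoop (\<lambda>i. 1 + y (Some i)) t = 1 + dot w y" using v(3) w(3) by blast+
      moreover have "0 \<le> dot d y" using s P by blast
      ultimately show "heval unit_hoop (\<lambda>i. 1 + y (Some i)) (HImp s t) = 1 + dot (\<lambda>i. 0) y"
        by (simp add: dd dot_zero)
    qed (use v(1,2) w(1,2) a val_zero in simp_all)
  next
    assume a: "emb ?x \<oplus>\<^sub>c emb (?x \<rightharpoonup> ?y) = emb ?y \<and> cle (emb ?y) (emb ?x)"
    then have P: "d' \<in> Pos" by (simp only: Pd v(2) w(2))
    \<comment> \<open>Cancellation in the group identifies the value of the difference vector with
      the shifted value of the implication.\<close>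
    have "val v \<oplus>\<^sub>c val d = val w" by (simp add: d_def val_add[symmetric])
    then have "val v \<oplus>\<^sub>c val d = val v \<oplus>\<^sub>c emb (?x \<rightharpoonup> ?y)" using a by (simp only: v(2) w(2))
    then have vd: "val d = emb (?x \<rightharpoonup> ?y)"
      using chang.Units_l_cancel[of "val v" "val d" "emb (?x \<rightharpoonup> ?y)"] emb_closed
      by (simp add: chang.Units_eq)
    show ?thesis
    proof (intro exI[of _ d] exI[of _ "insert d' (V \<union> W)"] conjI allI impI)
      fix y assume s: "sound (insert d' (V \<union> W)) y"
      then have "heval unit_hoop (\<lambda>i. 1 + y (Some i)) s = 1 + dot v y"
        "heval unit_hoop (\<lambda>i. 1 + y (Some i)) t = 1 + dot w y" using v(3) w(3) by blast+
      moreover have "0 \<le> dot d' y" using s P by blast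
      ultimately show "heval unit_hoop (\<lambda>i. 1 + y (Some i)) (HImp s t) = 1 + dot d y"
        by (simp add: dd)
    qed (use v(1,2) w(1,2) vd in simp_all)
  qed
qed

lemma real_refutation:
  assumes ge: "\<And>x. x \<in> subvals A b t \<Longrightarrow> m \<rightharpoonup> x = \<one>" and ne: "heval A b t \<noteq> \<one>"
  shows "\<exists>x. (\<forall>i. 0 \<le> x i \<and> x i \<le> 1) \<and> heval unit_hoop x t < 1"
proof -
  obtain v V where v: "finite V" "val v = emb (heval A b t)"
    "\<And>y. sound V y \<Longrightarrow> heval unit_hoop (\<lambda>i. 1 + y (Some i)) t = 1 + dot v y"
    using term_linear[OF ge] by blast
  define n :: "'v option \<Rightarrow> int" where "n = (\<lambda>i. - (if i = None then 1 else 0))"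
  define e :: "'v \<Rightarrow> 'v option \<Rightarrow> int" where "e j = (\<lambda>i. if i = Some j then 1 else 0)" for j
  \<comment> \<open>Beyond the branch conditions, \<open>v\<close> decides whether the term is below
    1, \<open>n\<close> makes the unit coordinate positive, and the last two families put the point
    into the cube.\<close>
  define V' where "V' = V \<union> {v, n} \<union> range (\<lambda>j i. - e j i) \<union> range (\<lambda>j i. e j i - n i)"
  have n: "val n = negunit" "dot n y = - y None" for y
    using val_minus[of "\<lambda>i. if i = None then 1 else 0"] dot_minus[of "\<lambda>i. if i = None then 1 else 0" y]
    by (simp_all add: n_def val_unit gen_def inv_unitc dot_unit)
  have e: "val (e j) = emb (b j)" "dot (e j) y = y (Some j)" for j y
    by (simp_all add: e_def val_unit dot_unit gen_def)
  have "finite V'" using v by (simp add: V'_def)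
  then obtain y0 :: "'v option \<Rightarrow> real" where y0: "\<And>w. w \<in> V' \<Longrightarrow> w \<in> Pos \<longleftrightarrow> 0 \<le> dot w y0"
    using total_cone.real_realization[OF Pos_cone, of UNIV V'] by (auto simp: dot_def)
  have "n \<notin> Pos" by (simp add: Pos_def n cle_def negunit_def one_chang)
  then have u: "0 < y0 None" using y0[of n] by (simp add: V'_def n)
  \<comment> \<open>Sign conditions survive positive scaling, so the unit coordinate may be
    normalised to 1.\<close>
  define y where "y = (\<lambda>i. (1 / y0 None) * y0 i)"
  have y: "w \<in> Pos \<longleftrightarrow> 0 \<le> dot w y" if "w \<in> V'" for w
    using y0[OF that] u unfolding y_def dot_scale by (simp add: zero_le_divide_iff)
  have y1: "y None = 1" using u by (simp add: y_def)
  have "0 \<le> 1 + y (Some j) \<and> 1 + y (Some j) \<le> 1" for j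
  proof -
    have "(\<lambda>i. e j i - n i) \<in> Pos" unfolding diff_Pos_iff using emb_ge b_closed by (simp add: n e)
    then have "0 \<le> dot (\<lambda>i. e j i - n i) y" using y by (simp add: V'_def)
    moreover have "(\<lambda>i. 0 - e j i) \<in> Pos"
      unfolding diff_Pos_iff using emb_le_zero b_closed by (simp add: val_zero e)
    then have "(\<lambda>i. - e j i) \<in> Pos" by simp
    then have "0 \<le> dot (\<lambda>i. - e j i) y" using y by (simp add: V'_def)
    ultimately show ?thesis by (simp add: dot_diff dot_minus n e y1)
  qed
  \<comment> \<open>Shifted values are at most 0, so a nonnegative one is 0 and the term would have
    value 1.\<close>
  moreover have "v \<notin> Pos"
  proof
    assume "v \<in> Pos"
    then have "cle \<one>\<^bsub>chang_group\<^esub> (emb (heval A b t))" by (simp add: Pos_def v)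
    moreover have cl: "heval A b t \<in> carrier A" using heval_closed b_closed by blast
    ultimately have "emb (heval A b t) = \<one>\<^bsub>chang_group\<^esub>"
      using cle_antisym emb_le_zero emb_closed by simp
    then show False using ne by (auto simp: emb_def one_chang split: if_splits)
  qed
  then have "dot v y < 0" using y[of v] by (auto simp: V'_def)
  moreover have "sound V y" using y y1 by (auto simp: V'_def)
  then have "heval unit_hoop (\<lambda>i. 1 + y (Some i)) t = 1 + dot v y" using v(3) by blast
  ultimately show ?thesis by (intro exI[of _ "\<lambda>i. 1 + y (Some i)"]) simp
qed

end

section \<open>From chains to arbitrary Wajsberg hoops\<close>

lemma (in wajsberg_hoop) chain_min:
  assumes "finite S" "S \<noteq> {}" "S \<subseteq> carrier A"
    and chain: "\<And>x y. \<lbrakk>x \<in> carrier A; y \<in> carrier A\<rbrakk> \<Longrightarrow> x \<preceq> y \<or> y \<preceq> x"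
  shows "\<exists>m\<in>S. \<forall>x\<in>S. m \<preceq> x"
  using assms(1-3)
proof (induction S rule: finite_ne_induct)
  case (insert x S)
  then obtain m where m: "m \<in> S" "\<forall>z\<in>S. m \<preceq> z" by auto
  show ?case
  proof (cases "m \<preceq> x")
    case True
    then show ?thesis using m by blast
  next
    case False
    then have "x \<preceq> m" using chain[of m x] m insert.prems by blast
    then have "\<forall>z\<in>S. x \<preceq> z" using m insert.prems hle_trans[of x m] by blast
    then show ?thesis using insert.prems by auto
  qed
qed simp

theorem (in wajsberg_hoop) chang_completeness:
  fixes b :: "'v::finite \<Rightarrow> 'a"
  assumes b: "\<And>i. b i \<in> carrier A"
    and valid: "\<And>x. (\<And>i. 0 \<le> x i \<and> x i \<le> 1) \<Longrightarrow> heval unit_hoop x t = 1"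
  shows "heval A b t = \<one>"
proof (rule ccontr)
  let ?c = "heval A b t"
  assume ne: "?c \<noteq> \<one>"
  have c: "?c \<in> carrier A" by (rule heval_closed) (rule b)
  obtain F where F: "hfilter F" "?c \<notin> F"
    "\<And>x y. \<lbrakk>x \<in> carrier A; y \<in> carrier A\<rbrakk> \<Longrightarrow> x \<rightharpoonup> y \<in> F \<or> y \<rightharpoonup> x \<in> F"
    using prime_filter_exists[OF c ne] by blast
  let ?Q = "hquot F" and ?h = "hrep F"
  define b' where "b' = (\<lambda>i. ?h (b i))"
  note hom = hrep_hom[OF F(1)]
  interpret Q: wajsberg_hoop ?Q by (rule hquot_wajsberg[OF F(1)])
  have carQ: "carrier ?Q = ?h ` carrier A" by (simp add: hquot_def)
  have imp1: "?h x \<rightharpoonup>\<^bsub>?Q\<^esub> ?h y = \<one>\<^bsub>?Q\<^esub>" if "x \<in> carrier A" "y \<in> carrier A" "x \<rightharpoonup> y \<in> F" for x y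
  proof -
    have "?h (x \<rightharpoonup> y) = ?h \<one>" using that hfilterD(2)[OF F(1)] by (simp add: hrep_eq_iff[OF F(1)])
    then show ?thesis using hoop_homD(3,4)[OF hom] that by simp
  qed
  have chainQ: "x \<rightharpoonup>\<^bsub>?Q\<^esub> y = \<one>\<^bsub>?Q\<^esub> \<or> y \<rightharpoonup>\<^bsub>?Q\<^esub> x = \<one>\<^bsub>?Q\<^esub>" if "x \<in> carrier ?Q" "y \<in> carrier ?Q" for x y
    using that F(3) imp1 unfolding carQ by blast
  have b': "b' i \<in> carrier ?Q" for i using b by (simp add: b'_def carQ)
  have ev: "heval ?Q b' t = ?h ?c" unfolding b'_def by (rule hom_heval[OF hom b, symmetric])
  have "?h ?c \<noteq> ?h \<one>" using hrep_eq_iff[OF F(1) c hone_closed] F(2) c by simp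
  then have neQ: "heval ?Q b' t \<noteq> \<one>\<^bsub>?Q\<^esub>" using ev hoop_homD(4)[OF hom] by simp
  \<comment> \<open>The range of the valuation is added because a variable need not occur in t,
    while m must lie below every generator.\<close>
  let ?S = "subvals ?Q b' t \<union> range b'"
  have "finite ?S" "?S \<noteq> {}" "?S \<subseteq> carrier ?Q"
    using finite_subvals[of ?Q b' t] Q.subvals_closed[of b' t, OF b'] b' by auto
  then obtain m where m: "m \<in> ?S" "\<And>x. x \<in> ?S \<Longrightarrow> m \<rightharpoonup>\<^bsub>?Q\<^esub> x = \<one>\<^bsub>?Q\<^esub>"
    using Q.chain_min[of ?S] chainQ by blast
  have mQ: "m \<in> carrier ?Q" using m(1) \<open>?S \<subseteq> carrier ?Q\<close> by blast
  have mne: "m \<noteq> \<one>\<^bsub>?Q\<^esub>"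
  proof
    assume "m = \<one>\<^bsub>?Q\<^esub>"
    then have "heval ?Q b' t = \<one>\<^bsub>?Q\<^esub>"
      using m(2)[of "heval ?Q b' t"] heval_in_subvals[of ?Q b' t] Q.heval_closed[of b' t, OF b'] by simp
    then show False using neQ by simp
  qed
  have mb: "m \<rightharpoonup>\<^bsub>?Q\<^esub> b' i = \<one>\<^bsub>?Q\<^esub>" for i using m(2) by blast
  interpret chang_valuation ?Q m b'
    by unfold_locales (fact mQ mne chainQ b' mb)+
  obtain x where "\<forall>i. 0 \<le> x i \<and> x i \<le> 1" "heval unit_hoop x t < 1"
    using real_refutation[OF m(2) neQ] by blast
  then show False using valid[of x] by simp
qed

corollary (in wajsberg_hoop) identity_transfer:
  fixes b :: "'v::finite \<Rightarrow> 'a"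
  assumes b: "\<And>i. b i \<in> carrier A"
    and valid: "\<And>x. (\<And>i. 0 \<le> x i \<and> x i \<le> 1) \<Longrightarrow> heval unit_hoop x s = heval unit_hoop x t"
  shows "heval A b s = heval A b t"
proof (rule hle_antisym)
  have "heval A b (HImp s t) = \<one>" "heval A b (HImp t s) = \<one>"
    by (rule chang_completeness[OF b]; simp add: valid)+
  then show "heval A b s \<preceq> heval A b t" "heval A b t \<preceq> heval A b s" by simp_all
qed (use heval_closed b in blast)+

section \<open>McNaughton's theorem\<close>

text \<open>Subtracting the chord makes both endpoint values 0. If the difference is nonnegative
  throughout, the piece active just after 0 starts at 0 and does not decrease. Otherwise take the
  first return to nonnegative values after a negative one: the piece active just before it is
  increasing, hence negative at 0 and nonnegative at 1.\<close>

lemma affine_piece_across_segment: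
  fixes \<phi> :: "real \<Rightarrow> real" and \<alpha> \<beta> :: "'k \<Rightarrow> real"
  assumes fin: "finite K" and cont: "continuous_on {0..1} \<phi>"
    and pieces: "\<And>t. t \<in> {0..1} \<Longrightarrow> \<exists>k\<in>K. \<phi> t = \<alpha> k + \<beta> k * t"
  shows "\<exists>k\<in>K. \<alpha> k \<le> \<phi> 0 \<and> \<phi> 1 \<le> \<alpha> k + \<beta> k"
proof -
  define \<psi> where "\<psi> t = \<phi> t - \<phi> 0 - t * (\<phi> 1 - \<phi> 0)" for t
  define a where "a k = \<alpha> k - \<phi> 0" for k
  define b where "b k = \<beta> k - (\<phi> 1 - \<phi> 0)" for k
  have cont\<psi>: "continuous_on {0..1} \<psi>"
    unfolding \<psi>_def using cont by (intro continuous_intros)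
  have pieces\<psi>: "\<exists>k\<in>K. \<psi> t = a k + b k * t" if "t \<in> {0..1}" for t
    using pieces[OF that] by (auto simp: \<psi>_def a_def b_def algebra_simps)
  \<comment> \<open>By continuity and finiteness a piece that disagrees with \<psi> at s disagrees
    nearby as well, so every piece active close to s is active at s.\<close>
  have local: "\<exists>\<delta>>0. \<forall>t\<in>{0..1}. \<bar>t - s\<bar> < \<delta> \<longrightarrow>
      (\<exists>k\<in>K. \<psi> t = a k + b k * t \<and> \<psi> s = a k + b k * s)" if s: "s \<in> {0..1}" for s
  proof -
    have "\<forall>k\<in>K. \<forall>\<^sub>F t in at s within {0..1}. \<psi> s \<noteq> a k + b k * s \<longrightarrow> \<psi> t \<noteq> a k + b k * t"
    proof
      fix k assume "k \<in> K"
      have "((\<lambda>t. \<psi> t - (a k + b k * t)) \<longlongrightarrow> \<psi> s - (a k + b k * s)) (at s within {0..1})"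
        using cont\<psi> s by (intro tendsto_intros) (auto simp: continuous_on_def)
      then have "\<psi> s - (a k + b k * s) \<noteq> 0 \<Longrightarrow>
          \<forall>\<^sub>F t in at s within {0..1}. \<psi> t - (a k + b k * t) \<noteq> 0"
        by (rule tendsto_imp_eventually_ne)
      then show "\<forall>\<^sub>F t in at s within {0..1}. \<psi> s \<noteq> a k + b k * s \<longrightarrow> \<psi> t \<noteq> a k + b k * t"
        by (cases "\<psi> s = a k + b k * s") auto
    qed
    then have "\<forall>\<^sub>F t in at s within {0..1}. \<forall>k\<in>K. \<psi> s \<noteq> a k + b k * s \<longrightarrow> \<psi> t \<noteq> a k + b k * t"
      using fin by (simp add: eventually_ball_finite_distrib)
    then obtain \<delta> where \<delta>: "\<delta> > 0" "\<And>t. \<lbrakk>t \<in> {0..1}; t \<noteq> s; dist t s < \<delta>\<rbrakk> \<Longrightarrow>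
        \<forall>k\<in>K. \<psi> s \<noteq> a k + b k * s \<longrightarrow> \<psi> t \<noteq> a k + b k * t"
      unfolding eventually_at by blast
    show ?thesis
    proof (intro exI[of _ \<delta>] conjI ballI impI \<delta>(1))
      fix t assume t: "t \<in> {0..1}" "\<bar>t - s\<bar> < \<delta>"
      obtain k where k: "k \<in> K" "\<psi> t = a k + b k * t" using pieces\<psi> t by blast
      moreover have "\<psi> s = a k + b k * s"
        using \<delta>(2)[of t] t k by (cases "t = s") (auto simp: dist_real_def)
      ultimately show "\<exists>k\<in>K. \<psi> t = a k + b k * t \<and> \<psi> s = a k + b k * s" by blast
    qed
  qed
  have \<psi>01: "\<psi> 0 = 0" "\<psi> 1 = 0" by (simp_all add: \<psi>_def)
  have "\<exists>k\<in>K. a k \<le> 0 \<and> 0 \<le> a k + b k"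
  proof (cases "\<forall>t\<in>{0..1}. 0 \<le> \<psi> t")
    case True
    obtain \<delta> where \<delta>: "\<delta> > 0" "\<And>t. \<lbrakk>t \<in> {0..1}; \<bar>t - 0\<bar> < \<delta>\<rbrakk> \<Longrightarrow>
        \<exists>k\<in>K. \<psi> t = a k + b k * t \<and> \<psi> 0 = a k + b k * 0"
      using local[of 0] by auto
    define t where "t = min 1 (\<delta> / 2)"
    have t: "t \<in> {0..1}" "\<bar>t - 0\<bar> < \<delta>" "0 < t" using \<delta>(1) by (auto simp: t_def min_def)
    then obtain k where k: "k \<in> K" "\<psi> t = a k + b k * t" "\<psi> 0 = a k + b k * 0" using \<delta>(2) by blast
    then have "a k = 0" using \<psi>01 by simp
    moreover have "0 \<le> \<psi> t" using True t(1) by blast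
    then have "0 \<le> b k" using t(3) k(2) \<open>a k = 0\<close> by (simp add: zero_le_mult_iff)
    ultimately show ?thesis using k(1) by (intro bexI[of _ k]) simp_all
  next
    case False
    then obtain t' where t': "t' \<in> {0..1}" "\<psi> t' < 0" by force
    \<comment> \<open>Closedness yields a first point of return; immediately to its left the
      function is still negative.\<close>
    define Z where "Z = {t \<in> {t'..1}. 0 \<le> \<psi> t}"
    have "closed Z" unfolding Z_def
      using cont\<psi> t' by (intro continuous_on_closed_Collect_le continuous_intros)
        (auto intro: continuous_on_subset)
    moreover have "bounded Z" by (rule bounded_subset[of "{t'..1}"]) (auto simp: Z_def)
    ultimately have "compact Z" by (simp add: compact_eq_bounded_closed)
    moreover have "1 \<in> Z" using t' \<psi>01 by (simp add: Z_def)
    ultimately obtain s where s: "s \<in> Z" "\<And>t. t \<in> Z \<Longrightarrow> s \<le> t"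
      using compact_attains_inf[of Z] by blast
    have s': "t' < s" "s \<le> 1" "0 \<le> \<psi> s" "s \<in> {0..1}"
      using s(1) t' by (auto simp: Z_def order_less_le)
    obtain \<delta> where \<delta>: "\<delta> > 0" "\<And>t. \<lbrakk>t \<in> {0..1}; \<bar>t - s\<bar> < \<delta>\<rbrakk> \<Longrightarrow>
        \<exists>k\<in>K. \<psi> t = a k + b k * t \<and> \<psi> s = a k + b k * s"
      using local[OF s'(4)] by auto
    define t where "t = max t' (s - \<delta> / 2)"
    have t: "t \<in> {0..1}" "\<bar>t - s\<bar> < \<delta>" "t < s" "t' \<le> t"
      using \<delta>(1) s' t' by (auto simp: t_def max_def)
    have neg: "\<psi> t < 0"
    proof (rule ccontr)
      assume "\<not> \<psi> t < 0"
      then have "t \<in> Z" using t by (simp add: Z_def)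
      then show False using s(2) t(3) by force
    qed
    obtain k where k: "k \<in> K" "\<psi> t = a k + b k * t" "\<psi> s = a k + b k * s" using \<delta>(2) t by blast
    have "b k * t < b k * s" using k neg s'(3) by linarith
    then have bk: "0 < b k" using t(3) mult_left_mono_neg[of t s "b k"] by linarith
    then have "0 \<le> b k * t" using t(1) by simp
    moreover have "b k * s \<le> b k" using bk s'(2) by (simp add: mult_left_le)
    ultimately show ?thesis using k neg s'(3) by (intro bexI[of _ k]) linarith+
  qed
  then obtain k where "k \<in> K" "a k \<le> 0" "0 \<le> a k + b k" by blast
  then show ?thesis unfolding a_def b_def by (intro bexI[of _ k]) auto
qed

section \<open>Hoop term functions and MV-term functions on the cube\<close>

abbreviation teval :: "'n hterm \<Rightarrow> real ^ 'n \<Rightarrow> real" where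
  "teval t x \<equiv> heval unit_hoop (\<lambda>i. x $ i) t"

lemma unit_heval_bounds:
  assumes "\<And>i. 0 \<le> f i \<and> f i \<le> 1" shows "0 \<le> heval unit_hoop f t" "heval unit_hoop f t \<le> 1"
  by (induction t) (use assms in auto)

lemma teval_bounds:
  assumes "x \<in> unit_cube" shows "0 \<le> teval t x" "teval t x \<le> 1"
  using assms unit_heval_bounds[of "\<lambda>i. x $ i" t] by (auto simp: unit_cube_def)

lemma unit_heval_one: "(\<And>i. f i = 1) \<Longrightarrow> heval unit_hoop f t = 1"
  by (induction t) simp_all

lemma one_in_cube: "1 \<in> unit_cube"
  by (simp add: unit_cube_def)

definition term_fun :: "(real ^ 'n \<Rightarrow> real) \<Rightarrow> bool" where
  "term_fun f \<longleftrightarrow> (\<exists>t. \<forall>x\<in>unit_cube. f x = teval t x)"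

lemma term_fun_mult: "\<lbrakk>term_fun f; term_fun g\<rbrakk> \<Longrightarrow> term_fun (\<lambda>x. max 0 (f x + g x - 1))"
proof -
  assume "term_fun f" "term_fun g"
  then obtain s t where "\<forall>x\<in>unit_cube. f x = teval s x" "\<forall>x\<in>unit_cube. g x = teval t x"
    unfolding term_fun_def by blast
  then show ?thesis unfolding term_fun_def by (intro exI[of _ "HMul s t"]) simp
qed

lemma term_fun_imp: "\<lbrakk>term_fun f; term_fun g\<rbrakk> \<Longrightarrow> term_fun (\<lambda>x. min 1 (1 - f x + g x))"
proof -
  assume "term_fun f" "term_fun g"
  then obtain s t where "\<forall>x\<in>unit_cube. f x = teval s x" "\<forall>x\<in>unit_cube. g x = teval t x"
    unfolding term_fun_def by blast
  then show ?thesis unfolding term_fun_def by (intro exI[of _ "HImp s t"]) simp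
qed

lemma term_fun_one: "term_fun (\<lambda>x. 1)"
  unfolding term_fun_def by (rule exI[of _ HOne]) simp

lemma term_fun_proj: "term_fun (\<lambda>x. x $ i)"
  unfolding term_fun_def by (rule exI[of _ "HVar i"]) simp

lemma term_fun_bounds:
  assumes "term_fun f" "x \<in> unit_cube" shows "0 \<le> f x" "f x \<le> 1"
  using assms teval_bounds[of x] by (auto simp: term_fun_def)

lemma term_fun_cong:
  assumes "term_fun f" "\<And>x. x \<in> unit_cube \<Longrightarrow> g x = f x" shows "term_fun g"
  using assms by (simp add: term_fun_def)

text \<open>The truncated sum is \<open>(x \<rightarrow> x y) \<rightarrow> y\<close>, so it needs no constant \<open>0\<close>.\<close>
lemma term_fun_oplus:
  assumes f: "term_fun f" and g: "term_fun g" shows "term_fun (\<lambda>x. min 1 (f x + g x))"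
proof (rule term_fun_cong[OF term_fun_imp[OF term_fun_imp[OF f term_fun_mult[OF f g]] g]])
  fix x :: "real ^ 'a" assume "x \<in> unit_cube"
  then have "0 \<le> f x" "f x \<le> 1" "0 \<le> g x" "g x \<le> 1" using term_fun_bounds f g by blast+
  then show "min 1 (f x + g x) = min 1 (1 - min 1 (1 - f x + max 0 (f x + g x - 1)) + g x)"
    by (simp add: min_def max_def)
qed

text \<open>The MV-term functions: a function whose value at \<open>1\<close> is \<open>1\<close> is a hoop term function,
  otherwise its negation is.\<close>
definition mv_fun :: "(real ^ 'n \<Rightarrow> real) \<Rightarrow> bool" where
  "mv_fun f \<longleftrightarrow> term_fun f \<or> term_fun (\<lambda>x. 1 - f x)"

lemma mv_fun_bounds:
  assumes "mv_fun f" "x \<in> unit_cube" shows "0 \<le> f x" "f x \<le> 1"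
  using assms term_fun_bounds[of f x] term_fun_bounds[of "\<lambda>x. 1 - f x" x]
  by (auto simp: mv_fun_def)

lemma mv_fun_cong:
  assumes "mv_fun f" "\<And>x. x \<in> unit_cube \<Longrightarrow> g x = f x" shows "mv_fun g"
  using assms(1) unfolding mv_fun_def
proof (elim disjE)
  assume "term_fun f"
  from term_fun_cong[OF this assms(2)] show "term_fun g \<or> term_fun (\<lambda>x. 1 - g x)" by blast
next
  assume "term_fun (\<lambda>x. 1 - f x)"
  from term_fun_cong[OF this, of "\<lambda>x. 1 - g x"] assms(2)
  show "term_fun g \<or> term_fun (\<lambda>x. 1 - g x)" by simp
qed

lemma mv_fun_neg: "mv_fun f \<Longrightarrow> mv_fun (\<lambda>x. 1 - f x)"
  by (auto simp: mv_fun_def)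

text \<open>With ~f for 1 - f, the four cases are f -> g, the negation of the product of f and ~g,
  the truncated sum of ~f and g, and the contrapositive ~g -> ~f. All of them are hoop terms up to
  negation.\<close>

lemma mv_fun_imp:
  assumes "mv_fun f" "mv_fun g" shows "mv_fun (\<lambda>x. min 1 (1 - f x + g x))"
proof -
  consider "term_fun f" "term_fun g" | "term_fun f" "term_fun (\<lambda>x. 1 - g x)"
    | "term_fun (\<lambda>x. 1 - f x)" "term_fun g" | "term_fun (\<lambda>x. 1 - f x)" "term_fun (\<lambda>x. 1 - g x)"
    using assms by (auto simp: mv_fun_def)
  then show ?thesis
  proof cases
    case 1
    show ?thesis using term_fun_imp[OF 1] by (simp add: mv_fun_def)
  next
    case 2
    have "term_fun (\<lambda>x. 1 - min 1 (1 - f x + g x))"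
      by (rule term_fun_cong[OF term_fun_mult[OF 2]]) (simp add: min_def max_def)
    then show ?thesis by (auto simp: mv_fun_def)
  next
    case 3
    show ?thesis using term_fun_oplus[OF 3] by (simp add: mv_fun_def)
  next
    case 4
    have "term_fun (\<lambda>x. min 1 (1 - f x + g x))"
      by (rule term_fun_cong[OF term_fun_imp[OF 4(2,1)]]) (simp add: algebra_simps)
    then show ?thesis by (auto simp: mv_fun_def)
  qed
qed

lemma mv_fun_oplus:
  assumes "mv_fun f" "mv_fun g" shows "mv_fun (\<lambda>x. min 1 (f x + g x))"
  using mv_fun_imp[OF mv_fun_neg[OF assms(1)] assms(2)] by simp

lemma mv_fun_mult:
  assumes "mv_fun f" "mv_fun g" shows "mv_fun (\<lambda>x. max 0 (f x + g x - 1))"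
  by (rule mv_fun_cong[OF mv_fun_neg[OF mv_fun_imp[OF assms(1) mv_fun_neg[OF assms(2)]]]])
    (simp add: min_def max_def)

lemma mv_fun_max:
  assumes "mv_fun f" "mv_fun g" shows "mv_fun (\<lambda>x. max (f x) (g x))"
proof (rule mv_fun_cong[OF mv_fun_imp[OF mv_fun_imp[OF assms] assms(2)]])
  fix x :: "real ^ 'a" assume "x \<in> unit_cube"
  then have "0 \<le> f x" "f x \<le> 1" "0 \<le> g x" "g x \<le> 1" using mv_fun_bounds assms by blast+
  then show "max (f x) (g x) = min 1 (1 - min 1 (1 - f x + g x) + g x)"
    by (simp add: min_def max_def)
qed

lemma mv_fun_min:
  assumes "mv_fun f" "mv_fun g" shows "mv_fun (\<lambda>x. min (f x) (g x))"
  by (rule mv_fun_cong[OF mv_fun_neg[OF mv_fun_max[OF mv_fun_neg[OF assms(1)] mv_fun_neg[OF assms(2)]]]])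
    (simp add: min_def max_def)

lemma mv_fun_Max:
  assumes "finite S" "S \<noteq> {}" "\<And>i. i \<in> S \<Longrightarrow> mv_fun (F i)"
  shows "mv_fun (\<lambda>x. Max ((\<lambda>i. F i x) ` S))"
  using assms
proof (induction S rule: finite_ne_induct)
  case (insert i S)
  then have "mv_fun (\<lambda>x. max (F i x) (Max ((\<lambda>i. F i x) ` S)))" by (intro mv_fun_max) auto
  then show ?case using insert.hyps by simp
qed simp

lemma mv_fun_Min:
  assumes "finite S" "S \<noteq> {}" "\<And>i. i \<in> S \<Longrightarrow> mv_fun (F i)"
  shows "mv_fun (\<lambda>x. Min ((\<lambda>i. F i x) ` S))"
  using assms
proof (induction S rule: finite_ne_induct)
  case (insert i S)
  then have "mv_fun (\<lambda>x. min (F i x) (Min ((\<lambda>i. F i x) ` S)))" by (intro mv_fun_min) auto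
  then show ?case using insert.hyps by simp
qed simp

section \<open>Clipped integer affine functions\<close>

definition clip :: "real \<Rightarrow> real" where "clip c = min 1 (max 0 c)"

text \<open>For c >= 0 the second factor is 1 and only the upper truncation acts. For -1 <= c < 0
  the first factor is x and the second, c + 1, restores the negative shift; below -1 both sides
  vanish.\<close>

lemma clip_add:
  assumes "0 \<le> x" "x \<le> 1"
  shows "clip (c + x) = max 0 (min 1 (clip c + x) + clip (c + 1) - 1)"
  using assms by (auto simp: clip_def min_def max_def)

lemma mv_fun_clip_step:
  assumes "mv_fun (\<lambda>x. clip (p x))" "mv_fun (\<lambda>x. clip (p x + 1))" "mv_fun f"
  shows "mv_fun (\<lambda>x. clip (p x + f x))"
  by (rule mv_fun_cong[OF mv_fun_mult[OF mv_fun_oplus[OF assms(1,3)] assms(2)]])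
    (rule clip_add, (rule mv_fun_bounds[OF assms(3)], assumption)+)

lemma mv_fun_proj: "mv_fun (\<lambda>x. x $ i)"
  by (simp add: mv_fun_def term_fun_proj)

text \<open>One unit of one coefficient is split off at a time, so the sum of the |a i| decreases.
  The constant term stays general since each step needs the clipped function both for p and for p +
  1.\<close>

lemma mv_fun_clip_affine:
  fixes a :: "'n::finite \<Rightarrow> int"
  shows "mv_fun (\<lambda>x. clip ((\<Sum>i\<in>UNIV. of_int (a i) * x $ i) + of_int b))"
proof (induction "\<Sum>i\<in>UNIV. nat \<bar>a i\<bar>" arbitrary: a b rule: less_induct)
  case less
  show ?case
  proof (cases "\<forall>i. a i = 0")
    case True
    have "clip (of_int b) = 0 \<or> clip (of_int b) = 1"
    proof (cases "b \<le> 0")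
      case False
      then have "(1::real) \<le> of_int b" by linarith
      then show ?thesis by (simp add: clip_def)
    qed (simp add: clip_def)
    moreover have "mv_fun (\<lambda>x :: real ^ 'n. 1)" "mv_fun (\<lambda>x :: real ^ 'n. 0)"
      using term_fun_one by (auto simp: mv_fun_def)
    ultimately show ?thesis using True by auto
  next
    case False
    then obtain j where j: "a j \<noteq> 0" by blast
    define \<epsilon> where "\<epsilon> = sgn (a j)"
    define a' where "a' = a(j := a j - \<epsilon>)"
    have split: "(\<Sum>i\<in>UNIV. h i (a' i)) = h j (a j - \<epsilon>) + (\<Sum>i\<in>UNIV - {j}. h i (a i))"
      "(\<Sum>i\<in>UNIV. h i (a i)) = h j (a j) + (\<Sum>i\<in>UNIV - {j}. h i (a i))"
      for h :: "'n \<Rightarrow> int \<Rightarrow> 'b::comm_monoid_add"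
      by (simp_all add: a'_def sum.remove[of UNIV j])
    have "nat \<bar>a j - \<epsilon>\<bar> < nat \<bar>a j\<bar>" using j by (auto simp: \<epsilon>_def sgn_if)
    then have "(\<Sum>i\<in>UNIV. nat \<bar>a' i\<bar>) < (\<Sum>i\<in>UNIV. nat \<bar>a i\<bar>)"
      unfolding split[of "\<lambda>i c. nat \<bar>c\<bar>"] by simp
    note IH = less[OF this]
    have sum: "(\<Sum>i\<in>UNIV. of_int (a i) * x $ i) = (\<Sum>i\<in>UNIV. of_int (a' i) * x $ i) + of_int \<epsilon> * x $ j"
      for x :: "real ^ 'n"
      unfolding split[of "\<lambda>i c. of_int c * x $ i"] by (simp add: algebra_simps)
    have "\<epsilon> = 1 \<or> \<epsilon> = - 1" using j by (simp add: \<epsilon>_def sgn_if)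
    then consider "\<epsilon> = 1" | "\<epsilon> = - 1" by blast
    then show ?thesis
    proof cases
      case 1
      have "mv_fun (\<lambda>x. clip (((\<Sum>i\<in>UNIV. of_int (a' i) * x $ i) + of_int b) + x $ j))"
        by (rule mv_fun_clip_step[OF IH _ mv_fun_proj]) (use IH[of "b + 1"] in \<open>simp add: add.assoc\<close>)
      then show ?thesis unfolding sum 1 by (simp add: algebra_simps)
    next
      case 2
      \<comment> \<open>Subtracting a coordinate means adding its negation and lowering the constant
        by 1.\<close>
      have "mv_fun (\<lambda>x. clip (((\<Sum>i\<in>UNIV. of_int (a' i) * x $ i) + of_int (b - 1)) + (1 - x $ j)))"
        by (rule mv_fun_clip_step[OF IH _ mv_fun_neg[OF mv_fun_proj]])
          (use IH[of b] in \<open>simp add: algebra_simps\<close>)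
      then show ?thesis unfolding sum 2 by (simp add: algebra_simps)
    qed
  qed
qed

lemma mv_fun_clip: "int_affine p \<Longrightarrow> mv_fun (\<lambda>x. clip (p x))"
  using mv_fun_clip_affine by (auto simp: int_affine_def)

lemma affine_segment:
  assumes "int_affine p"
  shows "p (x + t *\<^sub>R (y - x)) = p x + (p y - p x) * t"
proof -
  obtain a :: "'a \<Rightarrow> int" and b :: int where
    p: "p = (\<lambda>x. (\<Sum>i\<in>UNIV. of_int (a i) * x $ i) + of_int b)"
    using assms by (auto simp: int_affine_def)
  show ?thesis
    by (simp add: p algebra_simps sum.distrib sum_subtractf sum_distrib_left)
qed

lemma convex_unit_cube: "convex unit_cube"
proof (rule convexI)
  fix x y :: "real ^ 'n" and u v :: real
  assume *: "x \<in> unit_cube" "y \<in> unit_cube" "0 \<le> u" "0 \<le> v" "u + v = 1"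
  have "u * x $ i + v * y $ i \<le> 1" for i
    using * convex_bound_le[of "x $ i" 1 "y $ i" u v] by (simp add: unit_cube_def)
  then show "u *\<^sub>R x + v *\<^sub>R y \<in> unit_cube" using * by (simp add: unit_cube_def)
qed

text \<open>The max-min representation \<open>f x = max\<^sub>y min {p x | p y \<ge> f y}\<close> of a piecewise
  affine function over the pieces \<open>p\<close>.\<close>
theorem mcnaughton:
  fixes f :: "real ^ 'n \<Rightarrow> real"
  assumes "wajsberg_function f"
  shows "term_fun f"
proof -
  from assms have cont: "continuous_on unit_cube f" and f1: "f 1 = 1"
    and f01: "\<And>x. x \<in> unit_cube \<Longrightarrow> 0 \<le> f x \<and> f x \<le> 1"
    by (auto simp: wajsberg_function_def int_pwl_def)
  obtain Q where Q: "finite Q" "\<And>p. p \<in> Q \<Longrightarrow> int_affine p"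
    "\<And>x. x \<in> unit_cube \<Longrightarrow> \<exists>p\<in>Q. f x = p x"
    using assms by (auto simp: wajsberg_function_def int_pwl_def)
  define S where "S y = {p \<in> Q. f y \<le> p y}" for y
  have S: "finite (S y)" "S y \<subseteq> Q" for y using Q by (auto simp: S_def)
  have Sne: "S y \<noteq> {}" if y: "y \<in> unit_cube" for y using Q(3)[OF y] by (auto simp: S_def)
  \<comment> \<open>Along the segment from x to y some piece starts at or below f x and ends at or
    above f y. It belongs to \<open>S y\<close> and keeps the minimum over \<open>S y\<close> at or
    below f x.\<close>
  have cross: "\<exists>p\<in>S y. p x \<le> f x" if x: "x \<in> unit_cube" and y: "y \<in> unit_cube" for x y
  proof -
    have seg: "x + t *\<^sub>R (y - x) \<in> unit_cube" if "t \<in> {0..1}" for t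
      using convexD[OF convex_unit_cube x y, of "1 - t" t] that by (simp add: algebra_simps)
    have "\<exists>p\<in>Q. p x \<le> f (x + 0 *\<^sub>R (y - x)) \<and> f (x + 1 *\<^sub>R (y - x)) \<le> p x + (p y - p x)"
    proof (rule affine_piece_across_segment[OF Q(1)])
      show "continuous_on {0..1} (\<lambda>t. f (x + t *\<^sub>R (y - x)))"
        by (rule continuous_on_compose2[OF cont]) (auto intro!: continuous_intros seg)
      show "\<exists>p\<in>Q. f (x + t *\<^sub>R (y - x)) = p x + (p y - p x) * t" if "t \<in> {0..1}" for t
        using Q(3)[OF seg[OF that]] affine_segment[OF Q(2)] by metis
    qed
    then show ?thesis by (auto simp: S_def)
  qed
  define G where "G T x = Min ((\<lambda>p. clip (p x)) ` T)" for T :: "(real ^ 'n \<Rightarrow> real) set" and x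
  define M where "M x = Max ((\<lambda>T. G T x) ` S ` unit_cube)" for x
  \<comment> \<open>The points y form a continuum, but each \<open>S y\<close> is a subset of the
    finite set Q, so the outer maximum is finite.\<close>
  have finS: "finite (S ` unit_cube)" "S ` unit_cube \<noteq> {}"
    using finite_subset[of "S ` unit_cube" "Pow Q"] S(2) Q(1) one_in_cube by auto
  have "mv_fun (G T)" if T: "T \<in> S ` unit_cube" for T
  proof -
    obtain y where y: "y \<in> unit_cube" "T = S y" using T by blast
    show ?thesis unfolding G_def
    proof (rule mv_fun_Min)
      show "finite T" "T \<noteq> {}" using S(1) Sne y by simp_all
      show "mv_fun (\<lambda>x. clip (p x))" if "p \<in> T" for p
        using that S(2) y Q(2) by (blast intro: mv_fun_clip)
    qed
  qed
  then have "mv_fun M" unfolding M_def using finS by (intro mv_fun_Max) auto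
  moreover have "f x = M x" if x: "x \<in> unit_cube" for x
  proof (rule antisym)
    have "f x \<le> clip (p x)" if "p \<in> S x" for p
      using that f01[OF x] by (auto simp: S_def clip_def)
    then have "f x \<le> G (S x) x" unfolding G_def using S Sne[OF x] by (subst Min_ge_iff) auto
    also have "\<dots> \<le> M x" unfolding M_def using finS x by (intro Max_ge) auto
    finally show "f x \<le> M x" .
    have "G (S y) x \<le> f x" if y: "y \<in> unit_cube" for y
    proof -
      obtain p where p: "p \<in> S y" "p x \<le> f x" using cross[OF x y] by blast
      have "G (S y) x \<le> clip (p x)" unfolding G_def using S p by (intro Min_le) auto
      also have "\<dots> \<le> f x" using p(2) f01[OF x] by (auto simp: clip_def)
      finally show ?thesis .
    qed
    then show "M x \<le> f x" unfolding M_def using finS by (subst Max_le_iff) auto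
  qed
  ultimately have "mv_fun f" by (rule mv_fun_cong)
  \<comment> \<open>Every hoop term takes the value 1 at the vertex 1, where 1 - f is 0.\<close>
  moreover have "\<not> term_fun (\<lambda>x. 1 - f x)"
  proof
    assume "term_fun (\<lambda>x. 1 - f x)"
    then obtain t where "1 - f 1 = teval t (1 :: real ^ 'n)" unfolding term_fun_def using one_in_cube by blast
    then show False using f1 unit_heval_one[of "\<lambda>i. (1 :: real ^ 'n) $ i" t] by simp
  qed
  ultimately show ?thesis by (simp add: mv_fun_def)
qed

section \<open>Closure properties of Wajsberg functions\<close>

lemma int_affine_add: "\<lbrakk>int_affine p; int_affine q\<rbrakk> \<Longrightarrow> int_affine (\<lambda>x. p x + q x)"
  unfolding int_affine_def
proof (elim exE)
  fix a c :: "'a \<Rightarrow> int" and b d :: int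
  assume "p = (\<lambda>x. (\<Sum>i\<in>UNIV. of_int (a i) * x $ i) + of_int b)"
    "q = (\<lambda>x. (\<Sum>i\<in>UNIV. of_int (c i) * x $ i) + of_int d)"
  then show "\<exists>a b. (\<lambda>x. p x + q x) = (\<lambda>x. (\<Sum>i\<in>UNIV. of_int (a i) * x $ i) + of_int b)"
    by (intro exI[of _ "\<lambda>i. a i + c i"] exI[of _ "b + d"]) (simp add: algebra_simps sum.distrib)
qed

lemma int_affine_minus: "int_affine p \<Longrightarrow> int_affine (\<lambda>x. - p x)"
  unfolding int_affine_def
proof (elim exE)
  fix a :: "'a \<Rightarrow> int" and b :: int
  assume "p = (\<lambda>x. (\<Sum>i\<in>UNIV. of_int (a i) * x $ i) + of_int b)"
  then show "\<exists>a b. (\<lambda>x. - p x) = (\<lambda>x. (\<Sum>i\<in>UNIV. of_int (a i) * x $ i) + of_int b)"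
    by (intro exI[of _ "\<lambda>i. - a i"] exI[of _ "- b"]) (simp add: sum_negf)
qed

lemma int_affine_const: "int_affine (\<lambda>x. of_int b)"
  unfolding int_affine_def by (rule exI[of _ "\<lambda>i. 0"]) auto

lemma int_affine_proj: "int_affine (\<lambda>x. x $ j)"
  unfolding int_affine_def
  by (rule exI[of _ "\<lambda>i. if i = j then 1 else 0"], rule exI[of _ 0])
    (simp add: if_distrib[of of_int] if_distrib[of "\<lambda>c. c * _"] cong: if_cong)

lemma int_affine_ops:
  assumes "int_affine p" "int_affine q"
  shows "int_affine (\<lambda>x. p x + q x - 1)" "int_affine (\<lambda>x. 1 - p x + q x)"
  using int_affine_add[OF int_affine_add[OF assms] int_affine_const[of "- 1"]]
    int_affine_add[OF int_affine_add[OF int_affine_const[of 1] int_affine_minus[OF assms(1)]] assms(2)]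
  by simp_all

text \<open>Each operation of [0,1] is an affine combination of its arguments or a constant bound:
  \<open>d\<close> is 0 for the product and 1 for the implication. The pieces of h are the
  combinations of all pairs of pieces, together with that constant.\<close>

lemma int_pwl_two_pieces:
  fixes f g h :: "real ^ 'n \<Rightarrow> real"
  assumes f: "int_pwl f" and g: "int_pwl g" and cont: "continuous_on unit_cube h"
    and aff: "\<And>p q :: real ^ 'n \<Rightarrow> real. \<lbrakk>int_affine p; int_affine q\<rbrakk> \<Longrightarrow> int_affine (\<lambda>x. c (p x) (q x))"
    and h: "\<And>x. x \<in> unit_cube \<Longrightarrow> h x = c (f x) (g x) \<or> h x = of_int d"
  shows "int_pwl h"
proof -
  obtain P where P: "finite P" "\<And>p. p \<in> P \<Longrightarrow> int_affine p" "\<And>x. x \<in> unit_cube \<Longrightarrow> \<exists>p\<in>P. f x = p x"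
    using f by (auto simp: int_pwl_def)
  obtain Q where Q: "finite Q" "\<And>p. p \<in> Q \<Longrightarrow> int_affine p" "\<And>x. x \<in> unit_cube \<Longrightarrow> \<exists>p\<in>Q. g x = p x"
    using g by (auto simp: int_pwl_def)
  let ?R = "insert (\<lambda>x. of_int d) ((\<lambda>(p, q) x. c (p x) (q x)) ` (P \<times> Q))"
  have "\<exists>r\<in>?R. h x = r x" if x: "x \<in> unit_cube" for x
  proof -
    obtain p q where pq: "p \<in> P" "f x = p x" "q \<in> Q" "g x = q x" using P(3)[OF x] Q(3)[OF x] by blast
    then have "(\<lambda>x. c (p x) (q x)) \<in> ?R"
      by (intro insertI2 image_eqI[of _ _ "(p, q)"]) simp_all
    then show ?thesis using h[OF x] pq(2,4) by (metis (no_types, lifting) insertI1)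
  qed
  moreover have "int_affine r" if "r \<in> ?R" for r
    using that aff[OF P(2) Q(2)] int_affine_const by auto
  moreover have "finite ?R" using P(1) Q(1) by simp
  ultimately show ?thesis unfolding int_pwl_def using cont by blast
qed

lemma wajsberg_function_bounds:
  assumes "wajsberg_function f" "x \<in> unit_cube" shows "0 \<le> f x" "f x \<le> 1"
  using assms by (auto simp: wajsberg_function_def)

lemma wajsberg_functionI:
  assumes "int_pwl f" "\<And>x. x \<in> unit_cube \<Longrightarrow> 0 \<le> f x \<and> f x \<le> 1" "f 1 = 1"
  shows "wajsberg_function f"
  using assms by (auto simp: wajsberg_function_def)

lemma wajsberg_function_at_one: "wajsberg_function f \<Longrightarrow> f 1 = 1"
  by (simp add: wajsberg_function_def)

lemma wajsberg_function_mult: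
  assumes f: "wajsberg_function f" and g: "wajsberg_function g"
  shows "wajsberg_function (\<lambda>x. max 0 (f x + g x - 1))"
proof -
  have pw: "int_pwl f" "int_pwl g" using assms by (auto simp: wajsberg_function_def)
  have "int_pwl (\<lambda>x. max 0 (f x + g x - 1))"
  proof (rule int_pwl_two_pieces[OF pw])
    show "continuous_on unit_cube (\<lambda>x. max 0 (f x + g x - 1))"
      using pw by (intro continuous_intros) (auto simp: int_pwl_def)
    show "max 0 (f x + g x - 1) = f x + g x - 1 \<or> max 0 (f x + g x - 1) = of_int 0" for x
      by auto
  qed (rule int_affine_ops)
  moreover have "0 \<le> max 0 (f x + g x - 1) \<and> max 0 (f x + g x - 1) \<le> 1" if x: "x \<in> unit_cube" for x
    using wajsberg_function_bounds[OF f x] wajsberg_function_bounds[OF g x] by simp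
  ultimately show ?thesis
    using wajsberg_function_at_one[OF f] wajsberg_function_at_one[OF g]
    by (intro wajsberg_functionI) simp_all
qed

lemma wajsberg_function_imp:
  assumes f: "wajsberg_function f" and g: "wajsberg_function g"
  shows "wajsberg_function (\<lambda>x. min 1 (1 - f x + g x))"
proof -
  have pw: "int_pwl f" "int_pwl g" using assms by (auto simp: wajsberg_function_def)
  have "int_pwl (\<lambda>x. min 1 (1 - f x + g x))"
  proof (rule int_pwl_two_pieces[OF pw])
    show "continuous_on unit_cube (\<lambda>x. min 1 (1 - f x + g x))"
      using pw by (intro continuous_intros) (auto simp: int_pwl_def)
    show "min 1 (1 - f x + g x) = 1 - f x + g x \<or> min 1 (1 - f x + g x) = of_int 1" for x
      by auto
  qed (rule int_affine_ops)
  moreover have "0 \<le> min 1 (1 - f x + g x) \<and> min 1 (1 - f x + g x) \<le> 1" if x: "x \<in> unit_cube" for x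
    using wajsberg_function_bounds[OF f x] wajsberg_function_bounds[OF g x] by simp
  ultimately show ?thesis
    using wajsberg_function_at_one[OF f] wajsberg_function_at_one[OF g]
    by (intro wajsberg_functionI) simp_all
qed

lemma int_pwl_affine:
  assumes "int_affine p" "continuous_on unit_cube p" shows "int_pwl p"
  unfolding int_pwl_def using assms by (intro conjI exI[of _ "{p}"]) auto

lemma wajsberg_function_one: "wajsberg_function (\<lambda>x. 1)"
  using int_pwl_affine[OF int_affine_const[of 1]] by (auto simp: wajsberg_function_def)

lemma wajsberg_function_proj: "wajsberg_function (\<lambda>x. x $ j)"
proof -
  have "int_pwl (\<lambda>x. x $ j)"
    by (rule int_pwl_affine[OF int_affine_proj]) (intro continuous_intros)
  then show ?thesis by (auto simp: wajsberg_function_def unit_cube_def)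
qed

lemma wajsberg_function_heval:
  assumes "\<And>i. wajsberg_function (F i)"
  shows "wajsberg_function (\<lambda>x. heval unit_hoop (\<lambda>i. F i x) t)"
  by (induction t)
    (simp_all add: assms wajsberg_function_one wajsberg_function_mult wajsberg_function_imp)

section \<open>Projective Wajsberg hoops\<close>

lemma wajsberg_algebra_simps [simp]:
  "carrier (wajsberg_algebra P) = {restrict f P | f. wajsberg_function f}"
  "f \<otimes>\<^bsub>wajsberg_algebra P\<^esub> g = (\<lambda>x\<in>P. max 0 (f x + g x - 1))"
  "\<one>\<^bsub>wajsberg_algebra P\<^esub> = (\<lambda>x\<in>P. 1)"
  "f \<rightharpoonup>\<^bsub>wajsberg_algebra P\<^esub> g = (\<lambda>x\<in>P. min 1 (1 - f x + g x))"
  by (simp_all add: wajsberg_algebra_def)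

abbreviation proj :: "(real ^ 'n) set \<Rightarrow> 'n \<Rightarrow> real ^ 'n \<Rightarrow> real" where
  "proj P i \<equiv> (\<lambda>x\<in>P. x $ i)"

lemma heval_wajsberg_algebra:
  "heval (wajsberg_algebra P) (\<lambda>i. restrict (F i) P) t = (\<lambda>x\<in>P. heval unit_hoop (\<lambda>i. F i x) t)"
  by (induction t) (auto simp: restrict_def)

lemma heval_proj: "heval (wajsberg_algebra P) (proj P) t = restrict (teval t) P"
  by (rule heval_wajsberg_algebra)

text \<open>McNaughton's theorem puts every element into term form, so that maps out of W(P) can be
  defined and compared on terms.\<close>

lemma wajsberg_algebra_carrier:
  assumes "P \<subseteq> unit_cube"
  shows "carrier (wajsberg_algebra P) = range (\<lambda>t. restrict (teval t) P)"
proof -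
  have "\<exists>t. restrict f P = restrict (teval t) P" if f: "wajsberg_function f" for f
  proof -
    obtain t where "\<forall>x\<in>unit_cube. f x = teval t x"
      using mcnaughton[OF f] by (auto simp: term_fun_def)
    then have "restrict f P = restrict (teval t) P"
      using assms by (intro restrict_ext) blast
    then show ?thesis by blast
  qed
  moreover have "wajsberg_function (teval t)" for t :: "'a hterm"
    by (rule wajsberg_function_heval) (rule wajsberg_function_proj)
  ultimately show ?thesis unfolding wajsberg_algebra_simps(1) by blast
qed

lemma proj_carrier: "proj P i \<in> carrier (wajsberg_algebra P)"
  using wajsberg_function_proj[of i] by auto

lemma wajsberg_algebra_hoop_algebra: "hoop_algebra (wajsberg_algebra P)"
proof
  show "\<one>\<^bsub>wajsberg_algebra P\<^esub> \<in> carrier (wajsberg_algebra P)"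
    using wajsberg_function_one by auto
next
  fix f g assume "f \<in> carrier (wajsberg_algebra P)" "g \<in> carrier (wajsberg_algebra P)"
  then obtain f' g' where fg: "f = restrict f' P" "g = restrict g' P"
    "wajsberg_function f'" "wajsberg_function g'" by auto
  have "f \<otimes>\<^bsub>wajsberg_algebra P\<^esub> g = restrict (\<lambda>x. max 0 (f' x + g' x - 1)) P"
    "f \<rightharpoonup>\<^bsub>wajsberg_algebra P\<^esub> g = restrict (\<lambda>x. min 1 (1 - f' x + g' x)) P"
    using fg by (auto simp: restrict_def)
  then show "f \<otimes>\<^bsub>wajsberg_algebra P\<^esub> g \<in> carrier (wajsberg_algebra P)"
    "f \<rightharpoonup>\<^bsub>wajsberg_algebra P\<^esub> g \<in> carrier (wajsberg_algebra P)"
    using wajsberg_function_mult[OF fg(3,4)] wajsberg_function_imp[OF fg(3,4)] by auto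
qed

lemma wajsberg_algebra_element:
  assumes P: "P \<subseteq> unit_cube" and f: "f \<in> carrier (wajsberg_algebra P)"
  shows "f \<in> extensional P" "x \<in> P \<Longrightarrow> 0 \<le> f x" "x \<in> P \<Longrightarrow> f x \<le> 1"
proof -
  obtain h where h: "wajsberg_function h" "f = restrict h P" using f by auto
  show "f \<in> extensional P" using h(2) by simp
  show "0 \<le> f x" "f x \<le> 1" if "x \<in> P"
    using that wajsberg_function_bounds[OF h(1), of x] P h(2) by auto
qed

lemma wajsberg_algebra_wajsberg:
  assumes P: "P \<subseteq> unit_cube" shows "wajsberg_hoop (wajsberg_algebra P)"
proof -
  let ?W = "wajsberg_algebra P"
  interpret hoop_algebra ?W by (rule wajsberg_algebra_hoop_algebra)
  note el = wajsberg_algebra_element[OF P]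
  have eq: "restrict h P = restrict k P" if "\<And>x. x \<in> P \<Longrightarrow> h x = k x" for h k :: "real ^ 'a \<Rightarrow> real"
    using that by (rule restrict_ext)
  have "comm_monoid ?W"
  proof (rule comm_monoidI)
    fix f g assume "f \<in> carrier ?W" "g \<in> carrier ?W"
    show "f \<otimes>\<^bsub>?W\<^esub> g = g \<otimes>\<^bsub>?W\<^esub> f" by (simp add: add.commute)
  next
    fix f g h assume f: "f \<in> carrier ?W" and g: "g \<in> carrier ?W" and h: "h \<in> carrier ?W"
    show "f \<otimes>\<^bsub>?W\<^esub> g \<otimes>\<^bsub>?W\<^esub> h = f \<otimes>\<^bsub>?W\<^esub> (g \<otimes>\<^bsub>?W\<^esub> h)"
      unfolding wajsberg_algebra_simps
    proof (rule eq)
      fix x assume x: "x \<in> P"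
      show "max 0 ((\<lambda>x\<in>P. max 0 (f x + g x - 1)) x + h x - 1)
          = max 0 (f x + (\<lambda>x\<in>P. max 0 (g x + h x - 1)) x - 1)"
        using el(2,3)[OF f x] el(2,3)[OF g x] el(2,3)[OF h x] x by (simp add: max_def)
    qed
  next
    fix f assume f: "f \<in> carrier ?W"
    have "\<one>\<^bsub>?W\<^esub> \<otimes>\<^bsub>?W\<^esub> f = restrict f P"
      unfolding wajsberg_algebra_simps using el(2)[OF f] by (intro eq) simp
    then show "\<one>\<^bsub>?W\<^esub> \<otimes>\<^bsub>?W\<^esub> f = f" using el(1)[OF f] by (simp only: extensional_restrict)
  qed (fact hone_closed hmult_closed)+
  moreover have "wajsberg_hoop_axioms ?W"
  proof
    fix f assume f: "f \<in> carrier ?W"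
    show "f \<rightharpoonup>\<^bsub>?W\<^esub> f = \<one>\<^bsub>?W\<^esub>" by simp
  next
    fix f g assume f: "f \<in> carrier ?W" and g: "g \<in> carrier ?W"
    show "f \<otimes>\<^bsub>?W\<^esub> (f \<rightharpoonup>\<^bsub>?W\<^esub> g) = g \<otimes>\<^bsub>?W\<^esub> (g \<rightharpoonup>\<^bsub>?W\<^esub> f)"
      unfolding wajsberg_algebra_simps
    proof (rule eq)
      fix x assume x: "x \<in> P"
      show "max 0 (f x + (\<lambda>x\<in>P. min 1 (1 - f x + g x)) x - 1)
          = max 0 (g x + (\<lambda>x\<in>P. min 1 (1 - g x + f x)) x - 1)"
        using el(2,3)[OF f x] el(2,3)[OF g x] x by (simp add: max_def min_def)
    qed
    show "(f \<rightharpoonup>\<^bsub>?W\<^esub> g) \<rightharpoonup>\<^bsub>?W\<^esub> g = (g \<rightharpoonup>\<^bsub>?W\<^esub> f) \<rightharpoonup>\<^bsub>?W\<^esub> f"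
      unfolding wajsberg_algebra_simps
    proof (rule eq)
      fix x assume x: "x \<in> P"
      show "min 1 (1 - (\<lambda>x\<in>P. min 1 (1 - f x + g x)) x + g x)
          = min 1 (1 - (\<lambda>x\<in>P. min 1 (1 - g x + f x)) x + f x)"
        using el(2,3)[OF f x] el(2,3)[OF g x] x by (simp add: min_def)
    qed
    fix h assume h: "h \<in> carrier ?W"
    show "f \<otimes>\<^bsub>?W\<^esub> g \<rightharpoonup>\<^bsub>?W\<^esub> h = f \<rightharpoonup>\<^bsub>?W\<^esub> (g \<rightharpoonup>\<^bsub>?W\<^esub> h)"
      unfolding wajsberg_algebra_simps
    proof (rule eq)
      fix x assume x: "x \<in> P"
      show "min 1 (1 - (\<lambda>x\<in>P. max 0 (f x + g x - 1)) x + h x)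
          = min 1 (1 - f x + (\<lambda>x\<in>P. min 1 (1 - g x + h x)) x)"
        using el(2,3)[OF f x] el(2,3)[OF g x] el(2,3)[OF h x] x by (simp add: max_def min_def)
    qed
  qed
  ultimately show ?thesis by (intro wajsberg_hoop.intro hoop_algebra_axioms)
qed

lemma teval_vec_lambda: "teval t (vec_lambda f) = heval unit_hoop f t"
proof -
  have "(\<lambda>i. vec_lambda f $ i) = f" by (rule ext) simp
  then show ?thesis by simp
qed

text \<open>The extension is described on all term functions and not only on the projections, since
  this is the form in which homomorphisms are compared later.\<close>

theorem free_wajsberg_algebra:
  fixes b :: "'n::finite \<Rightarrow> 'a"
  assumes B: "wajsberg_hoop B" and b: "\<And>i. b i \<in> carrier B"
  obtains k where "k \<in> hoop_hom (wajsberg_algebra (unit_cube :: (real ^ 'n) set)) B"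
    "\<And>t. k (restrict (teval t) unit_cube) = heval B b t"
proof -
  interpret B: wajsberg_hoop B by (rule B)
  let ?C = "unit_cube :: (real ^ 'n) set"
  \<comment> \<open>A term is chosen for each element; completeness makes the value independent of
    the choice.\<close>
  define k where "k u = heval B b (SOME t. u = restrict (teval t) ?C)" for u
  have k: "k (restrict (teval t) ?C) = heval B b t" for t
  proof -
    define s where "s = (SOME s. restrict (teval t) ?C = restrict (teval s) ?C)"
    have s: "restrict (teval t) ?C = restrict (teval s) ?C"
      unfolding s_def by (rule someI[of _ t]) (rule refl)
    have "heval B b s = heval B b t"
    proof (rule B.identity_transfer[OF b])
      fix x :: "'n \<Rightarrow> real" assume x: "\<And>i. 0 \<le> x i \<and> x i \<le> 1"
      then have v: "vec_lambda x \<in> ?C" by (simp add: unit_cube_def)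
      have "teval t (vec_lambda x) = teval s (vec_lambda x)"
        using fun_cong[OF s, of "vec_lambda x"] unfolding restrict_apply'[OF v] .
      then show "heval unit_hoop x s = heval unit_hoop x t" by (simp only: teval_vec_lambda)
    qed
    then show ?thesis by (simp add: k_def s_def)
  qed
  have mult: "restrict (teval s) ?C \<otimes>\<^bsub>wajsberg_algebra ?C\<^esub> restrict (teval t) ?C
      = restrict (teval (HMul s t)) ?C" for s t
    by (auto simp: restrict_def)
  have imp: "restrict (teval s) ?C \<rightharpoonup>\<^bsub>wajsberg_algebra ?C\<^esub> restrict (teval t) ?C
      = restrict (teval (HImp s t)) ?C" for s t
    by (auto simp: restrict_def)
  have one: "\<one>\<^bsub>wajsberg_algebra ?C\<^esub> = restrict (teval HOne) ?C" by simp
  have "k \<in> hoop_hom (wajsberg_algebra ?C) B"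
  proof (rule hoop_homI)
    fix u v assume "u \<in> carrier (wajsberg_algebra ?C)" "v \<in> carrier (wajsberg_algebra ?C)"
    then obtain s t where st: "u = restrict (teval s) ?C" "v = restrict (teval t) ?C"
      unfolding wajsberg_algebra_carrier[OF subset_refl] by blast
    show "k (u \<otimes>\<^bsub>wajsberg_algebra ?C\<^esub> v) = k u \<otimes>\<^bsub>B\<^esub> k v"
      unfolding st mult k by simp
    show "k (u \<rightharpoonup>\<^bsub>wajsberg_algebra ?C\<^esub> v) = k u \<rightharpoonup>\<^bsub>B\<^esub> k v"
      unfolding st imp k by simp
  next
    fix u assume "u \<in> carrier (wajsberg_algebra ?C)"
    then obtain s where "u = restrict (teval s) ?C"
      unfolding wajsberg_algebra_carrier[OF subset_refl] by blast
    then show "k u \<in> carrier B" using k B.heval_closed[of b s, OF b] by simp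
  next
    show "k \<one>\<^bsub>wajsberg_algebra ?C\<^esub> = \<one>\<^bsub>B\<^esub>" unfolding one k by simp
  qed
  then show ?thesis using k that by blast
qed

section \<open>Generating families and transport between types\<close>

lemma (in hoop_algebra) hoop_generate_range: "hoop_generate A (range b) = range (heval A b)"
proof
  show "hoop_generate A (range b) \<subseteq> range (heval A b)"
  proof
    fix x assume "x \<in> hoop_generate A (range b)"
    then show "x \<in> range (heval A b)"
    proof (induction rule: hoop_generate.induct)
      case one
      show ?case by (rule range_eqI[of _ _ HOne]) simp
    next
      case (incl x)
      then obtain i where "x = b i" by blast
      then show ?case by (intro range_eqI[of _ _ "HVar i"]) simp
    next
      case (mult x y)
      then obtain s t where "x = heval A b s" "y = heval A b t" by blast
      then show ?case by (intro range_eqI[of _ _ "HMul s t"]) simp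
    next
      case (imp x y)
      then obtain s t where "x = heval A b s" "y = heval A b t" by blast
      then show ?case by (intro range_eqI[of _ _ "HImp s t"]) simp
    qed
  qed
  have "heval A b t \<in> hoop_generate A (range b)" for t
    by (induction t) (auto intro: hoop_generate.intros)
  then show "range (heval A b) \<subseteq> hoop_generate A (range b)" by blast
qed

text \<open>Lists of length n and families over the index type both allow repetitions, so they
  correspond along any enumeration of \<open>'n\<close>. Families are what valuations of terms
  require.\<close>

lemma (in hoop_algebra) n_generated_iff:
  "n_generated CARD('n::finite) A \<longleftrightarrow>
     (\<exists>b :: 'n \<Rightarrow> 'a. range b \<subseteq> carrier A \<and> carrier A = range (heval A b))"
proof
  assume "n_generated CARD('n) A"
  then obtain xs where xs: "length xs = CARD('n)" "set xs \<subseteq> carrier A"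
    "hoop_generate A (set xs) = carrier A" by (auto simp: n_generated_def)
  obtain h :: "'n \<Rightarrow> nat" where h: "bij_betw h UNIV {0..<CARD('n)}"
    using ex_bij_betw_finite_nat[of "UNIV :: 'n set"] by auto
  define b where "b i = xs ! h i" for i
  have "range b = (!) xs ` range h" by (simp add: b_def image_image)
  also have "range h = {0..<length xs}" using bij_betw_imp_surj_on[OF h] xs(1) by simp
  also have "(!) xs ` {0..<length xs} = set xs" by (auto simp: set_conv_nth)
  finally have "range b = set xs" .
  then have "range b \<subseteq> carrier A \<and> carrier A = range (heval A b)"
    using xs(2,3) hoop_generate_range[of b] by simp
  then show "\<exists>b :: 'n \<Rightarrow> 'a. range b \<subseteq> carrier A \<and> carrier A = range (heval A b)" by blast
next
  assume "\<exists>b :: 'n \<Rightarrow> 'a. range b \<subseteq> carrier A \<and> carrier A = range (heval A b)"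
  then obtain b :: "'n \<Rightarrow> 'a" where b: "range b \<subseteq> carrier A" "carrier A = range (heval A b)" by blast
  obtain ys :: "'n list" where ys: "set ys = UNIV" "distinct ys"
    using finite_distinct_list[of "UNIV :: 'n set"] by auto
  have "length (map b ys) = CARD('n)" using distinct_card[OF ys(2)] ys(1) by simp
  moreover have "set (map b ys) = range b" using ys(1) by simp
  ultimately show "n_generated CARD('n) A"
    unfolding n_generated_def using b hoop_generate_range[of b]
    by (intro exI[of _ "map b ys"]) simp
qed

text \<open>Transport of structure along an injection; it moves countable hoops into the types over
  which projectivity is assumed.\<close>

definition hoop_copy :: "('a \<Rightarrow> 'b) \<Rightarrow> ('a, 'r) hoop_scheme \<Rightarrow> 'b hoop" where
  "hoop_copy \<iota> A = (let \<kappa> = inv_into (carrier A) \<iota> in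
     \<lparr>carrier = \<iota> ` carrier A, mult = (\<lambda>x y. \<iota> (\<kappa> x \<otimes>\<^bsub>A\<^esub> \<kappa> y)),
      one = \<iota> \<one>\<^bsub>A\<^esub>, himp = (\<lambda>x y. \<iota> (\<kappa> x \<rightharpoonup>\<^bsub>A\<^esub> \<kappa> y))\<rparr>)"

lemma hoop_copy_hom:
  assumes "inj_on \<iota> (carrier A)"
  shows "\<iota> \<in> hoop_hom A (hoop_copy \<iota> A)" "\<iota> ` carrier A = carrier (hoop_copy \<iota> A)"
  using assms by (auto intro!: hoop_homI simp: hoop_copy_def Let_def)

lemma (in hoop_algebra) inverse_hom:
  assumes h: "h \<in> hoop_hom A B" and bij: "bij_betw h (carrier A) (carrier B)"
  shows "inv_into (carrier A) h \<in> hoop_hom B A"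
proof (rule hoop_homI)
  let ?k = "inv_into (carrier A) h"
  have inj: "inj_on h (carrier A)" and img: "h ` carrier A = carrier B"
    using bij by (auto simp: bij_betw_def)
  have k: "?k x \<in> carrier A" "h (?k x) = x" if "x \<in> carrier B" for x
    using that img by (auto simp: inv_into_into f_inv_into_f)
  fix x y assume xy: "x \<in> carrier B" "y \<in> carrier B"
  have "x \<otimes>\<^bsub>B\<^esub> y = h (?k x \<otimes> ?k y)" "x \<rightharpoonup>\<^bsub>B\<^esub> y = h (?k x \<rightharpoonup> ?k y)"
    using k[OF xy(1)] k[OF xy(2)] by (simp_all add: hoop_homD[OF h])
  then show "?k (x \<otimes>\<^bsub>B\<^esub> y) = ?k x \<otimes> ?k y" "?k (x \<rightharpoonup>\<^bsub>B\<^esub> y) = ?k x \<rightharpoonup> ?k y"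
    using k[OF xy(1)] k[OF xy(2)] inj by (simp_all add: inv_into_f_f hmult_closed himp_closed)
next
  show "inv_into (carrier A) h x \<in> carrier A" if "x \<in> carrier B" for x
    using that bij by (simp add: bij_betw_def inv_into_into)
  show "inv_into (carrier A) h \<one>\<^bsub>B\<^esub> = \<one>"
    using bij hoop_homD(4)[OF h] inv_into_f_f[of h "carrier A" \<one>] hone_closed
    by (simp add: bij_betw_def)
qed

lemma countable_inj_infinite:
  assumes "countable S"
  obtains \<iota> :: "'a \<Rightarrow> 'b::infinite" where "inj_on \<iota> S"
proof -
  obtain g :: "nat \<Rightarrow> 'b" where g: "inj g"
    using infinite_countable_subset[OF infinite_UNIV] by blast
  have "inj_on (g \<circ> to_nat_on S) S"
    using inj_on_to_nat_on[OF assms] g by (intro comp_inj_on) (auto intro: inj_on_subset)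
  then show ?thesis by (rule that)
qed

lemma restrict_hom:
  assumes "P \<subseteq> C"
  shows "(\<lambda>u. restrict u P) \<in> hoop_hom (wajsberg_algebra C) (wajsberg_algebra P)"
proof (rule hoop_homI)
  fix u assume "u \<in> carrier (wajsberg_algebra C)"
  then obtain f where f: "wajsberg_function f" "u = restrict f C" by auto
  then have "restrict u P = restrict f P" using assms by (auto simp: restrict_def fun_eq_iff)
  then show "restrict u P \<in> carrier (wajsberg_algebra P)" using f by auto
next
  fix u v :: "real ^ 'a \<Rightarrow> real"
  show "restrict (u \<otimes>\<^bsub>wajsberg_algebra C\<^esub> v) P = restrict u P \<otimes>\<^bsub>wajsberg_algebra P\<^esub> restrict v P"
    unfolding wajsberg_algebra_simps by (rule restrict_ext) (use assms in auto)
  show "restrict (u \<rightharpoonup>\<^bsub>wajsberg_algebra C\<^esub> v) P = restrict u P \<rightharpoonup>\<^bsub>wajsberg_algebra P\<^esub> restrict v P"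
    unfolding wajsberg_algebra_simps by (rule restrict_ext) (use assms in auto)
  show "restrict \<one>\<^bsub>wajsberg_algebra C\<^esub> P = \<one>\<^bsub>wajsberg_algebra P\<^esub>"
    unfolding wajsberg_algebra_simps by (rule restrict_ext) (use assms in auto)
qed

section \<open>Retractions of the cube and projectivity\<close>

locale pointed_retraction =
  fixes \<zeta> :: "real ^ 'n \<Rightarrow> real ^ 'n"
  assumes retraction: "pointed_z_retraction \<zeta>"
begin

abbreviation P where "P \<equiv> \<zeta> ` unit_cube"

lemma zeta_cube: "x \<in> unit_cube \<Longrightarrow> \<zeta> x \<in> unit_cube"
  using retraction by (auto simp: pointed_z_retraction_def z_map_def)

lemma P_cube: "P \<subseteq> unit_cube"
  using zeta_cube by blast

lemma zeta_P: "x \<in> P \<Longrightarrow> \<zeta> x = x"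
  using retraction by (auto simp: pointed_z_retraction_def)

lemma wajsberg_component: "wajsberg_function (\<lambda>x. \<zeta> x $ i)"
proof (rule wajsberg_functionI)
  show "int_pwl (\<lambda>x. \<zeta> x $ i)" "\<zeta> 1 $ i = 1"
    using retraction by (simp_all add: pointed_z_retraction_def z_map_def)
  show "0 \<le> \<zeta> x $ i \<and> \<zeta> x $ i \<le> 1" if "x \<in> unit_cube" for x
    using zeta_cube[OF that] by (simp add: unit_cube_def)
qed

text \<open>Composition with \<zeta> will split the restriction from the cube to P. It stays among
  Wajsberg functions because the components of \<zeta> are Wajsberg functions and these are closed
  under terms.\<close>

lemma pullback_hom:
  "(\<lambda>u. \<lambda>x\<in>unit_cube. u (\<zeta> x)) \<in> hoop_hom (wajsberg_algebra P) (wajsberg_algebra unit_cube)"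
proof (rule hoop_homI)
  fix u assume "u \<in> carrier (wajsberg_algebra P)"
  then obtain t where t: "u = restrict (teval t) P"
    unfolding wajsberg_algebra_carrier[OF P_cube] by blast
  have "(\<lambda>x\<in>unit_cube. u (\<zeta> x)) = restrict (\<lambda>x. heval unit_hoop (\<lambda>i. \<zeta> x $ i) t) unit_cube"
    by (rule restrict_ext) (simp add: t)
  moreover have "wajsberg_function (\<lambda>x. heval unit_hoop (\<lambda>i. \<zeta> x $ i) t)"
    by (rule wajsberg_function_heval) (rule wajsberg_component)
  ultimately show "(\<lambda>x\<in>unit_cube. u (\<zeta> x)) \<in> carrier (wajsberg_algebra unit_cube)" by auto
next
  fix u v :: "real ^ 'n \<Rightarrow> real"
  show "(\<lambda>x\<in>unit_cube. (u \<otimes>\<^bsub>wajsberg_algebra P\<^esub> v) (\<zeta> x))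
      = (\<lambda>x\<in>unit_cube. u (\<zeta> x)) \<otimes>\<^bsub>wajsberg_algebra unit_cube\<^esub> (\<lambda>x\<in>unit_cube. v (\<zeta> x))"
    "(\<lambda>x\<in>unit_cube. (u \<rightharpoonup>\<^bsub>wajsberg_algebra P\<^esub> v) (\<zeta> x))
      = (\<lambda>x\<in>unit_cube. u (\<zeta> x)) \<rightharpoonup>\<^bsub>wajsberg_algebra unit_cube\<^esub> (\<lambda>x\<in>unit_cube. v (\<zeta> x))"
    unfolding wajsberg_algebra_simps by (rule restrict_ext, simp)+
  show "(\<lambda>x\<in>unit_cube. \<one>\<^bsub>wajsberg_algebra P\<^esub> (\<zeta> x)) = \<one>\<^bsub>wajsberg_algebra unit_cube\<^esub>"
    unfolding wajsberg_algebra_simps by (rule restrict_ext) simp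
qed

lemma restrict_pullback:
  assumes "u \<in> carrier (wajsberg_algebra P)"
  shows "(\<lambda>x\<in>P. (\<lambda>x\<in>unit_cube. u (\<zeta> x)) x) = u"
proof -
  have "(\<lambda>x\<in>P. (\<lambda>x\<in>unit_cube. u (\<zeta> x)) x) = restrict u P"
  proof (rule restrict_ext)
    fix x assume x: "x \<in> P"
    then have "x \<in> unit_cube" using P_cube by blast
    then show "(\<lambda>x\<in>unit_cube. u (\<zeta> x)) x = u x" by (simp add: zeta_P[OF x])
  qed
  also have "\<dots> = u"
    using wajsberg_algebra_element(1)[OF P_cube assms] by (rule extensional_restrict)
  finally show ?thesis .
qed

end

text \<open>A map out of A is lifted on generators, extended to the free hoop, and the extension is
  precomposed with the pull-back along \<zeta>. The isomorphism also carries the hoop laws to A, of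
  which only closure is assumed.\<close>

lemma retract_imp_projective:
  fixes A :: "('a, 'r) hoop_scheme" and \<zeta> :: "real ^ 'n \<Rightarrow> real ^ 'n"
  assumes A: "hoop_algebra A" and \<zeta>: "pointed_z_retraction \<zeta>"
    and \<phi>: "\<phi> \<in> hoop_hom A (wajsberg_algebra (\<zeta> ` unit_cube))"
      "bij_betw \<phi> (carrier A) (carrier (wajsberg_algebra (\<zeta> ` unit_cube)))"
  shows "n_generated CARD('n) A" "projective_hoop TYPE('b) TYPE('c) A"
proof -
  interpret A: hoop_algebra A by (rule A)
  interpret pointed_retraction \<zeta> by unfold_locales (rule \<zeta>)
  let ?W = "wajsberg_algebra P" and ?C = "unit_cube :: (real ^ 'n) set"
  interpret W: wajsberg_hoop ?W by (rule wajsberg_algebra_wajsberg[OF P_cube])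
  define \<psi> where "\<psi> = inv_into (carrier A) \<phi>"
  have \<psi>: "\<psi> \<in> hoop_hom ?W A" unfolding \<psi>_def by (rule A.inverse_hom[OF \<phi>])
  have \<psi>\<phi>: "\<psi> (\<phi> a) = a" if "a \<in> carrier A" for a
    using that \<phi>(2) by (simp add: \<psi>_def bij_betw_def)
  have "\<psi> ` carrier ?W = carrier A"
    unfolding \<psi>_def using bij_betw_inv_into[OF \<phi>(2)] by (rule bij_betw_imp_surj_on)
  then have wA: "wajsberg_hoop A" by (rule W.hom_image_wajsberg[OF \<psi>])
  define c where "c i = \<psi> (proj P i)" for i
  have c: "c i \<in> carrier A" for i unfolding c_def by (rule hoop_homD(1)[OF \<psi> proj_carrier])
  have \<psi>_eval: "\<psi> (restrict (teval t) P) = heval A c t" for t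
    unfolding c_def heval_proj[symmetric] by (rule W.hom_heval[OF \<psi>]) (rule proj_carrier)
  have gen: "\<exists>t. a = heval A c t" if a: "a \<in> carrier A" for a
  proof -
    have "\<phi> a \<in> carrier ?W" using hoop_homD(1)[OF \<phi>(1) a] .
    then obtain t where "\<phi> a = restrict (teval t) P"
      unfolding wajsberg_algebra_carrier[OF P_cube] by blast
    then have "\<psi> (\<phi> a) = heval A c t" by (simp only: \<psi>_eval)
    then show ?thesis unfolding \<psi>\<phi>[OF a] by blast
  qed
  have "range c \<subseteq> carrier A" using c by blast
  moreover have "carrier A = range (heval A c)"
  proof
    show "carrier A \<subseteq> range (heval A c)" using gen by blast
    show "range (heval A c) \<subseteq> carrier A" using A.heval_closed[of c, OF c] by blast
  qed
  ultimately show "n_generated CARD('n) A" unfolding A.n_generated_iff by blast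
  show "projective_hoop TYPE('b) TYPE('c) A"
    unfolding projective_hoop_def
  proof (intro conjI allI impI wA)
    fix D :: "'b hoop" and B :: "'c hoop" and f g
    assume D: "wajsberg_hoop D" and B: "wajsberg_hoop B" and f: "f \<in> hoop_hom A D"
      and g: "g \<in> hoop_hom B D" and surj: "g ` carrier B = carrier D"
    interpret B: wajsberg_hoop B by (rule B)
    have fc: "f (c i) \<in> g ` carrier B" for i unfolding surj by (rule hoop_homD(1)[OF f c])
    define \<beta> where "\<beta> i = inv_into (carrier B) g (f (c i))" for i
    have \<beta>: "\<beta> i \<in> carrier B" "g (\<beta> i) = f (c i)" for i
      unfolding \<beta>_def by (rule inv_into_into[OF fc], rule f_inv_into_f[OF fc])
    obtain k where k: "k \<in> hoop_hom (wajsberg_algebra ?C) B"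
      "\<And>t. k (restrict (teval t) ?C) = heval B \<beta> t"
      by (rule free_wajsberg_algebra[where b = \<beta>, OF B \<beta>(1)]) (rule that)
    \<comment> \<open>Both sides are homomorphisms out of the free hoop that agree on the coordinate
      functions; the comparison runs over terms.\<close>
    have gk: "g (k u) = f (\<psi> (restrict u P))" if u: "u \<in> carrier (wajsberg_algebra ?C)" for u
    proof -
      obtain t where t: "u = restrict (teval t) ?C"
        using u unfolding wajsberg_algebra_carrier[OF subset_refl] by blast
      have "g (k u) = heval D (\<lambda>i. g (\<beta> i)) t"
        unfolding t k(2) by (rule B.hom_heval[OF g \<beta>(1)])
      also have "\<dots> = f (heval A c t)"
        unfolding \<beta>(2) by (rule A.hom_heval[OF f c, symmetric])
      also have "heval A c t = \<psi> (restrict (teval t) P)" by (rule \<psi>_eval[symmetric])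
      also have "restrict (teval t) P = restrict u P"
      proof (rule restrict_ext)
        fix x assume "x \<in> P"
        then have "x \<in> ?C" using P_cube by blast
        then show "teval t x = u x" by (simp add: t)
      qed
      finally show ?thesis .
    qed
    let ?e = "\<lambda>u. \<lambda>x\<in>?C. u (\<zeta> x)"
    show "\<exists>h\<in>hoop_hom A B. \<forall>x\<in>carrier A. f x = g (h x)"
    proof (intro bexI[of _ "\<lambda>a. k (?e (\<phi> a))"] ballI)
      show "(\<lambda>a. k (?e (\<phi> a))) \<in> hoop_hom A B"
        by (rule hoop_hom_compose[OF hoop_hom_compose[OF \<phi>(1) pullback_hom] k(1)])
      fix a assume a: "a \<in> carrier A"
      have \<phi>a: "\<phi> a \<in> carrier ?W" using hoop_homD(1)[OF \<phi>(1) a] .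
      have "g (k (?e (\<phi> a))) = f (\<psi> (restrict (?e (\<phi> a)) P))"
        by (rule gk[OF hoop_homD(1)[OF pullback_hom \<phi>a]])
      also have "\<dots> = f a" unfolding restrict_pullback[OF \<phi>a] \<psi>\<phi>[OF a] ..
      finally show "f a = g (k (?e (\<phi> a)))" ..
    qed
  qed
qed

lemma projective_hoopD:
  fixes D :: "'b hoop" and B :: "'c hoop"
  assumes "projective_hoop TYPE('b) TYPE('c) A" "wajsberg_hoop D" "wajsberg_hoop B"
    "f \<in> hoop_hom A D" "g \<in> hoop_hom B D" "g ` carrier B = carrier D"
  shows "\<exists>h\<in>hoop_hom A B. \<forall>x\<in>carrier A. f x = g (h x)"
  using assms by (simp add: projective_hoop_def)

text \<open>The identity of A is to be lifted along k. Lifting is given only for hoops over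
  \<open>'b\<close> and \<open>'c\<close>, so A is copied into \<open>'b\<close> and F into
  \<open>'c\<close>, and the lift is carried back through the inverse of the second copy.\<close>

lemma projective_imp_section:
  fixes A :: "('a, 'r) hoop_scheme" and F :: "('d, 's) hoop_scheme"
  assumes proj: "projective_hoop TYPE('b::infinite) TYPE('c::infinite) A"
    and F: "wajsberg_hoop F" and cA: "countable (carrier A)" and cF: "countable (carrier F)"
    and k: "k \<in> hoop_hom F A" and surj: "k ` carrier F = carrier A"
  obtains s where "s \<in> hoop_hom A F" "\<And>a. a \<in> carrier A \<Longrightarrow> k (s a) = a"
proof -
  interpret F: wajsberg_hoop F by (rule F)
  interpret A: wajsberg_hoop A using proj by (simp add: projective_hoop_def)
  obtain \<iota> :: "'a \<Rightarrow> 'b" where \<iota>: "inj_on \<iota> (carrier A)" using countable_inj_infinite[OF cA] by blast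
  obtain \<kappa> :: "'d \<Rightarrow> 'c" where \<kappa>: "inj_on \<kappa> (carrier F)" using countable_inj_infinite[OF cF] by blast
  let ?A' = "hoop_copy \<iota> A" and ?F' = "hoop_copy \<kappa> F" and ?\<kappa>' = "inv_into (carrier F) \<kappa>"
  note hA = hoop_copy_hom[OF \<iota>] and hF = hoop_copy_hom[OF \<kappa>]
  have wA': "wajsberg_hoop ?A'" by (rule A.hom_image_wajsberg[OF hA])
  have wF': "wajsberg_hoop ?F'" by (rule F.hom_image_wajsberg[OF hF])
  have \<kappa>': "?\<kappa>' \<in> hoop_hom ?F' F"
    by (rule F.inverse_hom[OF hF(1)]) (simp add: bij_betw_def \<kappa> hF(2))
  have g: "(\<lambda>x. \<iota> (k (?\<kappa>' x))) \<in> hoop_hom ?F' ?A'"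
    by (rule hoop_hom_compose[OF hoop_hom_compose[OF \<kappa>' k] hA(1)])
  have gsurj: "(\<lambda>x. \<iota> (k (?\<kappa>' x))) ` carrier ?F' = carrier ?A'"
  proof -
    have "?\<kappa>' ` carrier ?F' = carrier F"
      unfolding hF(2)[symmetric] using \<kappa> by (simp add: inv_into_image_cancel)
    then have "\<iota> ` k ` ?\<kappa>' ` carrier ?F' = carrier ?A'" using surj hA(2) by simp
    then show ?thesis by (simp add: image_image)
  qed
  obtain h where h: "h \<in> hoop_hom A ?F'" "\<forall>a\<in>carrier A. \<iota> a = \<iota> (k (?\<kappa>' (h a)))"
    using projective_hoopD[OF proj wA' wF' hA(1) g gsurj] by blast
  have s: "(\<lambda>a. ?\<kappa>' (h a)) \<in> hoop_hom A F" by (rule hoop_hom_compose[OF h(1) \<kappa>'])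
  moreover have "k (?\<kappa>' (h a)) = a" if a: "a \<in> carrier A" for a
  proof -
    have "k (?\<kappa>' (h a)) \<in> carrier A" using hoop_homD(1)[OF k hoop_homD(1)[OF s a]] .
    moreover have "\<iota> (k (?\<kappa>' (h a))) = \<iota> a" using h(2) a by simp
    ultimately show ?thesis using inj_onD[OF \<iota> _ _ a] by blast
  qed
  ultimately show ?thesis by (rule that)
qed

text \<open>The images of the coordinate functions under the idempotent e = s o k are the components
  of \<zeta>. Each s a is fixed by e, hence equals its own composition with \<zeta>, so it is
  determined by its restriction to P; this restriction is the isomorphism.\<close>

lemma projective_imp_retract:
  fixes A :: "('a, 'r) hoop_scheme"
  assumes A: "hoop_algebra A" and gen: "n_generated CARD('n::finite) A"
    and proj: "projective_hoop TYPE('b::infinite) TYPE('c::infinite) A"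
  obtains P :: "(real ^ 'n) set" where "pointed_z_retract P" "hoop_isomorphic A (wajsberg_algebra P)"
proof -
  interpret A: wajsberg_hoop A using proj by (simp add: projective_hoop_def)
  let ?C = "unit_cube :: (real ^ 'n) set"
  let ?W = "wajsberg_algebra ?C"
  interpret W: wajsberg_hoop ?W by (rule wajsberg_algebra_wajsberg[OF subset_refl])
  have carW: "carrier ?W = range (\<lambda>t. restrict (teval t) ?C)"
    by (rule wajsberg_algebra_carrier) simp
  obtain b :: "'n \<Rightarrow> 'a" where b: "range b \<subseteq> carrier A" "carrier A = range (heval A b)"
    using gen A.n_generated_iff by blast
  have b': "b i \<in> carrier A" for i using b(1) by blast
  obtain k where k: "k \<in> hoop_hom ?W A" "\<And>t. k (restrict (teval t) ?C) = heval A b t"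
    by (rule free_wajsberg_algebra[where b = b, OF A.wajsberg_hoop_axioms b']) (rule that)
  have ksurj: "k ` carrier ?W = carrier A" unfolding carW b(2) image_image k(2) ..
  have cnt: "countable (carrier A)" "countable (carrier ?W)" unfolding b(2) carW by simp_all
  obtain s where s: "s \<in> hoop_hom A ?W" "\<And>a. a \<in> carrier A \<Longrightarrow> k (s a) = a"
    by (rule projective_imp_section[OF proj W.wajsberg_hoop_axioms cnt k(1) ksurj]) (rule that)
  define e where "e u = s (k u)" for u
  have e: "e \<in> hoop_hom ?W ?W" unfolding e_def by (rule hoop_hom_compose[OF k(1) s(1)])
  have e_s: "e (s a) = s a" if "a \<in> carrier A" for a using s(2)[OF that] by (simp add: e_def)
  have "\<forall>i. \<exists>f. wajsberg_function f \<and> e (proj ?C i) = restrict f ?C"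
    using hoop_homD(1)[OF e proj_carrier] unfolding wajsberg_algebra_simps(1) by blast
  then obtain F where "\<forall>i. wajsberg_function (F i) \<and> e (proj ?C i) = restrict (F i) ?C"
    unfolding choice_iff by blast
  then have F: "\<And>i. wajsberg_function (F i)" "\<And>i. e (proj ?C i) = restrict (F i) ?C" by blast+
  define \<zeta> where "\<zeta> x = (\<chi> i. F i x)" for x
  have \<zeta>_cube: "\<zeta> x \<in> ?C" if "x \<in> ?C" for x
    using wajsberg_function_bounds[OF F(1) that] by (simp add: \<zeta>_def unit_cube_def)
  have e_eq: "e u = (\<lambda>x\<in>?C. u (\<zeta> x))" if u: "u \<in> carrier ?W" for u
  proof -
    obtain t where t: "u = restrict (teval t) ?C" using u unfolding carW by blast
    have "e u = heval ?W (\<lambda>i. e (proj ?C i)) t"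
      unfolding t heval_proj[symmetric] by (rule W.hom_heval[OF e]) (rule proj_carrier)
    also have "\<dots> = (\<lambda>x\<in>?C. heval unit_hoop (\<lambda>i. F i x) t)"
      unfolding F(2) by (rule heval_wajsberg_algebra)
    also have "\<dots> = (\<lambda>x\<in>?C. u (\<zeta> x))"
      by (rule restrict_ext) (use \<zeta>_cube in \<open>simp add: t \<zeta>_def teval_vec_lambda\<close>)
    finally show ?thesis .
  qed
  \<comment> \<open>Idempotence of e on the coordinate functions, read componentwise.\<close>
  have "\<zeta> (\<zeta> x) = \<zeta> x" if x: "x \<in> ?C" for x
  proof -
    have "F i (\<zeta> x) = F i x" for i
    proof -
      let ?u = "e (proj ?C i)"
      have u: "?u \<in> carrier ?W" by (rule hoop_homD(1)[OF e proj_carrier])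
      have "e ?u = ?u"
        using e_s[OF hoop_homD(1)[OF k(1) proj_carrier[of i ?C]]] by (simp only: e_def)
      then have "(\<lambda>x\<in>?C. ?u (\<zeta> x)) = ?u" unfolding e_eq[OF u] .
      from fun_cong[OF this, of x] have "?u (\<zeta> x) = ?u x" unfolding restrict_apply'[OF x] .
      then show ?thesis unfolding F(2) using x \<zeta>_cube[OF x] by simp
    qed
    then show ?thesis by (simp add: \<zeta>_def vec_eq_iff)
  qed
  moreover have "\<zeta> 1 = 1" using wajsberg_function_at_one[OF F(1)] by (simp add: \<zeta>_def vec_eq_iff)
  moreover have "z_map \<zeta>"
    unfolding z_map_def
  proof (intro conjI allI)
    show "\<zeta> ` ?C \<subseteq> ?C" using \<zeta>_cube by blast
    show "int_pwl (\<lambda>x. \<zeta> x $ i)" for i using F(1)[of i] by (simp add: \<zeta>_def wajsberg_function_def)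
  qed
  ultimately have ret: "pointed_z_retraction \<zeta>" by (simp add: pointed_z_retraction_def)
  then interpret pointed_retraction \<zeta> by unfold_locales
  have hom: "(\<lambda>a. restrict (s a) P) \<in> hoop_hom A (wajsberg_algebra P)"
    by (rule hoop_hom_compose[OF s(1) restrict_hom[OF P_cube]])
  have "inj_on (\<lambda>a. restrict (s a) P) (carrier A)"
  proof (rule inj_onI)
    fix a a' assume a: "a \<in> carrier A" "a' \<in> carrier A" and eq: "restrict (s a) P = restrict (s a') P"
    have sa: "s c = (\<lambda>x\<in>?C. s c (\<zeta> x))" if "c \<in> carrier A" for c
      by (rule trans[OF e_s[OF that, symmetric] e_eq[OF hoop_homD(1)[OF s(1) that]]])
    have "s a (\<zeta> x) = s a' (\<zeta> x)" if "x \<in> ?C" for x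
      using fun_cong[OF eq, of "\<zeta> x"] unfolding restrict_apply'[OF imageI[OF that]] .
    then have "(\<lambda>x\<in>?C. s a (\<zeta> x)) = (\<lambda>x\<in>?C. s a' (\<zeta> x))" by (rule restrict_ext)
    then have "s a = s a'" by (rule trans[OF sa[OF a(1)] trans[OF _ sa[OF a(2), symmetric]]])
    then have "k (s a) = k (s a')" by (rule arg_cong)
    then show "a = a'" unfolding s(2)[OF a(1)] s(2)[OF a(2)] .
  qed
  moreover have "carrier (wajsberg_algebra P) \<subseteq> (\<lambda>a. restrict (s a) P) ` carrier A"
  proof
    fix u assume "u \<in> carrier (wajsberg_algebra P)"
    then obtain t where t: "u = restrict (teval t) P"
      unfolding wajsberg_algebra_carrier[OF P_cube] by blast
    let ?v = "restrict (teval t) ?C"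
    have v: "?v \<in> carrier ?W" unfolding carW by blast
    \<comment> \<open>Since \<zeta> is the identity on P, applying e to the extension of u leaves
      its values on P unchanged.\<close>
    have "restrict (s (k ?v)) P = u"
      unfolding e_def[symmetric] e_eq[OF v] t
    proof (rule restrict_ext)
      fix x assume x: "x \<in> P"
      then have "x \<in> ?C" using P_cube by blast
      then show "(\<lambda>x\<in>?C. restrict (teval t) ?C (\<zeta> x)) x = teval t x" by (simp add: zeta_P[OF x])
    qed
    then show "u \<in> (\<lambda>a. restrict (s a) P) ` carrier A"
      using hoop_homD(1)[OF k(1) v] by blast
  qed
  then have "(\<lambda>a. restrict (s a) P) ` carrier A = carrier (wajsberg_algebra P)"
    using hoop_homD(1)[OF hom] by blast
  ultimately have "bij_betw (\<lambda>a. restrict (s a) P) (carrier A) (carrier (wajsberg_algebra P))"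
    by (rule bij_betw_imageI)
  then have "hoop_isomorphic A (wajsberg_algebra P)"
    unfolding hoop_isomorphic_def by (intro bexI[OF _ hom])
  moreover have "pointed_z_retract P"
    unfolding pointed_z_retract_def by (intro exI[of _ \<zeta>] conjI ret refl)
  ultimately show ?thesis by (intro that)
qed

theorem theorem5p3:
  fixes A :: "'a hoop"
  assumes "hoop_algebra A"
  shows "n_generated CARD('n::finite) A
           \<and> projective_hoop TYPE('b::infinite) TYPE('c::infinite) A
         \<longleftrightarrow> (\<exists>P :: (real ^ 'n) set. pointed_z_retract P
               \<and> hoop_isomorphic A (wajsberg_algebra P))"
proof
  assume *: "n_generated CARD('n) A \<and> projective_hoop TYPE('b) TYPE('c) A"
  obtain P :: "(real ^ 'n) set" where "pointed_z_retract P" "hoop_isomorphic A (wajsberg_algebra P)"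
    by (rule projective_imp_retract[OF assms conjunct1[OF *] conjunct2[OF *]]) (rule that)
  then show "\<exists>P :: (real ^ 'n) set. pointed_z_retract P \<and> hoop_isomorphic A (wajsberg_algebra P)"
    by blast
next
  assume "\<exists>P :: (real ^ 'n) set. pointed_z_retract P \<and> hoop_isomorphic A (wajsberg_algebra P)"
  then obtain \<zeta> :: "real ^ 'n \<Rightarrow> real ^ 'n" and \<phi> where "pointed_z_retraction \<zeta>"
    "\<phi> \<in> hoop_hom A (wajsberg_algebra (\<zeta> ` unit_cube))"
    "bij_betw \<phi> (carrier A) (carrier (wajsberg_algebra (\<zeta> ` unit_cube)))"
    unfolding pointed_z_retract_def hoop_isomorphic_def by blast
  then show "n_generated CARD('n) A \<and> projective_hoop TYPE('b) TYPE('c) A"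
    by (intro conjI retract_imp_projective[OF assms])
qed

end
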